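(* Let $L\in A(\omega)$, $\omega\in D$. The boundary value problem $L$ has a countable set of eigenvalues $\{\lambda_{nq}\}_{n\ge0,\,q=\overline{1,m}}$ (counted with multiplicities), and, for $n\ge1$, $$\rho_{nq}=\sqrt{\lambda_{nq}}=n+\frac{\omega_q}{\pi n}+\frac{\kappa_{nq}}{n},\qquad \{\kappa_{nq}\}_{n}\in \ell_2,\quad q=\overline{1,m}.$$
   Context: Fix $m\ge 1$; $q=\overline{1,m}$ means $q=1,\dots,m$. $L=L(Q(x),h,H)$ denotes the boundary value problem $$\ell Y:=-Y''+Q(x)Y=\lambda Y,\ x\in(0,\pi),\qquad U(Y):=Y'(0)-hY(0)=0,\quad V(Y):=Y'(\pi)+HY(\pi)=0,$$ where $Y$ is a column vector of length $m$, $Q$ is an $m\times m$ matrix function with entries in $L_2(0,\pi)$ (complex-valued), $h,H$ are complex $m\times m$ matrices, and (standing assumption) $Q=Q^*$, $h=h^*$, $H=H^*$. The multiplicity of an eigenvalue is the number of corresponding linearly independent vector eigenfunctions. For $\omega=\omega^*$, $L\in A(\omega)$ means that $h+H+\frac12\int_0^\pi Q(x)\,dx=\omega$. $D$ is the set of real diagonal matrices $\omega=\mathrm{diag}\{\omega_1,\dots,\omega_m\}$ with $\omega_1\le\dots\le\omega_m$. $\sqrt{\lambda}$ is the branch with $\mathrm{Re}\sqrt\lambda\ge0$. *)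

theory Defs
  imports "HOL-Analysis.Analysis" "HOL-Library.Function_Algebras"
begin

definition conj_transpose :: "complex^'m^'m \<Rightarrow> complex^'m^'m" where
  "conj_transpose A = (\<chi> i j. cnj (A $ j $ i))"

definition hermitian :: "complex^'m^'m \<Rightarrow> bool" where
  "hermitian A \<longleftrightarrow> conj_transpose A = A"

text \<open>Absolute continuity on a compact interval; a finite family of subintervals
  \<open>(u, v)\<close> is encoded as a finite set of pairs of endpoints.\<close>

definition absolutely_continuous_on_interval ::
    "real \<Rightarrow> real \<Rightarrow> (real \<Rightarrow> 'a::real_normed_vector) \<Rightarrow> bool" where
  "absolutely_continuous_on_interval a b f \<longleftrightarrow>
     (\<forall>\<epsilon>>0. \<exists>\<delta>>0. \<forall>I::(real \<times> real) set.
        finite I \<and> (\<forall>(u, v)\<in>I. a \<le> u \<and> u \<le> v \<and> v \<le> b) \<and>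
        pairwise (\<lambda>(u, v) (u', v'). {u<..<v} \<inter> {u'<..<v'} = {}) I \<and>
        (\<Sum>(u, v)\<in>I. v - u) < \<delta>
        \<longrightarrow> (\<Sum>(u, v)\<in>I. norm (f v - f u)) < \<epsilon>)"

definition L2_entries :: "(real \<Rightarrow> complex^'m^'m) \<Rightarrow> bool" where
  "L2_entries Q \<longleftrightarrow>
     (\<forall>i j. (\<lambda>x. Q x $ i $ j) \<in> borel_measurable (lebesgue_on {0<..<pi}) \<and>
            integrable (lebesgue_on {0<..<pi}) (\<lambda>x. (norm (Q x $ i $ j))\<^sup>2))"

text \<open>As \<open>Q\<close> is an \<open>L\<^sub>2\<close> function, the identity \<open>Q = Q\<^sup>*\<close> is required almost everywhere.\<close>

definition selfadjoint_problem ::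
    "(real \<Rightarrow> complex^'m^'m) \<Rightarrow> complex^'m^'m \<Rightarrow> complex^'m^'m \<Rightarrow> bool" where
  "selfadjoint_problem Q h H \<longleftrightarrow>
     L2_entries Q \<and> (AE x in lebesgue_on {0<..<pi}. hermitian (Q x)) \<and>
     hermitian h \<and> hermitian H"

text \<open>The derivative on \<open>[0, \<pi>]\<close>, one-sided at the end points.\<close>

definition deriv_I :: "(real \<Rightarrow> complex^'m) \<Rightarrow> real \<Rightarrow> complex^'m" where
  "deriv_I Y x = vector_derivative Y (at x within {0..pi})"

text \<open>Since \<open>Q\<close> is only square integrable, the equation \<open>- Y'' + Q Y = \<lambda> Y\<close> is understood in the
  sense of Caratheodory: \<open>Y\<close> is differentiable with absolutely continuous derivative
  on \<open>[0, \<pi>]\<close>, and the equation holds almost everywhere.\<close>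

definition solves :: "(real \<Rightarrow> complex^'m^'m) \<Rightarrow> complex \<Rightarrow> (real \<Rightarrow> complex^'m) \<Rightarrow> bool" where
  "solves Q z Y \<longleftrightarrow>
     Y differentiable_on {0..pi} \<and>
     absolutely_continuous_on_interval 0 pi (deriv_I Y) \<and>
     (AE x in lebesgue_on {0<..<pi}.
        \<exists>Y2. (deriv_I Y has_vector_derivative Y2) (at x) \<and> - Y2 + Q x *v Y x = z *s Y x)"

definition bc_U :: "complex^'m^'m \<Rightarrow> (real \<Rightarrow> complex^'m) \<Rightarrow> complex^'m" where
  "bc_U h Y = deriv_I Y 0 - h *v Y 0"

definition bc_V :: "complex^'m^'m \<Rightarrow> (real \<Rightarrow> complex^'m) \<Rightarrow> complex^'m" where
  "bc_V H Y = deriv_I Y pi + H *v Y pi"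

text \<open>Functions on \<open>[0, \<pi>]\<close> are represented by functions on the real line vanishing outside
  \<open>[0, \<pi>]\<close>, so that equality and linear independence refer to values on \<open>[0, \<pi>]\<close> only.\<close>

definition eigenspace ::
    "(real \<Rightarrow> complex^'m^'m) \<Rightarrow> complex^'m^'m \<Rightarrow> complex^'m^'m \<Rightarrow> complex \<Rightarrow> (real \<Rightarrow> complex^'m) set" where
  "eigenspace Q h H z =
     {Y. solves Q z Y \<and> bc_U h Y = 0 \<and> bc_V H Y = 0 \<and> (\<forall>x. x \<notin> {0..pi} \<longrightarrow> Y x = 0)}"

definition is_eigenvalue ::
    "(real \<Rightarrow> complex^'m^'m) \<Rightarrow> complex^'m^'m \<Rightarrow> complex^'m^'m \<Rightarrow> complex \<Rightarrow> bool" where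
  "is_eigenvalue Q h H z \<longleftrightarrow> (\<exists>Y\<in>eigenspace Q h H z. Y \<noteq> 0)"

definition scaleF :: "complex \<Rightarrow> (real \<Rightarrow> complex^'m) \<Rightarrow> real \<Rightarrow> complex^'m" where
  "scaleF c Y = (\<lambda>x. c *s Y x)"

global_interpretation vfun: vector_space "scaleF :: complex \<Rightarrow> (real \<Rightarrow> complex^'m) \<Rightarrow> _"
  by unfold_locales
    (auto simp: scaleF_def fun_eq_iff vec.scale_right_distrib vec.scale_left_distrib)

definition multiplicity_ev ::
    "(real \<Rightarrow> complex^'m^'m) \<Rightarrow> complex^'m^'m \<Rightarrow> complex^'m^'m \<Rightarrow> complex \<Rightarrow> nat" where
  "multiplicity_ev Q h H z = vfun.dim (eigenspace Q h H z)"

text \<open>\<open>lam\<close> lists the eigenvalues, each one exactly as often as its multiplicity.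
  In particular multiplicities are asserted to be finite: every fibre over an eigenvalue is finite
  and nonempty, so the dimension is not the value \<open>0\<close> that \<open>dim\<close> assigns to spaces of infinite
  dimension.\<close>

definition enumerates_eigenvalues ::
    "(real \<Rightarrow> complex^'m^'m) \<Rightarrow> complex^'m^'m \<Rightarrow> complex^'m^'m \<Rightarrow> (nat \<Rightarrow> 'm \<Rightarrow> complex) \<Rightarrow> bool" where
  "enumerates_eigenvalues Q h H lam \<longleftrightarrow>
     {z. is_eigenvalue Q h H z} = {lam n q |n q. True} \<and>
     (\<forall>z. is_eigenvalue Q h H z \<longrightarrow>
        finite {(n, q). lam n q = z} \<and> card {(n, q). lam n q = z} = multiplicity_ev Q h H z)"

definition class_A ::
    "complex^'m^'m \<Rightarrow> (real \<Rightarrow> complex^'m^'m) \<Rightarrow> complex^'m^'m \<Rightarrow> complex^'m^'m \<Rightarrow> bool" where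
  "class_A \<omega> Q h H \<longleftrightarrow>
     h + H + (1/2) *\<^sub>R (LINT x|lebesgue_on {0<..<pi}. Q x) = \<omega>"

text \<open>A finite linearly ordered index type \<open>'m\<close> plays the role of \<open>1, \<dots>, m\<close>.\<close>

definition diag_D :: "(complex^('m::{finite,linorder})^('m::{finite,linorder})) set" where
  "diag_D = {\<omega>. \<exists>d::'m \<Rightarrow> real. mono d \<and>
     \<omega> = (\<chi> i j. if i = j then complex_of_real (d i) else 0)}"

end

theory Submission
  imports Defs "HOL-Complex_Analysis.Complex_Analysis"
begin

text \<open>For the solution \<open>\<phi>(x, \<mu>) c\<close> of the equation with initial values \<open>c\<close>, \<open>h c\<close> put
  \<open>\<Delta>(\<mu>) c = V(\<phi>(\<cdot>, \<mu>) c)\<close>. The eigenvalues are the zeros of the entire function \<open>det \<Delta>\<close>.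
  Lagrange's identity pairs \<open>\<Delta>'(\<mu>) c\<close>, for \<open>c\<close> in the kernel of \<open>\<Delta>(\<mu>)\<close>, with \<open>\<phi>(\<pi>, \<mu>) c\<close> to
  \<open>- \<integral> |\<phi> c|\<^sup>2\<close>; hence eigenvalues are real, and the order of a zero is the dimension of the kernel,
  that is, the multiplicity of the eigenvalue.

  Variation of constants gives, with \<open>\<tau> = |Im \<rho>|\<close> and as \<open>|\<rho>| \<rightarrow> \<infinity>\<close>,
  \<open>\<Delta>(\<rho>\<^sup>2) = - \<rho> sin \<rho>\<pi> I + cos \<rho>\<pi> \<omega> + 1/2 \<integral> cos \<rho>(\<pi> - 2t) Q(t) dt + O(exp(\<tau>\<pi>) / |\<rho>|)\<close>.
  Rouche's theorem on the circles \<open>|\<mu>| = (N + 1/2)\<^sup>2\<close> shows that they enclose as many eigenvalues as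
  for \<open>Q = h = H = 0\<close>, that is, \<open>(N + 1) m\<close>. Near \<open>n\<^sup>2\<close> the matrix \<open>(-1)\<^sup>n \<Delta>(n\<^sup>2 + \<zeta>)\<close> differs from
  \<open>\<omega> - \<pi>\<zeta>/2\<close> by a quantity which is square summable in \<open>n\<close>, by Bessel's inequality for
  \<open>cos 2nt\<close>. Rouche's theorem on circles around \<open>n\<^sup>2 + 2 \<omega>\<^sub>q / \<pi>\<close> with square summable radii then
  localizes all remaining eigenvalues.\<close>

section \<open>Absolutely continuous functions\<close>

text \<open>Since \<open>Q\<close> is merely square integrable, solutions have an absolutely
  continuous derivative and satisfy the equation only almost everywhere. Lagrange's identity and
  variation of constants therefore rest on the fundamental theorem for absolutely continuous
  functions, and the way back from the Volterra equation to the differential equation rests on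
  Lebesgue differentiation. Origin of the centres: if \<rho>^2 = n^2 + \<zeta>, then \<rho> - n is
  about \<zeta>/(2n), so \<rho> sin \<rho>\<pi> is about (-1)^n \<pi>\<zeta>/2. The delicate point
  is square summability of the radii. An absolute error bound for a determinant whose m diagonal
  entries may all be small would only give radii like an m-th root of the error. Determinants are
  instead compared relative to each diagonal entry, which keeps the radii linear in the error of the
  matrix entries. Equal \<omega>_q are not separated: one circle per distinct value encloses as many
  eigenvalues as there are such q. Together these are m, which is all that two consecutive large
  circles leave room for between them.\<close>

definition interval_family :: "real \<Rightarrow> real \<Rightarrow> (real \<times> real) set \<Rightarrow> bool" where
  "interval_family a b I \<longleftrightarrow> finite I \<and> (\<forall>(u, v)\<in>I. a \<le> u \<and> u \<le> v \<and> v \<le> b) \<and>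
     pairwise (\<lambda>(u, v) (u', v'). {u<..<v} \<inter> {u'<..<v'} = {}) I"

lemma ac_iff:
  "absolutely_continuous_on_interval a b f \<longleftrightarrow>
     (\<forall>\<epsilon>>0. \<exists>\<delta>>0. \<forall>I. interval_family a b I \<longrightarrow> (\<Sum>(u, v)\<in>I. v - u) < \<delta> \<longrightarrow>
        (\<Sum>(u, v)\<in>I. norm (f v - f u)) < \<epsilon>)"
  unfolding absolutely_continuous_on_interval_def interval_family_def by (simp only: conj_assoc imp_conjL)

lemma ac_obtain:
  assumes "absolutely_continuous_on_interval a b f" "\<epsilon> > 0"
  obtains \<delta> where "\<delta> > 0"
    "\<And>I. interval_family a b I \<Longrightarrow> (\<Sum>(u, v)\<in>I. v - u) < \<delta> \<Longrightarrow> (\<Sum>(u, v)\<in>I. norm (f v - f u)) < \<epsilon>"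
  using assms unfolding ac_iff by blast

lemma interval_familyD:
  assumes "interval_family a b I"
  shows "finite I" "(u, v) \<in> I \<Longrightarrow> a \<le> u \<and> u \<le> v \<and> v \<le> b"
    "i \<in> I \<Longrightarrow> a \<le> fst i \<and> fst i \<le> snd i \<and> snd i \<le> b"
    "i \<in> I \<Longrightarrow> j \<in> I \<Longrightarrow> i \<noteq> j \<Longrightarrow> {fst i<..<snd i} \<inter> {fst j<..<snd j} = {}"
  using assms unfolding interval_family_def pairwise_def split_beta' by fastforce+

text \<open>Turns containment in an open set of small measure into the smallness hypothesis of
  absolute continuity.\<close>

lemma sum_lengths_le_measure:
  fixes U :: "real set"
  assumes I: "interval_family a b I"
    and sub: "\<And>i. i \<in> I \<Longrightarrow> {fst i<..<snd i} \<subseteq> U" and U: "U \<in> lmeasurable"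
  shows "(\<Sum>(u, v)\<in>I. v - u) \<le> measure lebesgue U"
proof -
  note I' = interval_familyD[OF I]
  have "measure lebesgue (\<Union>i\<in>I. {fst i<..<snd i}) = (\<Sum>i\<in>I. measure lebesgue {fst i<..<snd i})"
    by (rule measure_UNION') (use I'(1,4) in \<open>simp_all add: pairwise_def disjnt_def\<close>)
  also have "\<dots> = (\<Sum>(u, v)\<in>I. v - u)"
    by (rule sum.cong) (use I'(3) in \<open>auto simp: split_beta\<close>)
  finally have "(\<Sum>(u, v)\<in>I. v - u) = measure lebesgue (\<Union>i\<in>I. {fst i<..<snd i})" by simp
  also have "\<dots> \<le> measure lebesgue U"
    by (rule measure_mono_fmeasurable) (use I'(1) sub U in \<open>auto intro!: sets.finite_UN\<close>)
  finally show ?thesis .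
qed

text \<open>On the exceptional null set the gauge is an open set of small measure; the part of a fine
  division tagged there is controlled by absolute continuity.\<close>

lemma ac_fundamental_theorem:
  fixes f :: "real \<Rightarrow> 'a::euclidean_space"
  assumes ab: "a \<le> b" and ac: "absolutely_continuous_on_interval a b f"
    and N: "negligible N"
    and der: "\<And>x. x \<in> {a<..<b} - N \<Longrightarrow> (f has_vector_derivative g x) (at x)"
  shows "(g has_integral (f b - f a)) {a..b}"
proof -
  \<comment> \<open>The derivative is given only in the open interval, so the end points are counted
    among the exceptional points; there \<open>g\<close> is replaced by 0, which changes no
    integral.\<close>
  define M where "M = N \<union> {a, b}"
  have M: "negligible M" unfolding M_def using N by (simp add: negligible_Un)
  define g' where "g' x = (if x \<in> M then 0 else g x)" for x
  have "(g' has_integral (f b - f a)) (cbox a b)"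
    unfolding has_integral
  proof (intro allI impI)
    fix e :: real assume e: "e > 0"
    \<comment> \<open>The differentiable part of a division contributes at most
      \<open>\<eta> * (b - a) < e / 2\<close>; the summand 1 covers the case
      \<open>a = b\<close>.\<close>
    define \<eta> where "\<eta> = e / (2 * (b - a + 1))"
    have eta: "\<eta> > 0" "\<eta> * (b - a) < e / 2" using e ab by (auto simp: \<eta>_def field_simps)
    obtain \<delta> where d: "\<delta> > 0" and \<delta>:
      "\<And>I. interval_family a b I \<Longrightarrow> (\<Sum>(u, v)\<in>I. v - u) < \<delta> \<Longrightarrow> (\<Sum>(u, v)\<in>I. norm (f v - f u)) < e / 2"
      using ac_obtain[OF ac, of "e / 2"] e by (metis half_gt_zero)
    obtain U where U: "open U" "M \<subseteq> U" "U - M \<in> lmeasurable" "emeasure lebesgue (U - M) < ennreal \<delta>"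
      using sets_lebesgue_outer_open[of M \<delta>] d M negligible_imp_sets by blast
    have Ueq: "U = (U - M) \<union> M" using U by auto
    have Um: "U \<in> lmeasurable" using U(3) M Ueq by (metis fmeasurable.Un negligible_imp_measurable)
    have "measure lebesgue U \<le> measure lebesgue (U - M) + measure lebesgue M"
      by (subst Ueq) (intro measure_Un_le, use U M negligible_imp_sets in auto)
    also have "\<dots> = measure lebesgue (U - M)" using M by (simp add: negligible_imp_measure0)
    also have "\<dots> < \<delta>" using U(3,4) d
      by (metis emeasure_eq_measure2 ennreal_less_iff measure_nonneg)
    finally have Ud: "measure lebesgue U < \<delta>" .
    have "\<forall>x. \<exists>r>0. x \<in> {a..b} - M \<longrightarrow>
        (\<forall>y. norm (y - x) < r \<longrightarrow> norm (f y - f x - (y - x) *\<^sub>R g x) \<le> \<eta> * norm (y - x))"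
    proof
      fix x
      show "\<exists>r>0. x \<in> {a..b} - M \<longrightarrow>
        (\<forall>y. norm (y - x) < r \<longrightarrow> norm (f y - f x - (y - x) *\<^sub>R g x) \<le> \<eta> * norm (y - x))"
      proof (cases "x \<in> {a..b} - M")
        case True
        then have "x \<in> {a<..<b} - N" by (auto simp: M_def)
        from der[OF this] show ?thesis
          using eta(1) unfolding has_vector_derivative_def has_derivative_at_alt by blast
      qed (auto intro: exI[of _ 1])
    qed
    then obtain r where r: "\<And>x. r x > 0" "\<And>x y. x \<in> {a..b} - M \<Longrightarrow> norm (y - x) < r x \<Longrightarrow>
        norm (f y - f x - (y - x) *\<^sub>R g x) \<le> \<eta> * norm (y - x)"
      by metis
    define \<gamma> where "\<gamma> x = (if x \<in> M then U else ball x (r x))" for x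
    have gau: "gauge \<gamma>" unfolding gauge_def \<gamma>_def using U r by auto
    show "\<exists>\<gamma>. gauge \<gamma> \<and> (\<forall>\<D>. \<D> tagged_division_of cbox a b \<and> \<gamma> fine \<D> \<longrightarrow>
             norm ((\<Sum>(x, k)\<in>\<D>. measure lborel k *\<^sub>R g' x) - (f b - f a)) < e)"
    proof (rule exI[of _ \<gamma>], intro conjI gau allI impI)
      fix p assume "p tagged_division_of cbox a b \<and> \<gamma> fine p"
      then have p: "p tagged_division_of cbox a b" and fine: "\<gamma> fine p" by auto
      note pD = tagged_division_ofD[OF p]
      have K: "K = {Inf K..Sup K} \<and> a \<le> Inf K \<and> Inf K \<le> x \<and> x \<le> Sup K \<and> Sup K \<le> b \<and> K \<noteq> {} \<and> measure lborel K = Sup K - Inf K"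
        if xK: "(x, K) \<in> p" for x K
      proof -
        obtain u v where uv: "K = cbox u v" using pD(4)[OF xK] by blast
        have "x \<in> K" "K \<subseteq> {a..b}" using pD(2,3)[OF xK] by auto
        then show ?thesis using uv by auto
      qed
      have ba: "b - a = (\<Sum>(x,K)\<in>p. Sup K - Inf K)" "f b - f a = (\<Sum>(x,K)\<in>p. f(Sup K) - f(Inf K))"
        using additive_tagged_division_1[where f= "\<lambda>x. x"] additive_tagged_division_1[where f= f] ab p by auto
      let ?p1 = "{(x, K) \<in> p. x \<in> M}" and ?p2 = "{(x, K) \<in> p. x \<notin> M}"
      have fin: "finite ?p1" "finite ?p2" by (auto intro: finite_subset[OF _ pD(1)])
      have pun: "p = ?p1 \<union> ?p2" "?p1 \<inter> ?p2 = {}" by auto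
      let ?h = "\<lambda>(x, K). measure lborel K *\<^sub>R g' x - (f (Sup K) - f (Inf K))"
      have "(\<Sum>(x, k)\<in>p. measure lborel k *\<^sub>R g' x) - (f b - f a) = sum ?h p"
        unfolding ba by (simp add: sum_subtractf split_beta)
      also have "\<dots> = sum ?h ?p1 + sum ?h ?p2"
        by (subst pun(1)) (rule sum.union_disjoint[OF fin pun(2)])
      finally have eq: "(\<Sum>(x, k)\<in>p. measure lborel k *\<^sub>R g' x) - (f b - f a) = sum ?h ?p1 + sum ?h ?p2" .
      \<comment> \<open>Straddle estimate: the increment of \<open>f\<close> over an interval is
        split at its tag, and both halves are compared with the same derivative
        \<open>g x\<close>.\<close>
      have "norm (sum ?h ?p2) \<le> (\<Sum>(x, K)\<in>?p2. \<eta> * (Sup K - Inf K))"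
      proof (rule sum_norm_le)
        fix z assume "z \<in> ?p2"
        then obtain x K where z: "z = (x, K)" "(x, K) \<in> p" "x \<notin> M" by auto
        note Kx = K[OF z(2)]
        have x: "x \<in> {a..b} - M" using Kx z by auto
        have "K \<subseteq> ball x (r x)" using fineD[OF fine z(2)] z(3) by (simp add: \<gamma>_def)
        moreover have "Inf K \<in> K" "Sup K \<in> K"
          using Kx by (metis atLeastAtMost_iff order_refl order_trans)+
        ultimately have "norm (Inf K - x) < r x" "norm (Sup K - x) < r x"
          by (auto simp: dist_norm norm_minus_commute subset_iff)
        from r(2)[OF x this(1)] r(2)[OF x this(2)]
        have "norm (f (Inf K) - f x - (Inf K - x) *\<^sub>R g x) \<le> \<eta> * (x - Inf K)"
          "norm (f (Sup K) - f x - (Sup K - x) *\<^sub>R g x) \<le> \<eta> * (Sup K - x)"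
          using Kx by auto
        moreover have "?h z = (f (Inf K) - f x - (Inf K - x) *\<^sub>R g x) - (f (Sup K) - f x - (Sup K - x) *\<^sub>R g x)"
        proof -
          have "measure lborel K *\<^sub>R g x = Sup K *\<^sub>R g x - Inf K *\<^sub>R g x"
            using Kx by (simp add: scaleR_left_diff_distrib[symmetric])
          then show ?thesis using z(1,3) by (simp add: g'_def algebra_simps)
        qed
        ultimately have "norm (?h z) \<le> \<eta> * (x - Inf K) + \<eta> * (Sup K - x)"
          by (smt (verit) norm_triangle_ineq4)
        then show "norm (?h z) \<le> (case z of (x, K) \<Rightarrow> \<eta> * (Sup K - Inf K))"
          using z by (simp add: algebra_simps)
      qed
      also have "\<dots> \<le> (\<Sum>(x, K)\<in>p. \<eta> * (Sup K - Inf K))"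
        using eta K by (intro sum_mono2 pD(1)) (fastforce intro!: mult_nonneg_nonneg)+
      also have "\<dots> = \<eta> * (b - a)" unfolding ba by (simp add: sum_distrib_left split_beta)
      finally have n2: "norm (sum ?h ?p2) < e / 2" using eta by simp
      \<comment> \<open>Without one-point intervals, distinct members with equal end points would
        have interiors that are nonempty, equal and disjoint; this gives injectivity of
        \<open>\<phi>\<close>. The discarded intervals have zero increment.\<close>
      define p3 where "p3 = {(x, K) \<in> ?p1. Inf K < Sup K}"
      have fin3: "finite p3" unfolding p3_def by (rule finite_subset[OF _ fin(1)]) auto
      define \<phi> where "\<phi> = (\<lambda>(x::real, K::real set). (Inf K, Sup K))"
      have disj: "{Inf K<..<Sup K} \<inter> {Inf K'<..<Sup K'} = {}" if "(x, K) \<in> p3" "(x', K') \<in> p3" "(x, K) \<noteq> (x', K')" for x x' K K'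
      proof -
        have p: "(x, K) \<in> p" "(x', K') \<in> p" using that by (auto simp: p3_def)
        have "interior K \<inter> interior K' = {}" by (rule pD(5)[OF p that(3)])
        moreover have "{Inf K<..<Sup K} = interior K" using K[OF p(1)] by (metis interior_atLeastAtMost_real)
        moreover have "{Inf K'<..<Sup K'} = interior K'" using K[OF p(2)] by (metis interior_atLeastAtMost_real)
        ultimately show ?thesis by simp
      qed
      have inj: "inj_on \<phi> p3"
      proof (rule inj_onI, rule ccontr)
        fix z z' assume z: "z \<in> p3" "z' \<in> p3" "\<phi> z = \<phi> z'" "z \<noteq> z'"
        obtain x K x' K' where zz: "z = (x, K)" "z' = (x', K')" by fastforce
        have "{Inf K<..<Sup K} \<inter> {Inf K'<..<Sup K'} = {}" using disj z zz by blast
        moreover have "Inf K = Inf K'" "Sup K = Sup K'" using z zz by (auto simp: \<phi>_def)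
        moreover have "Inf K < Sup K" using z zz by (auto simp: p3_def)
        ultimately show False by auto
      qed
      have pw: "pairwise (\<lambda>(u, v) (u', v'). {u<..<v} \<inter> {u'<..<v'} = {}) (\<phi> ` p3)"
        unfolding pairwise_def using disj by (fastforce simp: \<phi>_def)
      have bd: "a \<le> u \<and> u \<le> v \<and> v \<le> b \<and> {u<..<v} \<subseteq> U" if uv: "(u, v) \<in> \<phi> ` p3" for u v
      proof -
        obtain x K where xK: "(x, K) \<in> p3" "u = Inf K" "v = Sup K" using uv by (auto simp: \<phi>_def)
        then have p: "(x, K) \<in> p" "x \<in> M" by (auto simp: p3_def)
        have "K \<subseteq> U" using fineD[OF fine p(1)] p(2) by (simp add: \<gamma>_def)
        moreover have "{Inf K<..<Sup K} \<subseteq> K"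
          using K[OF p(1)] by (metis greaterThanLessThan_subseteq_atLeastAtMost_iff order_refl)
        ultimately show ?thesis using K[OF p(1)] xK by auto
      qed
      have sub: "{fst i<..<snd i} \<subseteq> U" if "i \<in> \<phi> ` p3" for i
        using bd[of "fst i" "snd i"] that by simp
      have fam: "interval_family a b (\<phi> ` p3)"
        unfolding interval_family_def using fin3 pw bd by blast
      have "(\<Sum>(u, v)\<in>\<phi> ` p3. v - u) \<le> measure lebesgue U"
        by (rule sum_lengths_le_measure[OF fam sub Um])
      then have "(\<Sum>(u, v)\<in>\<phi> ` p3. norm (f v - f u)) < e / 2"
        using \<delta>[OF fam] Ud by simp
      moreover have "(\<Sum>(u, v)\<in>\<phi> ` p3. norm (f v - f u)) = (\<Sum>(x, K)\<in>p3. norm (f (Sup K) - f (Inf K)))"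
        by (subst sum.reindex[OF inj]) (simp add: \<phi>_def split_beta)
      moreover have "(\<Sum>(x, K)\<in>p3. norm (f (Sup K) - f (Inf K))) = (\<Sum>(x, K)\<in>?p1. norm (f (Sup K) - f (Inf K)))"
      proof (rule sum.mono_neutral_left[OF fin(1)])
        show "\<forall>i\<in>?p1 - p3. (case i of (x, K) \<Rightarrow> norm (f (Sup K) - f (Inf K))) = 0"
        proof
          fix z assume "z \<in> ?p1 - p3"
          then obtain x K where z: "z = (x, K)" "(x, K) \<in> p" "\<not> Inf K < Sup K" by (auto simp: p3_def)
          then have "Inf K = Sup K" using K[OF z(2)] by linarith
          then show "(case z of (x, K) \<Rightarrow> norm (f (Sup K) - f (Inf K))) = 0" using z by simp
        qed
      qed (auto simp: p3_def)
      moreover have "norm (sum ?h ?p1) \<le> (\<Sum>(x, K)\<in>?p1. norm (f (Sup K) - f (Inf K)))"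
        by (rule sum_norm_le) (auto simp: g'_def norm_minus_commute)
      ultimately have "norm (sum ?h ?p1) < e / 2" by linarith
      with n2 show "norm ((\<Sum>(x, k)\<in>p. measure lborel k *\<^sub>R g' x) - (f b - f a)) < e"
        unfolding eq using norm_triangle_ineq[of "sum ?h ?p1" "sum ?h ?p2"] by linarith
    qed
  qed
  then have "(g' has_integral (f b - f a)) {a..b}" by simp
  then show ?thesis
    by (rule has_integral_spike[OF M, rotated]) (auto simp: g'_def)
qed

lemma ac_continuous_on:
  assumes "absolutely_continuous_on_interval a b f"
  shows "continuous_on {a..b} f"
  unfolding continuous_on_iff
proof (intro ballI allI impI)
  fix x e :: real assume x: "x \<in> {a..b}" and e: "e > 0"
  obtain \<delta> where d: "\<delta> > 0" and \<delta>:
      "\<And>I. interval_family a b I \<Longrightarrow> (\<Sum>(u, v)\<in>I. v - u) < \<delta> \<Longrightarrow> (\<Sum>(u, v)\<in>I. norm (f v - f u)) < e"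
    using ac_obtain[OF assms e] by metis
  have "dist (f y) (f x) < e" if y: "y \<in> {a..b}" "dist y x < \<delta>" for y
    using \<delta>[of "{(min x y, max x y)}"] x y
    by (cases "x \<le> y") (auto simp: interval_family_def dist_norm norm_minus_commute min_def max_def)
  then show "\<exists>d>0. \<forall>x'\<in>{a..b}. dist x' x < d \<longrightarrow> dist (f x') (f x) < e" using d by blast
qed

lemma ac_subinterval:
  assumes f: "absolutely_continuous_on_interval a b f" and ab: "a \<le> c" "d \<le> b"
  shows "absolutely_continuous_on_interval c d f"
proof -
  have "interval_family a b I" if "interval_family c d I" for I
    using that ab unfolding interval_family_def by fastforce
  then show ?thesis using f unfolding ac_iff by meson
qed

text \<open>Common source of the closure properties below: congruence, sums and bilinear products
  each reduce to an estimate of increments.\<close>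

lemma ac_dominated:
  assumes f: "absolutely_continuous_on_interval a b f"
    and g: "absolutely_continuous_on_interval a b g"
    and le: "\<And>u v. a \<le> u \<Longrightarrow> u \<le> v \<Longrightarrow> v \<le> b \<Longrightarrow>
      norm (k v - k u) \<le> M * (norm (f v - f u) + norm (g v - g u))"
  shows "absolutely_continuous_on_interval a b k"
  unfolding ac_iff
proof (intro allI impI)
  fix e :: real assume e: "e > 0"
  define C where "C = \<bar>M\<bar> + 1"
  have C: "C > 0" by (simp add: C_def)
  have e': "e / (2 * C) > 0" using e C by simp
  obtain d1 where d1: "d1 > 0" and \<delta>1:
      "\<And>I. interval_family a b I \<Longrightarrow> (\<Sum>(u, v)\<in>I. v - u) < d1 \<Longrightarrow> (\<Sum>(u, v)\<in>I. norm (f v - f u)) < e / (2 * C)"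
    using ac_obtain[OF f e'] by metis
  obtain d2 where d2: "d2 > 0" and \<delta>2:
      "\<And>I. interval_family a b I \<Longrightarrow> (\<Sum>(u, v)\<in>I. v - u) < d2 \<Longrightarrow> (\<Sum>(u, v)\<in>I. norm (g v - g u)) < e / (2 * C)"
    using ac_obtain[OF g e'] by metis
  have "(\<Sum>(u, v)\<in>I. norm (k v - k u)) < e" if I: "interval_family a b I" "(\<Sum>(u, v)\<in>I. v - u) < min d1 d2" for I
  proof -
    have "(\<Sum>(u, v)\<in>I. norm (k v - k u)) \<le> (\<Sum>(u, v)\<in>I. C * (norm (f v - f u) + norm (g v - g u)))"
    proof (rule sum_mono, clarify)
      fix u v assume "(u, v) \<in> I"
      then have "norm (k v - k u) \<le> M * (norm (f v - f u) + norm (g v - g u))"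
        using le interval_familyD(2)[OF I(1)] by blast
      also have "\<dots> \<le> C * (norm (f v - f u) + norm (g v - g u))"
        by (intro mult_right_mono) (auto simp: C_def)
      finally show "norm (k v - k u) \<le> C * (norm (f v - f u) + norm (g v - g u))" .
    qed
    also have "\<dots> = C * ((\<Sum>(u, v)\<in>I. norm (f v - f u)) + (\<Sum>(u, v)\<in>I. norm (g v - g u)))"
      by (simp add: split_beta sum_distrib_left flip: sum.distrib)
    also have "\<dots> < C * (e / (2 * C) + e / (2 * C))"
      using \<delta>1[OF I(1)] \<delta>2[OF I(1)] I(2) C by (intro mult_strict_left_mono add_strict_mono) auto
    also have "\<dots> = e" using C by (simp add: field_simps)
    finally show ?thesis .
  qed
  then show "\<exists>\<delta>>0. \<forall>I. interval_family a b I \<longrightarrow> (\<Sum>(u, v)\<in>I. v - u) < \<delta> \<longrightarrow> (\<Sum>(u, v)\<in>I. norm (k v - k u)) < e"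
    using d1 d2 by (intro exI[of _ "min d1 d2"]) simp
qed

lemma ac_cong:
  assumes "absolutely_continuous_on_interval a b f" "\<And>x. x \<in> {a..b} \<Longrightarrow> f x = g x"
  shows "absolutely_continuous_on_interval a b g"
  by (rule ac_dominated[OF assms(1,1), of _ 1]) (use assms(2) in \<open>simp flip: assms(2)\<close>)

lemma ac_add:
  assumes "absolutely_continuous_on_interval a b f" "absolutely_continuous_on_interval a b g"
  shows "absolutely_continuous_on_interval a b (\<lambda>x. f x + g x)"
  by (rule ac_dominated[OF assms, of _ 1]) (simp add: add_diff_add norm_triangle_ineq)

lemma (in bounded_bilinear) ac_bilinear:
  assumes f: "absolutely_continuous_on_interval a b f"
    and g: "absolutely_continuous_on_interval a b g"
  shows "absolutely_continuous_on_interval a b (\<lambda>x. prod (f x) (g x))"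
proof -
  obtain K where K: "K > 0" "\<And>x y. norm (prod x y) \<le> norm x * norm y * K" using pos_bounded by blast
  have "bounded (f ` {a..b})" "bounded (g ` {a..b})"
    by (intro compact_imp_bounded compact_continuous_image ac_continuous_on f g compact_Icc)+
  then obtain Bf Bg where B: "Bf > 0" "Bg > 0" "\<And>x. x \<in> {a..b} \<Longrightarrow> norm (f x) \<le> Bf"
    "\<And>x. x \<in> {a..b} \<Longrightarrow> norm (g x) \<le> Bg"
    unfolding bounded_pos by (metis imageI)
  show ?thesis
  proof (rule ac_dominated[OF f g, of _ "(Bf + Bg) * K"])
    fix u v assume "a \<le> u" "u \<le> v" "v \<le> b"
    then have uv: "u \<in> {a..b}" "v \<in> {a..b}" by auto
    have "prod (f v) (g v) - prod (f u) (g u) = prod (f v - f u) (g v) + prod (f u) (g v - g u)"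
      by (simp add: diff_left diff_right)
    then have "norm (prod (f v) (g v) - prod (f u) (g u)) \<le>
        norm (f v - f u) * norm (g v) * K + norm (f u) * norm (g v - g u) * K"
      by (metis K(2) norm_triangle_mono)
    also have "\<dots> \<le> norm (f v - f u) * Bg * K + Bf * norm (g v - g u) * K"
      using uv B K by (intro add_mono mult_right_mono mult_left_mono) auto
    also have "\<dots> \<le> (Bf + Bg) * K * (norm (f v - f u) + norm (g v - g u))"
      using B K by (simp add: algebra_simps)
    finally show "norm (prod (f v) (g v) - prod (f u) (g u)) \<le> (Bf + Bg) * K * (norm (f v - f u) + norm (g v - g u))" .
  qed
qed

text \<open>A square integrable majorant allows an elementary argument:
  \<open>q <= s * q^2 + 1 / s\<close> bounds the sum of increments by \<open>s * J\<close> plus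
  total length divided by \<open>s\<close>. First \<open>s\<close> is chosen so that
  \<open>s * J < e / 2\<close>, then the length is limited to \<open>s * e / 2\<close>.\<close>

lemma ac_by_increments:
  fixes f :: "real \<Rightarrow> 'a::real_normed_vector" and q :: "real \<Rightarrow> real"
  assumes q2: "(\<lambda>t. (q t)\<^sup>2) integrable_on {a..b}" and q: "q integrable_on {a..b}"
    and inc: "\<And>u v. a \<le> u \<Longrightarrow> u \<le> v \<Longrightarrow> v \<le> b \<Longrightarrow> norm (f v - f u) \<le> integral {u..v} q"
  shows "absolutely_continuous_on_interval a b f"
  unfolding ac_iff
proof (intro allI impI)
  fix e :: real assume e: "e > 0"
  define J where "J = integral {a..b} (\<lambda>t. (q t)\<^sup>2)"
  have J: "J \<ge> 0" unfolding J_def by (rule integral_nonneg[OF q2]) auto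
  define s where "s = e / (2 * (J + 1))"
  have s: "s > 0" using e J by (simp add: s_def)
  have sJ: "s * J < e / 2" using e J by (simp add: s_def field_simps)
  define \<delta> where "\<delta> = s * e / 2"
  have d: "\<delta> > 0" using s e by (simp add: \<delta>_def)
  show "\<exists>\<delta>>0. \<forall>I. interval_family a b I \<longrightarrow> (\<Sum>(u, v)\<in>I. v - u) < \<delta> \<longrightarrow> (\<Sum>(u, v)\<in>I. norm (f v - f u)) < e"
  proof (rule exI[of _ \<delta>], intro conjI allI impI d)
    fix I assume fam: "interval_family a b I" and len: "(\<Sum>(u, v)\<in>I. v - u) < \<delta>"
    let ?I' = "{i \<in> I. fst i < snd i}"
    note fin = interval_familyD(1)[OF fam] and Iab = interval_familyD(3)[OF fam] and pw = interval_familyD(4)[OF fam]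
    have int: "q integrable_on {fst i..snd i}" "(\<lambda>t. (q t)\<^sup>2) integrable_on {fst i..snd i}" if "i \<in> I" for i
      using Iab[OF that] by (auto intro: integrable_on_subinterval[OF q] integrable_on_subinterval[OF q2])
    have "((\<lambda>t. (q t)\<^sup>2) has_integral (\<Sum>i\<in>?I'. integral {fst i..snd i} (\<lambda>t. (q t)\<^sup>2))) (\<Union>i\<in>?I'. {fst i..snd i})"
    proof (rule has_integral_UN)
      show "finite ?I'" using fin by simp
      show "((\<lambda>t. (q t)\<^sup>2) has_integral integral {fst i..snd i} (\<lambda>t. (q t)\<^sup>2)) {fst i..snd i}" if "i \<in> ?I'" for i
        using int(2)[of i] that by (simp add: integrable_integral)
      show "pairwise (\<lambda>i i'. negligible ({fst i..snd i} \<inter> {fst i'..snd i'})) ?I'"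
      proof (rule pairwiseI)
        fix i j assume ij: "i \<in> ?I'" "j \<in> ?I'" "i \<noteq> j"
        have "{fst i<..<snd i} \<inter> {fst j<..<snd j} = {}" using pw ij by blast
        then have "{fst i..snd i} \<inter> {fst j..snd j} \<subseteq> {fst i, snd i, fst j, snd j}"
          by (smt (verit) Int_iff atLeastAtMost_iff disjoint_iff greaterThanLessThan_iff insertCI subsetI)
        then show "negligible ({fst i..snd i} \<inter> {fst j..snd j})"
          by (rule negligible_subset[rotated]) simp
      qed
    qed
    then have sq: "(\<Sum>i\<in>?I'. integral {fst i..snd i} (\<lambda>t. (q t)\<^sup>2)) \<le> J" unfolding J_def
      by (rule has_integral_subset_le[rotated 1, OF _ integrable_integral[OF q2]]) (use Iab in fastforce)+
    have each: "norm (f (snd i) - f (fst i)) \<le> s * integral {fst i..snd i} (\<lambda>t. (q t)\<^sup>2) + (snd i - fst i) / s"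
      if "i \<in> I" for i
    proof -
      have "norm (f (snd i) - f (fst i)) \<le> integral {fst i..snd i} q"
        using inc Iab[OF that] by blast
      also have "\<dots> \<le> s * integral {fst i..snd i} (\<lambda>t. (q t)\<^sup>2) + (snd i - fst i) / s"
      proof (rule has_integral_le[OF integrable_integral[OF int(1)[OF that]]])
        have "((\<lambda>t. 1 / s) has_integral (snd i - fst i) *\<^sub>R (1 / s)) {fst i..snd i}"
          using has_integral_const_real[of "1 / s" "fst i" "snd i"] Iab[OF that] by simp
        from has_integral_add[OF has_integral_mult_right[OF integrable_integral[OF int(2)[OF that]], of s] this]
        show "((\<lambda>t. s * (q t)\<^sup>2 + 1 / s) has_integral s * integral {fst i..snd i} (\<lambda>t. (q t)\<^sup>2) + (snd i - fst i) / s) {fst i..snd i}"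
          by simp
        fix t
        have "0 \<le> (s * q t - 1 / 2)\<^sup>2" by simp
        then have "s * q t \<le> (s * q t)\<^sup>2 + 1" by (simp add: power2_eq_square algebra_simps)
        then show "q t \<le> s * (q t)\<^sup>2 + 1 / s"
          using s by (simp add: field_simps power2_eq_square)
      qed
      finally show ?thesis .
    qed
    have "(\<Sum>(u, v)\<in>I. norm (f v - f u)) = (\<Sum>i\<in>?I'. norm (f (snd i) - f (fst i)))"
    proof (rule sum.mono_neutral_cong_right)
      show "\<forall>i\<in>I - ?I'. (case i of (u, v) \<Rightarrow> norm (f v - f u)) = 0"
      proof
        fix i assume "i \<in> I - ?I'"
        then have "fst i = snd i" using Iab[of i] by auto
        then show "(case i of (u, v) \<Rightarrow> norm (f v - f u)) = 0" by (simp add: split_beta)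
      qed
    qed (use fin in \<open>auto simp: split_beta\<close>)
    also have "\<dots> \<le> (\<Sum>i\<in>?I'. s * integral {fst i..snd i} (\<lambda>t. (q t)\<^sup>2) + (snd i - fst i) / s)"
      by (intro sum_mono each) auto
    also have "\<dots> = s * (\<Sum>i\<in>?I'. integral {fst i..snd i} (\<lambda>t. (q t)\<^sup>2)) + (\<Sum>i\<in>?I'. snd i - fst i) / s"
      by (simp add: sum.distrib sum_distrib_left sum_divide_distrib)
    also have "(\<Sum>i\<in>?I'. snd i - fst i) = (\<Sum>(u, v)\<in>I. v - u)"
    proof (rule sum.mono_neutral_cong_left)
      show "\<forall>i\<in>I - ?I'. (case i of (u, v) \<Rightarrow> v - u) = 0"
      proof
        fix i assume "i \<in> I - ?I'"
        then have "fst i = snd i" using Iab[of i] by auto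
        then show "(case i of (u, v) \<Rightarrow> v - u) = 0" by (simp add: split_beta)
      qed
    qed (use fin in \<open>auto simp: split_beta\<close>)
    finally have "(\<Sum>(u, v)\<in>I. norm (f v - f u)) \<le>
        s * (\<Sum>i\<in>?I'. integral {fst i..snd i} (\<lambda>t. (q t)\<^sup>2)) + (\<Sum>(u, v)\<in>I. v - u) / s" .
    also have "\<dots> < s * J + \<delta> / s"
      using len sq s by (intro add_le_less_mono mult_left_mono divide_strict_right_mono) auto
    also have "\<dots> < e" using sJ s by (simp add: \<delta>_def)
    finally show "(\<Sum>(u, v)\<in>I. norm (f v - f u)) < e" .
  qed
qed

text \<open>The points of bad approximation are covered by intervals which Vitali's theorem makes
  disjoint, and Henstock's lemma bounds the total length of these.\<close>

lemma lebesgue_differentiation_interval: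
  fixes f :: "real \<Rightarrow> 'a::euclidean_space"
  assumes f: "f integrable_on {a..b}"
  obtains N where "negligible N"
    "\<And>x. x \<in> {a<..<b} - N \<Longrightarrow> ((\<lambda>x. integral {a..x} f) has_vector_derivative f x) (at x)"
proof -
  define F where "F x = integral {a..x} f" for x
  define bad where "bad k x d y \<longleftrightarrow> y \<noteq> x \<and> \<bar>y - x\<bar> < d \<and>
     norm (F y - F x - (y - x) *\<^sub>R f x) > \<bar>y - x\<bar> / real (Suc k)" for k x d y
  define E where "E k = {x \<in> {a<..<b}. \<forall>d>0. \<exists>y. bad k x d y}" for k
  have Fdiff: "F y - F x = integral {x..y} f" if "a \<le> x" "x \<le> y" "y \<le> b" for x y
    unfolding F_def using that by (subst Henstock_Kurzweil_Integration.integral_combine[OF that(1,2), symmetric]) (auto intro: integrable_on_subinterval[OF f])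
  have "negligible (E k)" for k
    unfolding negligible_outer_le
  proof (intro allI impI)
    fix e :: real assume e: "e > 0"
    \<comment> \<open>Each bad interval contributes at least its length divided by
      \<open>Suc k\<close> to the Henstock sum, so a sum below \<open>\<eta>\<close> bounds the
      total length by \<open>e\<close>.\<close>
    define \<eta> where "\<eta> = e / real (Suc k)"
    have eta: "\<eta> > 0" using e by (simp add: \<eta>_def)
    have f': "f integrable_on cbox a b" using f by simp
    obtain \<gamma> where gau: "gauge \<gamma>" and \<gamma>: "\<And>p. p tagged_partial_division_of cbox a b \<Longrightarrow> \<gamma> fine p \<Longrightarrow>
        (\<Sum>(x, K)\<in>p. norm (measure lborel K *\<^sub>R f x - integral K f)) < \<eta>"
      by (rule Henstock_lemma[OF f' eta]) (rule that, assumption, blast)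
    \<comment> \<open>The interval between a bad point and its witness is rewritten as a ball, the
      form needed for the covering theorem. The tag is the first component and may be either end
      point.\<close>
    define c where "c i = (fst i + snd i) / 2" for i :: "real \<times> real"
    define r where "r i = \<bar>snd i - fst i\<bar> / 2" for i :: "real \<times> real"
    have cb: "cball (c i) (r i) = {min (fst i) (snd i)..max (fst i) (snd i)}" for i
      unfolding cball_eq_atLeastAtMost c_def r_def by (cases "fst i \<le> snd i") (simp_all add: field_simps)
    define K where "K = {(x, y). x \<in> {a<..<b} \<and> y \<in> {a<..<b} \<and> y \<noteq> x \<and> cball (c (x, y)) (r (x, y)) \<subseteq> \<gamma> x \<and>
       norm (F y - F x - (y - x) *\<^sub>R f x) > \<bar>y - x\<bar> / real (Suc k)}"
    have rpos: "0 < r i" if "i \<in> K" for i using that by (auto simp: K_def r_def)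
    have cover: "\<exists>i. i \<in> K \<and> x \<in> cball (c i) (r i) \<and> r i < d" if x: "x \<in> E k" and d: "0 < d" for x d
    proof -
      have xab: "x \<in> {a<..<b}" using x by (simp add: E_def)
      have "open (\<gamma> x \<inter> {a<..<b})" "x \<in> \<gamma> x \<inter> {a<..<b}" using gau xab by (auto simp: gauge_def)
      then obtain s where s: "s > 0" "cball x s \<subseteq> \<gamma> x \<inter> {a<..<b}" using open_contains_cball by blast
      obtain y where y: "y \<noteq> x" "\<bar>y - x\<bar> < min s d" "norm (F y - F x - (y - x) *\<^sub>R f x) > \<bar>y - x\<bar> / real (Suc k)"
      proof -
        have "min s d > 0" using s(1) d by simp
        then obtain y where "bad k x (min s d) y" using x unfolding E_def by blast
        then show thesis using that unfolding bad_def by blast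
      qed
      have ys: "\<bar>y - x\<bar> < s" using y(2) by simp
      have sub: "cball (c (x, y)) (r (x, y)) \<subseteq> cball x s"
        unfolding cb unfolding cball_eq_atLeastAtMost using ys s(1) by (cases "x \<le> y") auto
      moreover have "y \<in> cball x s" using ys by (auto simp: dist_real_def)
      ultimately have "(x, y) \<in> K" using s y xab by (auto simp: K_def)
      moreover have "x \<in> cball (c (x, y)) (r (x, y))" by (simp add: cb)
      moreover have "r (x, y) < d" using y d by (simp add: r_def)
      ultimately show ?thesis by blast
    qed
    obtain C where C: "countable C" "C \<subseteq> K" "pairwise (\<lambda>i j. disjnt (cball (c i) (r i)) (cball (c j) (r j))) C"
      "negligible (E k - (\<Union>i\<in>C. cball (c i) (r i)))"
      by (rule Vitali_covering_theorem_cballs[of K r "E k" c, OF rpos cover]) (assumption | rule that)+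
    \<comment> \<open>Henstock's lemma speaks of finite partial divisions, hence the detour through
      finite subfamilies of the countable cover.\<close>
    have bound: "(\<Sum>i\<in>C'. measure lebesgue (cball (c i) (r i))) \<le> e" if C': "C' \<subseteq> C" "finite C'" for C'
    proof -
      define p where "p = (\<lambda>i. (fst i, cball (c i) (r i))) ` C'"
      have inj: "inj_on (\<lambda>i. (fst i, cball (c i) (r i))) C'"
      proof (rule inj_onI, rule ccontr)
        fix i j assume ij: "i \<in> C'" "j \<in> C'" "i \<noteq> j" "(fst i, cball (c i) (r i)) = (fst j, cball (c j) (r j))"
        then have "disjnt (cball (c i) (r i)) (cball (c j) (r j))" using pairwiseD[OF C(3), of i j] ij(1-3) C'(1) by blast
        moreover have "fst i \<in> cball (c i) (r i)" unfolding cb by simp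
        moreover have "cball (c i) (r i) = cball (c j) (r j)" using ij(4) by blast
        ultimately show False unfolding disjnt_def by (metis IntI empty_iff)
      qed
      have p: "p tagged_partial_division_of cbox a b"
        unfolding tagged_partial_division_of_def
      proof (intro conjI allI impI)
        show "finite p" using C' by (simp add: p_def)
      next
        fix x D assume "(x, D) \<in> p"
        then obtain i where i: "i \<in> C'" "x = fst i" "D = cball (c i) (r i)" by (auto simp: p_def)
        then have "i \<in> K" using C C' by auto
        then have "fst i \<in> {a<..<b}" "snd i \<in> {a<..<b}" by (auto simp: K_def)
        then show "x \<in> D" "D \<subseteq> cbox a b" "\<exists>a b. D = cbox a b" unfolding i cb
          by (auto simp flip: box_real simp: min_def max_def)
      next
        fix x1 K1 x2 K2 assume "(x1, K1) \<in> p \<and> (x2, K2) \<in> p \<and> (x1, K1) \<noteq> (x2, K2)"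
        then obtain i j where ij: "i \<in> C'" "j \<in> C'" "K1 = cball (c i) (r i)" "K2 = cball (c j) (r j)" "i \<noteq> j"
          by (auto simp: p_def)
        then have "disjnt K1 K2" using pairwiseD[OF C(3), of i j] C'(1) by blast
        then show "interior K1 \<inter> interior K2 = {}"
          using interior_subset unfolding disjnt_def by blast
      qed
      have fine: "\<gamma> fine p"
      proof -
        have "cball (c i) (r i) \<subseteq> \<gamma> (fst i)" if "i \<in> C'" for i
        proof -
          have "i \<in> K" using that C(2) C'(1) by blast
          then show ?thesis unfolding K_def by (cases i) auto
        qed
        then show ?thesis unfolding fine_def p_def by blast
      qed
      have "(\<Sum>i\<in>C'. measure lebesgue (cball (c i) (r i))) / real (Suc k) =
          (\<Sum>i\<in>C'. \<bar>snd i - fst i\<bar> / real (Suc k))"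
        unfolding sum_divide_distrib by (rule sum.cong) (auto simp: cb min_def max_def)
      also have "\<dots> \<le> (\<Sum>i\<in>C'. norm (measure lborel (cball (c i) (r i)) *\<^sub>R f (fst i) - integral (cball (c i) (r i)) f))"
      proof (rule sum_mono)
        fix i assume "i \<in> C'"
        then have iK: "i \<in> K" using C C' by auto
        obtain x y where xy: "i = (x, y)" by fastforce
        have *: "x \<in> {a<..<b}" "y \<in> {a<..<b}" "norm (F y - F x - (y - x) *\<^sub>R f x) > \<bar>y - x\<bar> / real (Suc k)"
          using iK by (auto simp: K_def xy)
        show "\<bar>snd i - fst i\<bar> / real (Suc k) \<le>
           norm (measure lborel (cball (c i) (r i)) *\<^sub>R f (fst i) - integral (cball (c i) (r i)) f)"
        proof (cases "x \<le> y")
          case True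
          then have "measure lborel (cball (c i) (r i)) *\<^sub>R f (fst i) - integral (cball (c i) (r i)) f
            = - (F y - F x - (y - x) *\<^sub>R f x)"
            using Fdiff[of x y] * by (simp add: cb xy)
          then show ?thesis using * xy by (metis fst_conv less_imp_le norm_minus_cancel snd_conv)
        next
          case False
          then have "measure lborel (cball (c i) (r i)) *\<^sub>R f (fst i) - integral (cball (c i) (r i)) f
            = F y - F x - (y - x) *\<^sub>R f x"
            using Fdiff[of y x] * by (simp add: cb xy algebra_simps)
          then show ?thesis using * xy by (metis fst_conv less_imp_le snd_conv)
        qed
      qed
      also have "\<dots> = (\<Sum>(x, K)\<in>p. norm (measure lborel K *\<^sub>R f x - integral K f))"
        unfolding p_def by (subst sum.reindex[OF inj]) simp
      also have "\<dots> < \<eta>" by (rule \<gamma>[OF p fine])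
      finally show ?thesis unfolding \<eta>_def by (simp add: divide_less_cancel)
    qed
    let ?T = "(E k - (\<Union>i\<in>C. cball (c i) (r i))) \<union> (\<Union>i\<in>C. cball (c i) (r i))"
    have m: "(\<Union>i\<in>C. cball (c i) (r i)) \<in> lmeasurable" "measure lebesgue (\<Union>i\<in>C. cball (c i) (r i)) \<le> e"
    proof -
      have *: "measure lebesgue (\<Union>i\<in>C'. cball (c i) (r i)) \<le> e" if "C' \<subseteq> C" "finite C'" for C'
        using bound[OF that] measure_UNION_le[OF that(2), of "\<lambda>i. cball (c i) (r i)" lebesgue]
        by fastforce
      show "(\<Union>i\<in>C. cball (c i) (r i)) \<in> lmeasurable" "measure lebesgue (\<Union>i\<in>C. cball (c i) (r i)) \<le> e"
        by (auto intro!: fmeasurable_UN_bound[OF C(1) _ *] measure_UN_bound[OF C(1) _ *])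
    qed
    show "\<exists>T. E k \<subseteq> T \<and> T \<in> lmeasurable \<and> measure lebesgue T \<le> e"
    proof (rule exI[of _ ?T], intro conjI)
      show "?T \<in> lmeasurable" by (rule fmeasurable.Un[OF negligible_imp_measurable[OF C(4)] m(1)])
      have "measure lebesgue ?T \<le> measure lebesgue (E k - (\<Union>i\<in>C. cball (c i) (r i))) + measure lebesgue (\<Union>i\<in>C. cball (c i) (r i))"
        by (rule measure_Un_le[OF negligible_imp_sets[OF C(4)] fmeasurableD[OF m(1)]])
      also have "\<dots> \<le> e" using m(2) negligible_imp_measure0[OF C(4)] by linarith
      finally show "measure lebesgue ?T \<le> e" .
    qed auto
  qed
  then have "negligible (\<Union>k. E k)" by (intro negligible_countable_Union) auto
  moreover have "(F has_vector_derivative f x) (at x)" if x: "x \<in> {a<..<b} - (\<Union>k. E k)" for x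
    unfolding has_vector_derivative_def has_derivative_at_alt
  proof (intro conjI allI impI)
    show "bounded_linear (\<lambda>h. h *\<^sub>R f x)" by (rule bounded_linear_scaleR_left)
    fix e :: real assume e: "e > 0"
    obtain k where k: "1 / real (Suc k) < e" using e by (metis nat_approx_posE)
    have "x \<notin> E k" "x \<in> {a<..<b}" using x by blast+
    then obtain d where d: "d > 0" and nb: "\<And>y. \<not> bad k x d y"
      by (auto simp: E_def)
    have d2: "norm (F y - F x - (y - x) *\<^sub>R f x) \<le> \<bar>y - x\<bar> / real (Suc k)" if "y \<noteq> x" "\<bar>y - x\<bar> < d" for y
      using nb[of y] that unfolding bad_def by linarith
    have "norm (F y - F x - (y - x) *\<^sub>R f x) \<le> e * norm (y - x)" if "norm (y - x) < d" for y
    proof (cases "y = x")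
      case False
      have "norm (F y - F x - (y - x) *\<^sub>R f x) \<le> \<bar>y - x\<bar> * (1 / real (Suc k))" using d2[OF False] that by simp
      also have "\<dots> \<le> \<bar>y - x\<bar> * e" using k by (intro mult_left_mono) auto
      finally show ?thesis by (simp add: mult.commute)
    qed simp
    then show "\<exists>d>0. \<forall>y. norm (y - x) < d \<longrightarrow> norm (F y - F x - (y - x) *\<^sub>R f x) \<le> e * norm (y - x)"
      using d by blast
  qed
  ultimately show thesis unfolding F_def[abs_def] by (rule that)
qed

section \<open>Linear Volterra equations\<close>

text \<open>Square integrability of the majorant \<open>q\<close> is what makes the integral
  operator a contraction on all of \<open>{0..b}\<close> at once, so that no gluing of short
  intervals is required. Integrability of \<open>A t (f t)\<close> is postulated for continuous
  \<open>f\<close> only, the class in which solutions are sought.\<close>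

locale volterra =
  fixes A :: "real \<Rightarrow> 'a::euclidean_space \<Rightarrow> 'a" and q :: "real \<Rightarrow> real" and b :: real
  assumes b_nonneg: "0 \<le> b"
    and lin: "\<And>t. bounded_linear (A t)"
    and bound: "\<And>t v. t \<in> {0..b} \<Longrightarrow> norm (A t v) \<le> q t * norm v"
    and q_nonneg: "\<And>t. 0 \<le> q t"
    and q2_int: "(\<lambda>t. (q t)\<^sup>2) integrable_on {0..b}"
    and A_int: "\<And>f. continuous_on {0..b} f \<Longrightarrow> (\<lambda>t. A t (f t)) integrable_on {0..b}"
begin

text \<open>With \<open>J\<close> the integral of \<open>q^2\<close>, this choice gives
  \<open>J / weight <= 1 / 2\<close>; the summand 1 keeps the weight away from 0 when
  \<open>q\<close> vanishes.\<close>

definition weight :: real where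
  "weight = 2 * (integral {0..b} (\<lambda>t. (q t)\<^sup>2) + 1)"

lemma weight_pos: "weight \<ge> 2"
  unfolding weight_def using integral_nonneg[OF q2_int] by auto

lemma A_int_sub:
  "continuous_on {0..b} f \<Longrightarrow> 0 \<le> u \<Longrightarrow> x \<le> b \<Longrightarrow> (\<lambda>t. A t (f t)) integrable_on {u..x}"
  by (rule integrable_on_subinterval[OF A_int]) auto

lemma A_diff: "A t (u - v) = A t u - A t v"
  by (rule linear_diff[OF bounded_linear.linear[OF lin]])

text \<open>AM-GM in the form \<open>2 q e\<^sup>K\<^sup>t \<le> s q\<^sup>2 e\<^sup>K\<^sup>x + e\<^sup>2\<^sup>K\<^sup>t\<^sup>-\<^sup>K\<^sup>x / s\<close> makes the
  operator a contraction for the norm weighted by \<open>e\<^sup>-\<^sup>K\<^sup>x\<close>.\<close>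

lemma contraction:
  assumes f: "continuous_on {0..b} f" and x: "x \<in> {0..b}" and B: "0 \<le> B"
    and fB: "\<And>t. t \<in> {0..x} \<Longrightarrow> norm (f t) \<le> B * exp (weight * t)"
  shows "norm (integral {0..x} (\<lambda>t. A t (f t))) \<le> B / 2 * exp (weight * x)"
proof -
  define J where "J = integral {0..b} (\<lambda>t. (q t)\<^sup>2)"
  define s where "s = 1 / weight"
  define K where "K = weight"
  have K: "K \<ge> 2" "K = 2 * (J + 1)" using weight_pos by (auto simp: K_def weight_def J_def)
  have J: "J \<ge> 0" unfolding J_def by (rule integral_nonneg[OF q2_int]) auto
  have s: "s > 0" "s = 1 / K" using K by (auto simp: s_def K_def)
  have q2x: "(\<lambda>t. (q t)\<^sup>2) integrable_on {0..x}" by (rule integrable_on_subinterval[OF q2_int]) (use x in auto)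
  have J0: "integral {0..x} (\<lambda>t. (q t)\<^sup>2) \<le> J" unfolding J_def
    by (rule integral_subset_le[OF _ q2x q2_int]) (use x in auto)
  define G where "G t = B * (s / 2 * exp (K * x) * (q t)\<^sup>2 + exp (2 * K * t - K * x) / (2 * s))" for t
  have E: "((\<lambda>t. exp (2 * K * t - K * x) / (2 * s)) has_integral
      (exp (2 * K * x - K * x) / (4 * K * s) - exp (2 * K * 0 - K * x) / (4 * K * s))) {0..x}"
    by (rule fundamental_theorem_of_calculus)
      (use x K(1) s(1) in \<open>auto intro!: derivative_eq_intros simp: field_simps simp flip: has_real_derivative_iff_has_vector_derivative\<close>)
  have G: "(G has_integral B * (s / 2 * exp (K * x) * integral {0..x} (\<lambda>t. (q t)\<^sup>2) +
      (exp (2 * K * x - K * x) / (4 * K * s) - exp (2 * K * 0 - K * x) / (4 * K * s)))) {0..x}"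
    unfolding G_def
    by (rule has_integral_mult_right[OF has_integral_add[OF has_integral_mult_right[OF integrable_integral[OF q2x]] E]])
  have "norm (integral {0..x} (\<lambda>t. A t (f t))) \<le> integral {0..x} G"
  proof (rule integral_norm_bound_integral)
    show "(\<lambda>t. A t (f t)) integrable_on {0..x}" by (rule A_int_sub[OF f]) (use x in auto)
    show "G integrable_on {0..x}" using G by blast
    fix t assume t: "t \<in> {0..x}"
    have "norm (A t (f t)) \<le> q t * (B * exp (K * t))"
      using bound[of t "f t"] fB[OF t] t x q_nonneg[of t] unfolding K_def
      by (meson atLeastAtMost_iff mult_left_mono order_trans)
    also have "\<dots> = B * (q t * exp (K * t))" by simp
    also have "\<dots> \<le> G t" unfolding G_def
    proof (rule mult_left_mono[OF _ B])
      define u where "u = exp (K * t)"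
      define w where "w = exp (K * x)"
      have uw: "u > 0" "w > 0" by (auto simp: u_def w_def)
      have "0 \<le> (s * w * q t - u)\<^sup>2" by simp
      then have "2 * (s * w) * (q t * u) \<le> (s * w * q t)\<^sup>2 + u\<^sup>2"
        by (simp add: power2_eq_square algebra_simps)
      then have "q t * u \<le> ((s * w * q t)\<^sup>2 + u\<^sup>2) / (2 * (s * w))"
        using s(1) uw by (simp add: field_simps)
      also have "\<dots> = s / 2 * w * (q t)\<^sup>2 + (u\<^sup>2 / w) / (2 * s)"
        using s(1) uw by (simp add: field_simps power2_eq_square)
      also have "u\<^sup>2 / w = exp (2 * K * t - K * x)"
        by (simp add: u_def w_def exp_diff power2_eq_square flip: exp_add)
      finally show "q t * exp (K * t) \<le> s / 2 * exp (K * x) * (q t)\<^sup>2 + exp (2 * K * t - K * x) / (2 * s)"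
        by (simp add: u_def w_def)
    qed
    finally show "norm (A t (f t)) \<le> G t" .
  qed
  also have "\<dots> = B * (s / 2 * exp (K * x) * integral {0..x} (\<lambda>t. (q t)\<^sup>2) +
      (exp (2 * K * x - K * x) / (4 * K * s) - exp (2 * K * 0 - K * x) / (4 * K * s)))"
    using G by (rule integral_unique)
  \<comment> \<open>As \<open>s * K = 1\<close>, each summand is at most a quarter of
    \<open>exp (K * x)\<close>: the first because \<open>s * J <= 1 / 2\<close>, the second after
    dropping its negative boundary term.\<close>
  also have "\<dots> \<le> B * (exp (K * x) / 2)"
  proof (rule mult_left_mono[OF _ B])
    have "s * K = 1" using s K(1) by simp
    then have sJ: "s * J \<le> 1 / 2" using s(1) K(2) by (simp add: algebra_simps)
    have "s / 2 * exp (K * x) * integral {0..x} (\<lambda>t. (q t)\<^sup>2) \<le> s / 2 * exp (K * x) * J"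
      using s J0 by (intro mult_left_mono) auto
    also have "\<dots> = (s * J) * exp (K * x) / 2" by simp
    also have "\<dots> \<le> (1 / 2) * exp (K * x) / 2"
      using sJ by (intro divide_right_mono mult_right_mono) auto
    finally have 1: "s / 2 * exp (K * x) * integral {0..x} (\<lambda>t. (q t)\<^sup>2) \<le> exp (K * x) / 4" by simp
    have "4 * K * s = 4" using \<open>s * K = 1\<close> by (simp add: mult.commute)
    then have "exp (2 * K * x - K * x) / (4 * K * s) - exp (2 * K * 0 - K * x) / (4 * K * s) \<le> exp (K * x) / 4"
      by simp
    with 1 show "s / 2 * exp (K * x) * integral {0..x} (\<lambda>t. (q t)\<^sup>2) +
      (exp (2 * K * x - K * x) / (4 * K * s) - exp (2 * K * 0 - K * x) / (4 * K * s)) \<le> exp (K * x) / 2" by linarith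
  qed
  finally show ?thesis by (simp add: K_def)
qed

text \<open>A Gronwall bound obtained from the contraction: at a maximum \<open>z\<close> of the
  weighted norm \<open>h\<close> one gets \<open>h z <= B + h z / 2\<close>.\<close>

lemma stability:
  assumes f: "continuous_on {0..b} f" and B: "0 \<le> B"
    and eq: "\<And>x. x \<in> {0..b} \<Longrightarrow> f x = g x + integral {0..x} (\<lambda>t. A t (f t))"
    and gB: "\<And>x. x \<in> {0..b} \<Longrightarrow> norm (g x) \<le> B * exp (weight * x)"
    and x: "x \<in> {0..b}"
  shows "norm (f x) \<le> 2 * B * exp (weight * x)"
proof -
  define h where "h t = norm (f t) * exp (- weight * t)" for t
  have "continuous_on {0..b} h" unfolding h_def by (intro continuous_intros f)
  then obtain z where z: "z \<in> {0..b}" "\<And>t. t \<in> {0..b} \<Longrightarrow> h t \<le> h z"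
    using continuous_attains_sup[of "{0..b}" h] b_nonneg by auto
  have hf: "norm (f t) = h t * exp (weight * t)" for t by (simp add: h_def flip: exp_add)
  have h0: "h z \<ge> 0" by (simp add: h_def)
  have "norm (integral {0..z} (\<lambda>t. A t (f t))) \<le> h z / 2 * exp (weight * z)"
    by (rule contraction[OF f z(1) h0]) (use z hf in auto)
  then have "norm (f z) \<le> B * exp (weight * z) + h z / 2 * exp (weight * z)"
    using gB[OF z(1)] norm_triangle_ineq[of "g z" "integral {0..z} (\<lambda>t. A t (f t))"]
    by (subst eq[OF z(1)]) linarith
  then have "h z * exp (weight * z) \<le> (B + h z / 2) * exp (weight * z)" unfolding hf by (simp add: algebra_simps)
  then have "h z \<le> 2 * B" by simp
  then have "h x \<le> 2 * B" using z(2)[OF x] by linarith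
  then show ?thesis unfolding hf by (intro mult_right_mono) auto
qed

lemma solution_unique:
  assumes f: "continuous_on {0..b} f" "continuous_on {0..b} f'"
    and eq: "\<And>x. x \<in> {0..b} \<Longrightarrow> f x = g x + integral {0..x} (\<lambda>t. A t (f t))"
      "\<And>x. x \<in> {0..b} \<Longrightarrow> f' x = g x + integral {0..x} (\<lambda>t. A t (f' t))"
    and x: "x \<in> {0..b}"
  shows "f x = f' x"
proof -
  have "norm (f x - f' x) \<le> 2 * 0 * exp (weight * x)"
  proof (rule stability[where f="\<lambda>x. f x - f' x" and g="\<lambda>_. 0"])
    fix y assume y: "y \<in> {0..b}"
    have "integral {0..y} (\<lambda>t. A t (f t - f' t)) =
      integral {0..y} (\<lambda>t. A t (f t)) - integral {0..y} (\<lambda>t. A t (f' t))"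
      unfolding A_diff by (rule integral_diff) (use y f A_int_sub in auto)
    then show "f y - f' y = 0 + integral {0..y} (\<lambda>t. A t (f t - f' t))" using eq[OF y] by simp
  qed (use x f in \<open>auto intro: continuous_intros\<close>)
  then show ?thesis by simp
qed

lemma continuous_on_volterra_integral:
  "continuous_on {0..b} f \<Longrightarrow> continuous_on {0..b} (\<lambda>x. integral {0..x} (\<lambda>t. A t (f t)))"
  by (rule indefinite_integral_continuous_1[OF A_int])

text \<open>Picard iteration. Successive differences halve in the weighted norm, so the telescoping
  series converges uniformly by the Weierstrass test.\<close>

lemma solution_exists:
  assumes g: "continuous_on {0..b} g"
  obtains f where "continuous_on {0..b} f"
    "\<And>x. x \<in> {0..b} \<Longrightarrow> f x = g x + integral {0..x} (\<lambda>t. A t (f t))"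
proof -
  define u where "u = rec_nat g (\<lambda>_ v x. g x + integral {0..x} (\<lambda>t. A t (v t)))"
  have u0: "u 0 = g" and uS: "u (Suc n) x = g x + integral {0..x} (\<lambda>t. A t (u n t))" for n x
    by (auto simp: u_def)
  have cu: "continuous_on {0..b} (u n)" for n
  proof (induction n)
    case (Suc n)
    have "continuous_on {0..b} (\<lambda>x. g x + integral {0..x} (\<lambda>t. A t (u n t)))"
      by (intro continuous_on_add g continuous_on_volterra_integral Suc)
    then show ?case by (simp add: uS[abs_def])
  qed (simp add: u0 g)
  have "bounded (g ` {0..b})" by (intro compact_imp_bounded compact_continuous_image g) auto
  then obtain B where B: "B > 0" "\<And>x. x \<in> {0..b} \<Longrightarrow> norm (g x) \<le> B"
    unfolding bounded_pos by (metis imageI)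
  have step: "norm (u (Suc n) x - u n x) \<le> B * (1 / 2) ^ n * exp (weight * x)" if "x \<in> {0..b}" for n x
    using that
  proof (induction n arbitrary: x)
    case 0
    have "norm (integral {0..x} (\<lambda>t. A t (g t))) \<le> B / 2 * exp (weight * x)"
    proof (rule contraction[OF g 0])
      show "norm (g t) \<le> B * exp (weight * t)" if "t \<in> {0..x}" for t
      proof -
        have "1 \<le> exp (weight * t)" using that weight_pos by simp
        then have "B * 1 \<le> B * exp (weight * t)" using B by (intro mult_left_mono) auto
        then show ?thesis using B(2)[of t] that 0 by auto
      qed
    qed (use B in auto)
    also have "\<dots> \<le> B * exp (weight * x)" using B by auto
    finally show ?case by (simp add: u0 uS)
  next
    case (Suc n)
    have "u (Suc (Suc n)) x - u (Suc n) x =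
        integral {0..x} (\<lambda>t. A t (u (Suc n) t)) - integral {0..x} (\<lambda>t. A t (u n t))"
      by (simp add: uS)
    also have "\<dots> = integral {0..x} (\<lambda>t. A t (u (Suc n) t - u n t))"
      unfolding A_diff by (rule integral_diff[symmetric]) (use Suc.prems cu A_int_sub in auto)
    also have "norm \<dots> \<le> (B * (1 / 2) ^ n) / 2 * exp (weight * x)"
      by (rule contraction) (use Suc B cu in \<open>auto intro: continuous_intros\<close>)
    finally show ?case by simp
  qed
  define M where "M = B * exp (weight * b)"
  have M: "norm (u (Suc n) x - u n x) \<le> M * (1 / 2) ^ n" if "x \<in> {0..b}" for n x
  proof -
    have "exp (weight * x) \<le> exp (weight * b)" using that weight_pos by simp
    then have "B * (1 / 2) ^ n * exp (weight * x) \<le> B * (1 / 2) ^ n * exp (weight * b)"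
      using B by (intro mult_left_mono) auto
    then show ?thesis using step[OF that, of n] by (simp add: M_def algebra_simps)
  qed
  define f where "f x = g x + (\<Sum>n. u (Suc n) x - u n x)" for x
  have tel: "(\<Sum>k<n. u (Suc k) x - u k x) = u n x - g x" for n x
    using sum_lessThan_telescope[of "\<lambda>k. u k x" n] by (simp add: u0)
  have "uniform_limit {0..b} (\<lambda>n x. \<Sum>k<n. u (Suc k) x - u k x) (\<lambda>x. \<Sum>n. u (Suc n) x - u n x) sequentially"
    by (rule Weierstrass_m_test[where M="\<lambda>n. M * (1 / 2) ^ n"]) (use M in \<open>auto intro: summable_mult summable_geometric\<close>)
  then have "uniform_limit {0..b} (\<lambda>n x. g x + (\<Sum>k<n. u (Suc k) x - u k x)) f sequentially"
    unfolding f_def by (intro uniform_limit_intros)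
  then have ul: "uniform_limit {0..b} u f sequentially" by (simp add: tel)
  have cf: "continuous_on {0..b} f"
    by (rule uniform_limit_theorem[OF _ ul]) (use cu in auto)
  show thesis
  proof (rule that[OF cf])
    fix x assume x: "x \<in> {0..b}"
    \<comment> \<open>The limit passes under the integral by the contraction estimate applied to
      \<open>u n - f\<close>.\<close>
    have "(\<lambda>n. integral {0..x} (\<lambda>t. A t (u n t))) \<longlonglongrightarrow> integral {0..x} (\<lambda>t. A t (f t))"
      unfolding tendsto_iff
    proof (intro allI impI)
      fix e :: real assume e: "e > 0"
      define d where "d = e / exp (weight * x)"
      have d: "d > 0" using e by (simp add: d_def)
      have "\<forall>\<^sub>F n in sequentially. \<forall>t\<in>{0..b}. dist (u n t) (f t) < d"
        using uniform_limitD[OF ul d] .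
      then show "\<forall>\<^sub>F n in sequentially. dist (integral {0..x} (\<lambda>t. A t (u n t))) (integral {0..x} (\<lambda>t. A t (f t))) < e"
      proof eventually_elim
        case (elim n)
        have "integral {0..x} (\<lambda>t. A t (u n t)) - integral {0..x} (\<lambda>t. A t (f t)) =
          integral {0..x} (\<lambda>t. A t (u n t - f t))"
          unfolding A_diff by (rule integral_diff[symmetric]) (use x cu cf A_int_sub in auto)
        also have "norm \<dots> \<le> d / 2 * exp (weight * x)"
        proof (rule contraction)
          fix t assume t: "t \<in> {0..x}"
          have "norm (u n t - f t) \<le> d * 1" using elim[rule_format, of t] t x by (simp add: dist_norm)
          also have "\<dots> \<le> d * exp (weight * t)" using d t weight_pos by (intro mult_left_mono) auto
          finally show "norm (u n t - f t) \<le> d * exp (weight * t)" .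
        qed (use d x cu cf in \<open>auto intro: continuous_intros\<close>)
        also have "\<dots> < e" using e by (simp add: d_def)
        finally show ?case by (simp add: dist_norm)
      qed
    qed
    then have "(\<lambda>n. u (Suc n) x) \<longlonglongrightarrow> g x + integral {0..x} (\<lambda>t. A t (f t))"
      unfolding uS by (intro tendsto_intros)
    moreover have "(\<lambda>n. u (Suc n) x) \<longlonglongrightarrow> f x"
      using tendsto_uniform_limitI[OF ul x] by (rule LIMSEQ_Suc)
    ultimately show "f x = g x + integral {0..x} (\<lambda>t. A t (f t))" by (metis LIMSEQ_unique)
  qed
qed

end

section \<open>The initial value problem\<close>

lemma AE_lebesgue_on_negligible:
  assumes "AE x in lebesgue_on S. P x" "S \<in> sets lebesgue"
  obtains N where "negligible N" "\<And>x. x \<in> S - N \<Longrightarrow> P x"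
proof -
  obtain N where N: "N \<in> null_sets (lebesgue_on S)" "{x \<in> space (lebesgue_on S). \<not> P x} \<subseteq> N"
    using assms(1) unfolding eventually_ae_filter by blast
  have "negligible N" unfolding negligible_iff_null_sets
    using N(1) assms(2) null_sets_restrict_space by blast
  then show thesis by (rule that) (use N(2) in \<open>auto simp: space_restrict_space\<close>)
qed

lemma negligible_AE_lebesgue_on:
  assumes "negligible N" "\<And>x. x \<in> S - N \<Longrightarrow> P x" "S \<in> sets lebesgue"
  shows "AE x in lebesgue_on S. P x"
proof -
  have "N \<in> null_sets lebesgue" using assms(1) by (simp add: negligible_iff_null_sets)
  then have "AE x in lebesgue. x \<notin> N" by (rule AE_not_in)
  then have "AE x in lebesgue. x \<in> S \<longrightarrow> P x" by eventually_elim (use assms(2) in blast)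
  then show ?thesis using assms(3) by (simp add: AE_restrict_space_iff)
qed

lemma norm_cvec_le_sum: "norm (x :: complex^'n) \<le> (\<Sum>i\<in>UNIV. norm (x $ i))"
  unfolding norm_vec_def by (rule L2_set_le_sum) auto

text \<open>Chosen in place of an operator norm because its integrability and square integrability
  along \<open>Q\<close> reduce to those of finitely many scalar entries.\<close>

definition entry_sum :: "complex^'n^'n \<Rightarrow> real" where
  "entry_sum M = (\<Sum>i\<in>UNIV. \<Sum>j\<in>UNIV. norm (M $ i $ j))"

lemma entry_sum_nonneg: "0 \<le> entry_sum M"
  unfolding entry_sum_def by (intro sum_nonneg) auto

lemma norm_matvec_le: "norm (M *v x) \<le> entry_sum M * norm (x :: complex^'n)"
proof -
  have "norm (M *v x) \<le> (\<Sum>i\<in>UNIV. norm (\<Sum>j\<in>UNIV. M $ i $ j * x $ j))"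
    using norm_cvec_le_sum[of "M *v x"] by (simp add: matrix_vector_mult_def)
  also have "\<dots> \<le> (\<Sum>i\<in>UNIV. \<Sum>j\<in>UNIV. norm (M $ i $ j) * norm x)"
  proof (intro sum_mono sum_norm_le)
    fix i j show "norm (M $ i $ j * x $ j) \<le> norm (M $ i $ j) * norm x"
      unfolding norm_mult by (intro mult_left_mono Finite_Cartesian_Product.norm_nth_le) auto
  qed
  finally show ?thesis by (simp add: entry_sum_def sum_distrib_right)
qed

lemma norm_cscale: "norm (c *s (x :: complex^'n)) = norm c * norm x"
proof -
  have "c *s x = (\<chi> i. c * x $ i)" by (simp add: vector_scalar_mult_def)
  then show ?thesis
    by (simp add: norm_vec_def norm_mult L2_set_right_distrib)
qed

lemma bounded_bilinear_matvec:
  "bounded_bilinear ((*v) :: complex^'n^'n \<Rightarrow> complex^'n \<Rightarrow> complex^'n)"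
proof (rule bounded_bilinear.intro)
  show "\<exists>K. \<forall>M x. norm ((M :: complex^'n^'n) *v x) \<le> norm M * norm x * K"
  proof (intro exI allI)
    fix M :: "complex^'n^'n" and x :: "complex^'n"
    have "entry_sum M \<le> (\<Sum>i\<in>(UNIV::'n set). \<Sum>j\<in>(UNIV::'n set). norm M)"
      unfolding entry_sum_def
      by (intro sum_mono) (meson Finite_Cartesian_Product.norm_nth_le order_trans)
    also have "\<dots> = norm M * (real CARD('n))\<^sup>2" by (simp add: power2_eq_square)
    finally have "entry_sum M * norm x \<le> norm M * (real CARD('n))\<^sup>2 * norm x" by (rule mult_right_mono) simp
    then show "norm (M *v x) \<le> norm M * norm x * (real CARD('n))\<^sup>2"
      using norm_matvec_le[of M x] by (simp add: algebra_simps)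
  qed
qed (auto simp: vec_eq_iff matrix_vector_mult_def algebra_simps sum.distrib scaleR_sum_right)

lemma bounded_bilinear_cscale:
  "bounded_bilinear ((*s) :: complex \<Rightarrow> complex^'n \<Rightarrow> complex^'n)"
proof (rule bounded_bilinear.intro)
  show "\<exists>K. \<forall>c x. norm (c *s (x :: complex^'n)) \<le> norm c * norm x * K"
    by (rule exI[of _ 1]) (simp add: norm_cscale)
qed (auto simp: vec_eq_iff algebra_simps)

lemmas continuous_on_matvec [continuous_intros] = bounded_bilinear.continuous_on[OF bounded_bilinear_matvec]
lemmas continuous_on_cscale [continuous_intros] = bounded_bilinear.continuous_on[OF bounded_bilinear_cscale]

lemma bounded_linear_axis: "bounded_linear (axis i :: complex \<Rightarrow> complex^'n)"
  by (rule linear_conv_bounded_linear[THEN iffD1])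
    (auto intro!: linearI simp: vec_eq_iff axis_def)

lemma matvec_integrable:
  fixes M :: "real \<Rightarrow> complex^'n^'n"
  assumes M: "\<And>i j. (\<lambda>t. M t $ i $ j) absolutely_integrable_on {a..b}"
    and y: "continuous_on {a..b} y"
  shows "(\<lambda>t. M t *v y t) integrable_on {a..b}"
proof -
  have *: "(\<lambda>t. y t $ j * M t $ i $ j) absolutely_integrable_on {a..b}" for i j
  proof (rule absolutely_integrable_bounded_measurable_product[where h="(*)"])
    have c: "continuous_on {a..b} (\<lambda>t. y t $ j)" by (intro continuous_intros y)
    then show "(\<lambda>t. y t $ j) \<in> borel_measurable (lebesgue_on {a..b})"
      by (intro continuous_imp_measurable_on_sets_lebesgue) auto
    show "bounded ((\<lambda>t. y t $ j) ` {a..b})"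
      by (intro compact_imp_bounded compact_continuous_image c) auto
  qed (use M in \<open>auto intro: bounded_bilinear_mult simp: bilinear_conv_bounded_bilinear\<close>)
  have "(\<lambda>t. axis i (M t $ i $ j * y t $ j) :: complex^'n) integrable_on {a..b}" for i j
  proof -
    have "(axis i \<circ> (\<lambda>t. M t $ i $ j * y t $ j) :: real \<Rightarrow> complex^'n) integrable_on {a..b}"
      using set_lebesgue_integral_eq_integral(1)[OF *, of j i]
      by (intro integrable_linear[OF _ bounded_linear_axis]) (simp add: mult.commute)
    then show ?thesis by (simp add: o_def)
  qed
  then have "(\<lambda>t. \<Sum>i\<in>UNIV. \<Sum>j\<in>UNIV. axis i (M t $ i $ j * y t $ j) :: complex^'n) integrable_on {a..b}"
    by (intro integrable_sum) auto
  moreover have "(\<lambda>t. \<Sum>i\<in>UNIV. \<Sum>j\<in>UNIV. axis i (M t $ i $ j * y t $ j) :: complex^'n) = (\<lambda>t. M t *v y t)"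
    by (auto simp: fun_eq_iff vec_eq_iff matrix_vector_mult_def axis_def if_distrib cong: if_cong)
       (subst sum.swap, simp)
  ultimately show ?thesis by simp
qed

lemma integrable_on_pair:
  fixes f :: "real \<Rightarrow> 'a::euclidean_space" and g :: "real \<Rightarrow> 'b::euclidean_space"
  assumes "f integrable_on S" "g integrable_on S"
  shows "(\<lambda>t. (f t, g t)) integrable_on S"
proof -
  have "((\<lambda>x. (x, 0::'b)) \<circ> f) integrable_on S"
    by (rule integrable_linear[OF assms(1)]) (intro bounded_linear_intros)
  moreover have "((\<lambda>x. (0::'a, x)) \<circ> g) integrable_on S"
    by (rule integrable_linear[OF assms(2)]) (intro bounded_linear_intros)
  ultimately have "(\<lambda>t. ((\<lambda>x. (x, 0::'b)) \<circ> f) t + ((\<lambda>x. (0::'a, x)) \<circ> g) t) integrable_on S"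
    by (rule integrable_add)
  then show ?thesis by simp
qed

locale sturm_liouville =
  fixes Q :: "real \<Rightarrow> complex^'m^'m" and h H :: "complex^('m::finite)^'m"
  assumes selfadjoint: "selfadjoint_problem Q h H"
begin

text \<open>On a bounded interval square integrability gives integrability through
  \<open>a <= a^2 + 1\<close>; the open and the closed interval differ by a null set.\<close>

lemma Q_entry:
  shows Q_abs_int: "(\<lambda>t. Q t $ i $ j) absolutely_integrable_on {0..pi}"
    and Q_sq_int: "(\<lambda>t. (norm (Q t $ i $ j))\<^sup>2) integrable_on {0..pi}"
proof -
  have L2: "(\<lambda>x. Q x $ i $ j) \<in> borel_measurable (lebesgue_on {0<..<pi})"
    "integrable (lebesgue_on {0<..<pi}) (\<lambda>x. (norm (Q x $ i $ j))\<^sup>2)"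
    using selfadjoint by (auto simp: selfadjoint_problem_def L2_entries_def)
  have sq: "(\<lambda>t. (norm (Q t $ i $ j))\<^sup>2) integrable_on {0<..<pi}"
    by (rule integrable_on_lebesgue_on[OF L2(2)]) auto
  have neg: "negligible ({0..pi} - {0<..<pi})"
    by (rule negligible_subset[of "{0, pi}"]) auto
  have "(\<lambda>t. (norm (Q t $ i $ j))\<^sup>2 + 1) integrable_on {0<..<pi}"
    by (intro integrable_add sq) (use integrable_on_open_interval_real[of "\<lambda>_. 1::real" 0 pi] in auto)
  moreover have "norm (Q t $ i $ j) \<le> (norm (Q t $ i $ j))\<^sup>2 + 1" for t
  proof -
    have "0 \<le> (norm (Q t $ i $ j) - 1 / 2)\<^sup>2" by simp
    then show ?thesis by (simp add: power2_eq_square algebra_simps)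
  qed
  ultimately have "(\<lambda>t. Q t $ i $ j) absolutely_integrable_on {0<..<pi}"
    using measurable_bounded_by_integrable_imp_absolutely_integrable[OF L2(1)] by auto
  then show "(\<lambda>t. Q t $ i $ j) absolutely_integrable_on {0..pi}"
    by (rule absolutely_integrable_spike_set[OF _ negligible_subset[OF neg] negligible_subset[OF neg]]) auto
  show "(\<lambda>t. (norm (Q t $ i $ j))\<^sup>2) integrable_on {0..pi}"
    by (rule integrable_spike_set[OF sq negligible_subset[OF neg] negligible_subset[OF neg]]) auto
qed

lemma Q_sum_int: "(\<lambda>t. entry_sum (Q t)) integrable_on {0..pi}"
  unfolding entry_sum_def
  by (intro integrable_sum) (use Q_abs_int in \<open>auto simp: absolutely_integrable_on_def\<close>)

text \<open>The shift \<open>a\<close> accommodates the spectral parameter: it becomes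
  \<open>1 + norm \<mu>\<close> for the first-order system and \<open>norm \<mu>\<close> for the
  second derivative alone.\<close>

lemma Q_sum_sq_int: "(\<lambda>t. (a + entry_sum (Q t))\<^sup>2) integrable_on {0..pi}"
proof -
  have n: "(\<lambda>t. norm (Q t $ i $ j)) absolutely_integrable_on {0..pi}" for i j
    using absolutely_integrable_norm[OF Q_abs_int] by (simp add: o_def)
  have "(\<lambda>t. norm (Q t $ i $ j) * norm (Q t $ k $ l)) integrable_on {0..pi}" for i j k l
  proof (rule measurable_bounded_by_integrable_imp_integrable)
    show "(\<lambda>t. norm (Q t $ i $ j) * norm (Q t $ k $ l)) \<in> borel_measurable (lebesgue_on {0..pi})"
      by (intro borel_measurable_times absolutely_integrable_measurable[THEN iffD1, THEN conjunct1] n) auto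
    show "(\<lambda>t. (norm (Q t $ i $ j))\<^sup>2 + (norm (Q t $ k $ l))\<^sup>2) integrable_on {0..pi}"
      by (intro integrable_add Q_sq_int)
    show "norm (norm (Q t $ i $ j) * norm (Q t $ k $ l)) \<le> (norm (Q t $ i $ j))\<^sup>2 + (norm (Q t $ k $ l))\<^sup>2" for t
      using sum_squares_bound[of "norm (Q t $ i $ j)" "norm (Q t $ k $ l)"]
        mult_nonneg_nonneg[OF norm_ge_zero[of "Q t $ i $ j"] norm_ge_zero[of "Q t $ k $ l"]]
      by (simp add: abs_mult del: mult_nonneg_nonneg)
  qed auto
  then have "(\<lambda>t. \<Sum>i\<in>UNIV. \<Sum>j\<in>UNIV. \<Sum>k\<in>UNIV. \<Sum>l\<in>UNIV. norm (Q t $ i $ j) * norm (Q t $ k $ l)) integrable_on {0..pi}"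
    by (intro integrable_sum) auto
  moreover have "(\<lambda>t. \<Sum>i\<in>UNIV. \<Sum>j\<in>UNIV. \<Sum>k\<in>UNIV. \<Sum>l\<in>UNIV. norm (Q t $ i $ j) * norm (Q t $ k $ l)) =
      (\<lambda>t. (entry_sum (Q t))\<^sup>2)"
    unfolding entry_sum_def power2_eq_square sum_distrib_left[symmetric] sum_distrib_right[symmetric] ..
  ultimately have sq: "(\<lambda>t. (entry_sum (Q t))\<^sup>2) integrable_on {0..pi}" by simp
  have "(\<lambda>t. a\<^sup>2 + (2 * a) * entry_sum (Q t) + (entry_sum (Q t))\<^sup>2) integrable_on {0..pi}"
    by (intro integrable_add sq integrable_on_mult_right Q_sum_int) auto
  then show ?thesis by (simp add: power2_sum algebra_simps)
qed

text \<open>First-order form y' = v, v' = (Q - \<mu>) y of the equation, acting on pairs (y,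
  v).\<close>

definition sys :: "complex \<Rightarrow> real \<Rightarrow> (complex^'m) \<times> (complex^'m) \<Rightarrow> (complex^'m) \<times> (complex^'m)" where
  "sys \<mu> t z = (snd z, Q t *v fst z - \<mu> *s fst z)"

lemma volterra_sys: "volterra (sys \<mu>) (\<lambda>t. (1 + norm \<mu>) + entry_sum (Q t)) pi"
proof (rule volterra.intro)
  show "bounded_linear (sys \<mu> t)" for t
    unfolding sys_def[abs_def]
    by (intro bounded_linear_Pair bounded_linear_sub bounded_linear_snd
        bounded_linear_compose[OF bounded_bilinear.bounded_linear_right[OF bounded_bilinear_matvec] bounded_linear_fst]
        bounded_linear_compose[OF bounded_bilinear.bounded_linear_right[OF bounded_bilinear_cscale] bounded_linear_fst])
  show "norm (sys \<mu> t z) \<le> (1 + norm \<mu> + entry_sum (Q t)) * norm z" for t z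
  proof -
    have "norm (sys \<mu> t z) \<le> norm (snd z) + norm (Q t *v fst z - \<mu> *s fst z)"
      unfolding sys_def by (rule norm_Pair_le)
    also have "\<dots> \<le> norm (snd z) + (norm (Q t *v fst z) + norm (\<mu> *s fst z))"
      by (intro add_left_mono norm_triangle_ineq4)
    also have "\<dots> \<le> norm (snd z) + (entry_sum (Q t) * norm (fst z) + norm \<mu> * norm (fst z))"
      using norm_matvec_le[of "Q t" "fst z"] by (simp add: norm_cscale)
    also have "\<dots> \<le> norm z + (entry_sum (Q t) * norm z + norm \<mu> * norm z)"
      using norm_fst_le[of "fst z" "snd z"] norm_snd_le[of "snd z" "fst z"]
      by (intro add_mono mult_left_mono entry_sum_nonneg) auto
    finally show ?thesis by (simp add: algebra_simps)
  qed
  show "(\<lambda>t. (1 + norm \<mu> + entry_sum (Q t))\<^sup>2) integrable_on {0..pi}"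
    by (rule Q_sum_sq_int)
  show "0 \<le> 1 + norm \<mu> + entry_sum (Q t)" for t
    using entry_sum_nonneg[of "Q t"] by simp
  fix f :: "real \<Rightarrow> (complex^'m) \<times> (complex^'m)" assume f: "continuous_on {0..pi} f"
  show "(\<lambda>t. sys \<mu> t (f t)) integrable_on {0..pi}"
    unfolding sys_def
    by (intro integrable_on_pair integrable_diff integrable_continuous_real matvec_integrable Q_abs_int continuous_intros f)
qed simp

end

lemma ac_of_C1:
  fixes f :: "real \<Rightarrow> 'a::euclidean_space"
  assumes der: "\<And>x. x \<in> {a..b} \<Longrightarrow> (f has_vector_derivative f' x) (at x within {a..b})"
    and cont: "continuous_on {a..b} f'"
  shows "absolutely_continuous_on_interval a b f"
proof -
  have "bounded (f' ` {a..b})" by (intro compact_imp_bounded compact_continuous_image cont) auto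
  then obtain B where B: "\<And>x. x \<in> {a..b} \<Longrightarrow> norm (f' x) \<le> B" unfolding bounded_iff by (metis imageI)
  show ?thesis
  proof (rule ac_by_increments[where q="\<lambda>_. B"])
    fix u v assume uv: "a \<le> u" "u \<le> v" "v \<le> b"
    have "(f' has_integral f v - f u) {u..v}"
      by (rule fundamental_theorem_of_calculus[OF uv(2)])
        (use uv in \<open>auto intro: has_vector_derivative_within_subset[OF der]\<close>)
    then have "f v - f u = integral {u..v} f'" "f' integrable_on {u..v}" by (auto simp: integral_unique)
    moreover from this(2) have "norm (integral {u..v} f') \<le> integral {u..v} (\<lambda>_. B)"
      by (rule integral_norm_bound_integral) (use uv B integrable_const_ivl in auto)
    ultimately show "norm (f v - f u) \<le> integral {u..v} (\<lambda>_. B)" by (simp only:)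
  qed (auto intro: integrable_const_ivl)
qed

lemma integral_pair:
  fixes f :: "real \<Rightarrow> ('a::euclidean_space) \<times> ('b::euclidean_space)"
  assumes "f integrable_on S"
  shows "fst (integral S f) = integral S (\<lambda>t. fst (f t))" "snd (integral S f) = integral S (\<lambda>t. snd (f t))"
  using integral_linear[OF assms bounded_linear_fst] integral_linear[OF assms bounded_linear_snd]
  by (auto simp: o_def)

lemma matvec_cscale: "(M :: complex^'n^'n) *v (a *s x) = a *s (M *v x)"
  by (simp add: vec_eq_iff matrix_vector_mult_def sum_distrib_left algebra_simps)

context sturm_liouville
begin

text \<open>Working form of \<open>solves\<close>: the derivative is an explicit function
  \<open>v\<close> instead of a chosen vector derivative, and the almost-everywhere clause is an
  explicit null set. \<open>ode_solves\<close> and \<open>solves_ode\<close> relate the two.\<close>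

definition ode :: "complex \<Rightarrow> (real \<Rightarrow> complex^'m) \<Rightarrow> (real \<Rightarrow> complex^'m) \<Rightarrow> bool" where
  "ode \<mu> y v \<longleftrightarrow> (\<forall>x\<in>{0..pi}. (y has_vector_derivative v x) (at x within {0..pi})) \<and>
     absolutely_continuous_on_interval 0 pi v \<and>
     (\<exists>N. negligible N \<and>
       (\<forall>x\<in>{0<..<pi} - N. (v has_vector_derivative (Q x *v y x - \<mu> *s y x)) (at x)))"

lemma ode_deriv: "ode \<mu> y v \<Longrightarrow> x \<in> {0..pi} \<Longrightarrow> (y has_vector_derivative v x) (at x within {0..pi})"
  by (simp add: ode_def)

lemma ode_deriv_interior:
  assumes "ode \<mu> y v" "x \<in> {0<..<pi}"
  shows "(y has_vector_derivative v x) (at x)"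
proof -
  have "at x within {0..pi} = at x" by (rule at_within_interior) (use assms in auto)
  then show ?thesis using ode_deriv[OF assms(1), of x] assms(2) by auto
qed

lemma ode_ac2: "ode \<mu> y v \<Longrightarrow> absolutely_continuous_on_interval 0 pi v"
  by (simp add: ode_def)

lemma ode_cont2: "ode \<mu> y v \<Longrightarrow> continuous_on {0..pi} v"
  using ac_continuous_on ode_ac2 by blast

lemma ode_cont1: "ode \<mu> y v \<Longrightarrow> continuous_on {0..pi} y"
  using ode_deriv by (meson continuous_on_eq_continuous_within has_vector_derivative_continuous)

lemma ode_ac1: "ode \<mu> y v \<Longrightarrow> absolutely_continuous_on_interval 0 pi y"
  using ac_of_C1 ode_deriv ode_cont2 by blast

lemma ode_null:
  assumes "ode \<mu> y v"
  obtains N where "negligible N"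
    "\<And>x. x \<in> {0<..<pi} - N \<Longrightarrow> (v has_vector_derivative (Q x *v y x - \<mu> *s y x)) (at x)"
  using assms unfolding ode_def by blast

lemma ode_deriv_I: "ode \<mu> y v \<Longrightarrow> x \<in> {0..pi} \<Longrightarrow> deriv_I y x = v x"
  unfolding deriv_I_def
  by (rule vector_derivative_within_cbox[of 0 pi, unfolded box_real]) (auto simp: ode_deriv)

lemma ode_solves:
  assumes "ode \<mu> y v"
  shows "solves Q \<mu> y"
  unfolding solves_def
proof (intro conjI)
  show "y differentiable_on {0..pi}"
    unfolding differentiable_on_def using ode_deriv[OF assms] differentiableI_vector by blast
  show "absolutely_continuous_on_interval 0 pi (deriv_I y)"
    by (rule ac_cong[OF ode_ac2[OF assms]]) (simp add: ode_deriv_I[OF assms])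
  obtain N where N: "negligible N"
    "\<And>x. x \<in> {0<..<pi} - N \<Longrightarrow> (v has_vector_derivative (Q x *v y x - \<mu> *s y x)) (at x)"
    using ode_null[OF assms] by blast
  show "AE x in lebesgue_on {0<..<pi}.
       \<exists>Y2. (deriv_I y has_vector_derivative Y2) (at x) \<and> - Y2 + Q x *v y x = \<mu> *s y x"
  proof (rule negligible_AE_lebesgue_on[OF N(1)])
    fix x assume x: "x \<in> {0<..<pi} - N"
    have "(deriv_I y has_vector_derivative (Q x *v y x - \<mu> *s y x)) (at x)"
      by (rule has_vector_derivative_transform_within_open[OF N(2)[OF x], of "{0<..<pi}"])
        (use x ode_deriv_I[OF assms] in auto)
    then show "\<exists>Y2. (deriv_I y has_vector_derivative Y2) (at x) \<and> - Y2 + Q x *v y x = \<mu> *s y x"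
      by (intro exI[of _ "Q x *v y x - \<mu> *s y x"]) simp
  qed auto
qed

lemma solves_ode:
  assumes "solves Q \<mu> y"
  shows "ode \<mu> y (deriv_I y)"
  unfolding ode_def
proof (intro conjI ballI)
  fix x :: real assume "x \<in> {0..pi}"
  then show "(y has_vector_derivative deriv_I y x) (at x within {0..pi})"
    using assms unfolding solves_def deriv_I_def differentiable_on_def
    by (simp add: vector_derivative_works)
next
  show "absolutely_continuous_on_interval 0 pi (deriv_I y)" using assms by (simp add: solves_def)
  have ae: "AE x in lebesgue_on {0<..<pi}.
      \<exists>Y2. (deriv_I y has_vector_derivative Y2) (at x) \<and> - Y2 + Q x *v y x = \<mu> *s y x"
    using assms by (simp add: solves_def)
  have m: "{0<..<pi} \<in> sets lebesgue" by simp
  obtain N where N: "negligible N" "\<And>x. x \<in> {0<..<pi} - N \<Longrightarrow>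
      \<exists>Y2. (deriv_I y has_vector_derivative Y2) (at x) \<and> - Y2 + Q x *v y x = \<mu> *s y x"
    using AE_lebesgue_on_negligible[OF ae m] by blast
  have "(deriv_I y has_vector_derivative (Q x *v y x - \<mu> *s y x)) (at x)" if x: "x \<in> {0<..<pi} - N" for x
  proof -
    obtain Y2 where "(deriv_I y has_vector_derivative Y2) (at x)" "- Y2 + Q x *v y x = \<mu> *s y x"
      using N(2)[OF x] by blast
    moreover from this(2) have "Y2 = Q x *v y x - \<mu> *s y x" by (simp add: algebra_simps)
    ultimately show ?thesis by simp
  qed
  then show "\<exists>N. negligible N \<and>
       (\<forall>x\<in>{0<..<pi} - N. (deriv_I y has_vector_derivative (Q x *v y x - \<mu> *s y x)) (at x))"
    using N(1) by blast
qed

lemma sys_int: "continuous_on {0..pi} f \<Longrightarrow> x \<le> pi \<Longrightarrow> (\<lambda>t. sys \<mu> t (f t)) integrable_on {0..x}"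
  using volterra.A_int_sub[OF volterra_sys, of f 0 x] by simp

lemma ode_integral:
  assumes o: "ode \<mu> y v" and x: "x \<in> {0..pi}"
  shows "(y x, v x) = (y 0, v 0) + integral {0..x} (\<lambda>t. sys \<mu> t (y t, v t))"
proof -
  have int: "(\<lambda>t. sys \<mu> t (y t, v t)) integrable_on {0..x}"
    by (rule sys_int) (use x ode_cont1[OF o] ode_cont2[OF o] in \<open>auto intro!: continuous_intros\<close>)
  have 1: "(v has_integral y x - y 0) {0..x}"
    by (rule fundamental_theorem_of_calculus)
      (use x in \<open>auto intro: has_vector_derivative_within_subset[OF ode_deriv[OF o]]\<close>)
  obtain N where N: "negligible N"
    "\<And>x. x \<in> {0<..<pi} - N \<Longrightarrow> (v has_vector_derivative (Q x *v y x - \<mu> *s y x)) (at x)"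
    using ode_null[OF o] by blast
  have "absolutely_continuous_on_interval 0 x v"
    by (rule ac_subinterval[OF ode_ac2[OF o]]) (use x in auto)
  then have 2: "((\<lambda>t. Q t *v y t - \<mu> *s y t) has_integral v x - v 0) {0..x}"
    by (intro ac_fundamental_theorem[OF _ _ N(1)]) (use x N(2) in auto)
  show ?thesis
    using integral_pair[OF int] 1 2 by (auto simp: sys_def prod_eq_iff integral_unique)
qed

text \<open>Regularity is recovered in two ways: \<open>v\<close> is absolutely continuous since its
  increments are bounded by integrals of a square integrable function, and its derivative exists
  almost everywhere by Lebesgue differentiation.\<close>

lemma integral_ode:
  assumes f: "continuous_on {0..pi} f"
    and eq: "\<And>x. x \<in> {0..pi} \<Longrightarrow> f x = z0 + integral {0..x} (\<lambda>t. sys \<mu> t (f t))"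
  shows "ode \<mu> (fst \<circ> f) (snd \<circ> f)"
proof -
  define y where "y = fst \<circ> f"
  define v where "v = snd \<circ> f"
  have cy: "continuous_on {0..pi} y" and cv: "continuous_on {0..pi} v"
    unfolding y_def v_def o_def by (intro continuous_intros f)+
  have 1: "y x = fst z0 + integral {0..x} v" and
    2: "v x = snd z0 + integral {0..x} (\<lambda>t. Q t *v y t - \<mu> *s y t)" if "x \<in> {0..pi}" for x
    using arg_cong[OF eq[OF that], of fst] arg_cong[OF eq[OF that], of snd] integral_pair[OF sys_int[OF f, of x]] that
    by (auto simp: sys_def y_def v_def o_def)
  have vint: "(\<lambda>t. Q t *v y t - \<mu> *s y t) integrable_on {0..pi}"
    by (intro integrable_diff integrable_continuous_real matvec_integrable Q_abs_int continuous_intros cy)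
  have "bounded (y ` {0..pi})" by (intro compact_imp_bounded compact_continuous_image cy) auto
  then obtain B where B: "B > 0" "\<And>x. x \<in> {0..pi} \<Longrightarrow> norm (y x) \<le> B" unfolding bounded_pos by (metis imageI)
  show ?thesis unfolding ode_def y_def[symmetric] v_def[symmetric]
  proof (intro conjI ballI)
    fix x :: real assume x: "x \<in> {0..pi}"
    have "((\<lambda>x. fst z0 + integral {0..x} v) has_vector_derivative 0 + v x) (at x within {0..pi})"
      by (intro has_vector_derivative_add has_vector_derivative_const integral_has_vector_derivative cv x)
    then show "(y has_vector_derivative v x) (at x within {0..pi})"
      by (auto intro: has_vector_derivative_transform[OF x] simp: 1)
  next
    show "absolutely_continuous_on_interval 0 pi v"
    proof (rule ac_by_increments[where q="\<lambda>t. B * (norm \<mu> + entry_sum (Q t))"])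
      show "(\<lambda>t. (B * (norm \<mu> + entry_sum (Q t)))\<^sup>2) integrable_on {0..pi}"
        unfolding power_mult_distrib by (intro integrable_on_mult_right Q_sum_sq_int)
      show qi: "(\<lambda>t. B * (norm \<mu> + entry_sum (Q t))) integrable_on {0..pi}"
        by (intro integrable_on_mult_right integrable_add Q_sum_int) auto
      fix a b :: real assume ab: "0 \<le> a" "a \<le> b" "b \<le> pi"
      have "integral {0..b} (\<lambda>t. Q t *v y t - \<mu> *s y t) =
        integral {0..a} (\<lambda>t. Q t *v y t - \<mu> *s y t) + integral {a..b} (\<lambda>t. Q t *v y t - \<mu> *s y t)"
        using ab by (intro Henstock_Kurzweil_Integration.integral_combine[symmetric] integrable_on_subinterval[OF vint]) auto
      then have "v b - v a = integral {a..b} (\<lambda>t. Q t *v y t - \<mu> *s y t)"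
        using 2[of a] 2[of b] ab by auto
      also have "norm \<dots> \<le> integral {a..b} (\<lambda>t. B * (norm \<mu> + entry_sum (Q t)))"
      proof (rule integral_norm_bound_integral)
        show "(\<lambda>t. Q t *v y t - \<mu> *s y t) integrable_on {a..b}"
          by (rule integrable_on_subinterval[OF vint]) (use ab in auto)
        show "(\<lambda>t. B * (norm \<mu> + entry_sum (Q t))) integrable_on {a..b}"
          by (rule integrable_on_subinterval[OF qi]) (use ab in auto)
        fix t assume t: "t \<in> {a..b}"
        have "norm (Q t *v y t - \<mu> *s y t) \<le> entry_sum (Q t) * norm (y t) + norm \<mu> * norm (y t)"
          using norm_triangle_ineq4[of "Q t *v y t" "\<mu> *s y t"] norm_matvec_le[of "Q t" "y t"]
          by (simp add: norm_cscale)
        also have "\<dots> \<le> entry_sum (Q t) * B + norm \<mu> * B"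
          using B(2)[of t] t ab by (intro add_mono mult_left_mono entry_sum_nonneg) auto
        finally show "norm (Q t *v y t - \<mu> *s y t) \<le> B * (norm \<mu> + entry_sum (Q t))"
          by (simp add: algebra_simps)
      qed
      finally show "norm (v b - v a) \<le> integral {a..b} (\<lambda>t. B * (norm \<mu> + entry_sum (Q t)))" .
    qed
  next
    obtain N where N: "negligible N" "\<And>x. x \<in> {0<..<pi} - N \<Longrightarrow>
      ((\<lambda>x. integral {0..x} (\<lambda>t. Q t *v y t - \<mu> *s y t)) has_vector_derivative (Q x *v y x - \<mu> *s y x)) (at x)"
      using lebesgue_differentiation_interval[OF vint] by blast
    have "(v has_vector_derivative (Q x *v y x - \<mu> *s y x)) (at x)" if x: "x \<in> {0<..<pi} - N" for x
    proof (rule has_vector_derivative_transform_within_open[of _ _ _ "{0<..<pi}"])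
      show "((\<lambda>x. snd z0 + integral {0..x} (\<lambda>t. Q t *v y t - \<mu> *s y t)) has_vector_derivative (Q x *v y x - \<mu> *s y x)) (at x)"
        using has_vector_derivative_add[OF has_vector_derivative_const N(2)[OF x]] by simp
    qed (use x 2 in auto)
    then show "\<exists>N. negligible N \<and> (\<forall>x\<in>{0<..<pi} - N. (v has_vector_derivative (Q x *v y x - \<mu> *s y x)) (at x))"
      using N(1) by blast
  qed
qed

lemma ode_unique:
  assumes o: "ode \<mu> y v" "ode \<mu> y' v'" and init: "y 0 = y' 0" "v 0 = v' 0" and x: "x \<in> {0..pi}"
  shows "y x = y' x" "v x = v' x"
proof -
  have "(\<lambda>x. (y x, v x)) x = (\<lambda>x. (y' x, v' x)) x"
  proof (rule volterra.solution_unique[OF volterra_sys])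
    show "continuous_on {0..pi} (\<lambda>x. (y x, v x))" "continuous_on {0..pi} (\<lambda>x. (y' x, v' x))"
      by (intro continuous_intros ode_cont1[OF o(1)] ode_cont2[OF o(1)] ode_cont1[OF o(2)] ode_cont2[OF o(2)])+
    show "(y x, v x) = (y 0, v 0) + integral {0..x} (\<lambda>t. sys \<mu> t (y t, v t))" if "x \<in> {0..pi}" for x
      by (rule ode_integral[OF o(1) that])
    show "(y' x, v' x) = (y 0, v 0) + integral {0..x} (\<lambda>t. sys \<mu> t (y' t, v' t))" if "x \<in> {0..pi}" for x
      unfolding init by (rule ode_integral[OF o(2) that])
  qed (rule x)
  then show "y x = y' x" "v x = v' x" by auto
qed

lemma ode_exists: "\<exists>y v. ode \<mu> y v \<and> y 0 = c \<and> v 0 = d"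
proof -
  obtain f where f: "continuous_on {0..pi} f"
    "\<And>x. x \<in> {0..pi} \<Longrightarrow> f x = (c, d) + integral {0..x} (\<lambda>t. sys \<mu> t (f t))"
    using volterra.solution_exists[OF volterra_sys, of "\<lambda>_. (c, d)" \<mu>] by auto
  have "f 0 = (c, d)" using f(2)[of 0] by simp
  then show ?thesis using integral_ode[OF f] by (intro exI[of _ "fst \<circ> f"] exI[of _ "snd \<circ> f"]) simp
qed

text \<open>Superposition is checked on the integral equation, where it is linearity of the
  integral, without combining exceptional sets.\<close>

lemma ode_lincomb:
  assumes o: "ode \<mu> y v" "ode \<mu> y' v'"
  shows "ode \<mu> (\<lambda>x. a *s y x + y' x) (\<lambda>x. a *s v x + v' x)"
proof -
  let ?f = "\<lambda>x. (a *s y x + y' x, a *s v x + v' x)"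
  have lin: "bounded_linear (\<lambda>z :: (complex^'m) \<times> (complex^'m). (a *s fst z, a *s snd z))"
    by (intro bounded_linear_Pair
        bounded_linear_compose[OF bounded_bilinear.bounded_linear_right[OF bounded_bilinear_cscale] bounded_linear_fst]
        bounded_linear_compose[OF bounded_bilinear.bounded_linear_right[OF bounded_bilinear_cscale] bounded_linear_snd])
  have c: "continuous_on {0..pi} (\<lambda>x. (y x, v x))" "continuous_on {0..pi} (\<lambda>x. (y' x, v' x))"
    by (intro continuous_intros ode_cont1[OF o(1)] ode_cont2[OF o(1)] ode_cont1[OF o(2)] ode_cont2[OF o(2)])+
  have "ode \<mu> (fst \<circ> ?f) (snd \<circ> ?f)"
  proof (rule integral_ode[of _ "?f 0"])
    show "continuous_on {0..pi} ?f"
      by (intro continuous_intros ode_cont1[OF o(1)] ode_cont2[OF o(1)] ode_cont1[OF o(2)] ode_cont2[OF o(2)])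
    fix x :: real assume x: "x \<in> {0..pi}"
    have "(\<lambda>t. sys \<mu> t (?f t)) = (\<lambda>t. (\<lambda>z. (a *s fst z, a *s snd z)) (sys \<mu> t (y t, v t)) + sys \<mu> t (y' t, v' t))"
      by (auto simp: sys_def fun_eq_iff matvec_cscale vec.add vec_eq_iff algebra_simps matrix_vector_right_distrib)
    moreover have "integral {0..x} (\<lambda>t. (\<lambda>z. (a *s fst z, a *s snd z)) (sys \<mu> t (y t, v t)) + sys \<mu> t (y' t, v' t)) =
      (\<lambda>z. (a *s fst z, a *s snd z)) (integral {0..x} (\<lambda>t. sys \<mu> t (y t, v t))) + integral {0..x} (\<lambda>t. sys \<mu> t (y' t, v' t))"
      using integral_linear[OF sys_int[OF c(1), of x \<mu>] lin] integrable_linear[OF sys_int[OF c(1), of x \<mu>] lin] sys_int[OF c(2), of x \<mu>] x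
      by (subst integral_add) (auto simp: o_def)
    ultimately have "?f 0 + integral {0..x} (\<lambda>t. sys \<mu> t (?f t)) =
       (\<lambda>z. (a *s fst z, a *s snd z)) ((y 0, v 0) + integral {0..x} (\<lambda>t. sys \<mu> t (y t, v t))) +
       ((y' 0, v' 0) + integral {0..x} (\<lambda>t. sys \<mu> t (y' t, v' t)))"
      by (simp add: prod_eq_iff vector_add_ldistrib algebra_simps)
    also have "\<dots> = ?f x"
      unfolding ode_integral[OF o(1) x, symmetric] ode_integral[OF o(2) x, symmetric] by simp
    finally show "?f x = ?f 0 + integral {0..x} (\<lambda>t. sys \<mu> t (?f t))" by simp
  qed
  then show ?thesis by (simp add: o_def)
qed

end

section \<open>The characteristic matrix\<close>

text \<open>Hermitian inner product, conjugate linear in the first argument; this is what brings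
  \<open>cnj \<nu>\<close> into Lagrange's identity.\<close>

definition cip :: "complex^'n \<Rightarrow> complex^'n \<Rightarrow> complex" where
  "cip u w = (\<Sum>i\<in>UNIV. cnj (u $ i) * w $ i)"

lemma bounded_bilinear_cip: "bounded_bilinear (cip :: complex^'n \<Rightarrow> _)"
proof (rule bounded_bilinear.intro)
  show "\<exists>K. \<forall>u w. norm (cip (u :: complex^'n) w) \<le> norm u * norm w * K"
  proof (intro exI allI)
    fix u w :: "complex^'n"
    have "norm (cip u w) \<le> (\<Sum>i\<in>(UNIV :: 'n set). norm u * norm w)"
      unfolding cip_def
    proof (rule sum_norm_le)
      fix i show "norm (cnj (u $ i) * w $ i) \<le> norm u * norm w"
        unfolding norm_mult by (intro mult_mono) (auto simp: Finite_Cartesian_Product.norm_nth_le)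
    qed
    then show "norm (cip u w) \<le> norm u * norm w * real CARD('n)" by (simp add: mult.commute)
  qed
qed (auto simp: cip_def algebra_simps sum.distrib scaleR_sum_right)

lemmas continuous_on_cip [continuous_intros] = bounded_bilinear.continuous_on[OF bounded_bilinear_cip]

lemma cip_scale_right: "cip u (a *s w) = a * cip u w"
  by (simp add: cip_def sum_distrib_left algebra_simps)

lemma cip_scale_left: "cip (a *s u) w = cnj a * cip u w"
  by (simp add: cip_def sum_distrib_left algebra_simps)

lemmas cip_add_right = bounded_bilinear.add_right[OF bounded_bilinear_cip]
lemmas cip_add_left = bounded_bilinear.add_left[OF bounded_bilinear_cip]
lemmas cip_diff_right = bounded_bilinear.diff_right[OF bounded_bilinear_cip]
lemmas cip_diff_left = bounded_bilinear.diff_left[OF bounded_bilinear_cip]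
lemmas cip_zero_right = bounded_bilinear.zero_right[OF bounded_bilinear_cip]
lemmas cip_zero_left = bounded_bilinear.zero_left[OF bounded_bilinear_cip]

lemma cip_self: "cip u u = of_real ((norm u)\<^sup>2)"
  by (simp add: cip_def norm_vec_def L2_set_def sum_nonneg mult.commute flip: complex_norm_square)

lemma cip_hermitian:
  assumes "hermitian A"
  shows "cip (A *v u) w = cip u (A *v w)"
proof -
  have A: "cnj (A $ i $ j) = A $ j $ i" for i j
    using assms unfolding hermitian_def conj_transpose_def vec_eq_iff by simp
  have "cip (A *v u) w = (\<Sum>i\<in>UNIV. \<Sum>j\<in>UNIV. A $ j $ i * cnj (u $ j) * w $ i)"
    by (simp add: cip_def matrix_vector_mult_def sum_distrib_right A)
  also have "\<dots> = (\<Sum>j\<in>UNIV. \<Sum>i\<in>UNIV. A $ j $ i * cnj (u $ j) * w $ i)" by (rule sum.swap)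
  also have "\<dots> = cip u (A *v w)"
    by (simp add: cip_def matrix_vector_mult_def sum_distrib_left algebra_simps)
  finally show ?thesis .
qed

lemma linear_csI:
  assumes "\<And>a x y. f (a *s x + y) = a *s f x + f (y :: complex^'n)" "f 0 = 0"
  shows "Vector_Spaces.linear (*s) (*s) f"
proof (unfold_locales)
  show "f (x + y) = f x + f y" for x y using assms(1)[of 1 x y] by simp
  show "f (a *s x) = a *s f x" for a x using assms(1)[of a x 0] assms(2) by simp
qed

context sturm_liouville
begin

definition sol :: "complex \<Rightarrow> complex^'m \<Rightarrow> (real \<Rightarrow> complex^'m) \<times> (real \<Rightarrow> complex^'m)" where
  "sol \<mu> c = (SOME s. ode \<mu> (fst s) (snd s) \<and> fst s 0 = c \<and> snd s 0 = h *v c)"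

definition phi :: "complex \<Rightarrow> complex^'m \<Rightarrow> real \<Rightarrow> complex^'m" where
  "phi \<mu> c = fst (sol \<mu> c)"

definition dphi :: "complex \<Rightarrow> complex^'m \<Rightarrow> real \<Rightarrow> complex^'m" where
  "dphi \<mu> c = snd (sol \<mu> c)"

lemma phi_sol: "ode \<mu> (phi \<mu> c) (dphi \<mu> c) \<and> phi \<mu> c 0 = c \<and> dphi \<mu> c 0 = h *v c"
proof -
  obtain y v where "ode \<mu> y v \<and> y 0 = c \<and> v 0 = h *v c" using ode_exists by blast
  then show ?thesis unfolding phi_def dphi_def sol_def
    by (intro someI[of "\<lambda>s. ode \<mu> (fst s) (snd s) \<and> fst s 0 = c \<and> snd s 0 = h *v c" "(y, v)"]) simp
qed

lemmas phi_ode = phi_sol[THEN conjunct1]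
  and phi_0 = phi_sol[THEN conjunct2, THEN conjunct1]
  and dphi_0 = phi_sol[THEN conjunct2, THEN conjunct2]

lemma phi_unique:
  assumes "ode \<mu> y v" "y 0 = c" "v 0 = h *v c" "x \<in> {0..pi}"
  shows "y x = phi \<mu> c x" "v x = dphi \<mu> c x"
  using ode_unique[OF assms(1) phi_ode, of c x] assms by (auto simp: phi_0 dphi_0)

lemma phi_lincomb:
  assumes "x \<in> {0..pi}"
  shows "phi \<mu> (a *s c + d) x = a *s phi \<mu> c x + phi \<mu> d x"
    "dphi \<mu> (a *s c + d) x = a *s dphi \<mu> c x + dphi \<mu> d x"
  using phi_unique[OF ode_lincomb[OF phi_ode phi_ode, of \<mu> a c d] _ _ assms, of "a *s c + d"]
  by (simp_all add: phi_0 dphi_0 matvec_cscale matrix_vector_right_distrib)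

lemma phi_cont: "continuous_on {0..pi} (phi \<mu> c)" "continuous_on {0..pi} (dphi \<mu> c)"
  using ode_cont1[OF phi_ode] ode_cont2[OF phi_ode] .

lemma phi_zero: "x \<in> {0..pi} \<Longrightarrow> phi \<mu> 0 x = 0" "x \<in> {0..pi} \<Longrightarrow> dphi \<mu> 0 x = 0"
  using phi_lincomb[of x \<mu> 1 0 0] by (auto simp: vec_eq_iff)

definition Delta :: "complex \<Rightarrow> complex^'m^'m" where
  "Delta \<mu> = matrix (\<lambda>c. dphi \<mu> c pi + H *v phi \<mu> c pi)"

definition Phi :: "complex \<Rightarrow> complex^'m^'m" where
  "Phi \<mu> = matrix (\<lambda>c. phi \<mu> c pi)"

lemma Delta_mult: "Delta \<mu> *v c = dphi \<mu> c pi + H *v phi \<mu> c pi"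
  unfolding Delta_def
proof (rule matrix_works, rule linear_csI)
  fix a x y
  have "dphi \<mu> (a *s x + y) pi + H *v phi \<mu> (a *s x + y) pi =
      (a *s dphi \<mu> x pi + dphi \<mu> y pi) + (a *s (H *v phi \<mu> x pi) + H *v phi \<mu> y pi)"
    by (simp add: phi_lincomb matrix_vector_right_distrib matvec_cscale)
  then show "dphi \<mu> (a *s x + y) pi + H *v phi \<mu> (a *s x + y) pi =
      a *s (dphi \<mu> x pi + H *v phi \<mu> x pi) + (dphi \<mu> y pi + H *v phi \<mu> y pi)"
    by (simp add: vector_add_ldistrib add_ac)
qed (simp add: phi_zero)

lemma Phi_mult: "Phi \<mu> *v c = phi \<mu> c pi"
  unfolding Phi_def
  by (rule matrix_works, rule linear_csI) (simp_all add: phi_lincomb phi_zero)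

text \<open>The bracket \<open>W\<close> has derivative (\<mu> - cnj \<nu>) <phi, phi> almost
  everywhere, because a hermitian \<open>Q\<close> cancels. It vanishes at 0 because
  \<open>h\<close> is hermitian, and at \<pi> a hermitian \<open>H\<close> may be added to both
  derivatives, which turns them into \<open>Delta\<close>.\<close>

lemma lagrange:
  "cip (Delta \<nu> *v c) (Phi \<mu> *v d) - cip (Phi \<nu> *v c) (Delta \<mu> *v d) =
     (\<mu> - cnj \<nu>) * integral {0..pi} (\<lambda>t. cip (phi \<nu> c t) (phi \<mu> d t))"
proof -
  have sa: "hermitian h" "hermitian H" "AE x in lebesgue_on {0<..<pi}. hermitian (Q x)"
    using selfadjoint by (auto simp: selfadjoint_problem_def)
  define W where "W x = cip (dphi \<nu> c x) (phi \<mu> d x) - cip (phi \<nu> c x) (dphi \<mu> d x)" for x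
  have m: "{0<..<pi} \<in> sets lebesgue" by simp
  obtain N1 where N1: "negligible N1" "\<And>x. x \<in> {0<..<pi} - N1 \<Longrightarrow> hermitian (Q x)"
    using AE_lebesgue_on_negligible[OF sa(3) m] by blast
  obtain N2 where N2: "negligible N2" "\<And>x. x \<in> {0<..<pi} - N2 \<Longrightarrow>
      (dphi \<nu> c has_vector_derivative (Q x *v phi \<nu> c x - \<nu> *s phi \<nu> c x)) (at x)"
    using ode_null[OF phi_ode[of \<nu> c]] by blast
  obtain N3 where N3: "negligible N3" "\<And>x. x \<in> {0<..<pi} - N3 \<Longrightarrow>
      (dphi \<mu> d has_vector_derivative (Q x *v phi \<mu> d x - \<mu> *s phi \<mu> d x)) (at x)"
    using ode_null[OF phi_ode[of \<mu> d]] by blast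
  have W1: "absolutely_continuous_on_interval 0 pi (\<lambda>x. cip (dphi \<nu> c x) (phi \<mu> d x))"
    and W2: "absolutely_continuous_on_interval 0 pi (\<lambda>x. cip (phi \<nu> c x) (dphi \<mu> d x))"
    by (intro bounded_bilinear.ac_bilinear[OF bounded_bilinear_cip] ode_ac1[OF phi_ode] ode_ac2[OF phi_ode])+
  let ?N = "N1 \<union> N2 \<union> N3"
  have N: "negligible ?N" using N1 N2 N3 by (intro negligible_Un)
  let ?g1 = "\<lambda>x. cip (dphi \<nu> c x) (dphi \<mu> d x) + cip (Q x *v phi \<nu> c x - \<nu> *s phi \<nu> c x) (phi \<mu> d x)"
  let ?g2 = "\<lambda>x. cip (phi \<nu> c x) (Q x *v phi \<mu> d x - \<mu> *s phi \<mu> d x) + cip (dphi \<nu> c x) (dphi \<mu> d x)"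
  have i1: "(?g1 has_integral (cip (dphi \<nu> c pi) (phi \<mu> d pi) - cip (dphi \<nu> c 0) (phi \<mu> d 0))) {0..pi}"
    by (rule ac_fundamental_theorem[OF _ W1 N])
      (auto intro!: bounded_bilinear.has_vector_derivative[OF bounded_bilinear_cip] N2 ode_deriv_interior[OF phi_ode])
  have i2: "(?g2 has_integral (cip (phi \<nu> c pi) (dphi \<mu> d pi) - cip (phi \<nu> c 0) (dphi \<mu> d 0))) {0..pi}"
    by (rule ac_fundamental_theorem[OF _ W2 N])
      (auto intro!: bounded_bilinear.has_vector_derivative[OF bounded_bilinear_cip] N3 ode_deriv_interior[OF phi_ode])
  have W0: "W 0 = 0" by (simp add: W_def phi_0 dphi_0 cip_hermitian[OF sa(1)])
  have "((\<lambda>x. ?g1 x - ?g2 x) has_integral (W pi - W 0)) {0..pi}"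
    using has_integral_diff[OF i1 i2] by (simp add: W_def algebra_simps)
  then have "((\<lambda>x. ?g1 x - ?g2 x) has_integral W pi) {0..pi}" by (simp add: W0)
  then have "((\<lambda>x. (\<mu> - cnj \<nu>) * cip (phi \<nu> c x) (phi \<mu> d x)) has_integral W pi) {0..pi}"
  proof (rule has_integral_spike[rotated 2])
    show "negligible (N1 \<union> {0, pi})" using N1 by (intro negligible_Un) auto
    fix x assume "x \<in> {0..pi} - (N1 \<union> {0, pi})"
    then have "hermitian (Q x)" using N1(2)[of x] by auto
    then show "(\<mu> - cnj \<nu>) * cip (phi \<nu> c x) (phi \<mu> d x) = ?g1 x - ?g2 x"
      by (simp add: cip_diff_left cip_diff_right cip_scale_left cip_scale_right cip_hermitian algebra_simps)
  qed
  then have "integral {0..pi} (\<lambda>x. (\<mu> - cnj \<nu>) * cip (phi \<nu> c x) (phi \<mu> d x)) = W pi"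
    by (rule integral_unique)
  moreover have "W pi = cip (Delta \<nu> *v c) (Phi \<mu> *v d) - cip (Phi \<nu> *v c) (Delta \<mu> *v d)"
    by (simp add: W_def Delta_mult Phi_mult cip_add_left cip_add_right cip_hermitian[OF sa(2)])
  ultimately show ?thesis by simp
qed

text \<open>A continuous nonnegative function with integral zero vanishes everywhere, in particular
  at 0, where \<open>phi\<close> equals \<open>c\<close>.\<close>

lemma phi_norm_integral_zero:
  assumes "integral {0..pi} (\<lambda>t. cip (phi \<mu> c t) (phi \<mu> c t)) = 0"
  shows "c = 0"
proof -
  have cont: "continuous_on {0..pi} (\<lambda>t. (norm (phi \<mu> c t))\<^sup>2)" by (intro continuous_intros phi_cont)
  have "integral {0..pi} (\<lambda>t. cip (phi \<mu> c t) (phi \<mu> c t)) = of_real (integral {0..pi} (\<lambda>t. (norm (phi \<mu> c t))\<^sup>2))"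
    unfolding cip_self using integrable_continuous_real[OF cont]
    by (intro integral_unique has_integral_of_real integrable_integral)
  then have "integral {0..pi} (\<lambda>t. (norm (phi \<mu> c t))\<^sup>2) = 0" using assms by simp
  then have "(norm (phi \<mu> c 0))\<^sup>2 = 0"
    using integral_eq_0_iff[OF cont] by auto
  then show ?thesis by (simp add: phi_0)
qed

text \<open>In Lagrange's identity with equal parameters and vectors both pairings vanish, so \<mu>
  - cnj \<mu> times a nonzero integral is zero.\<close>

lemma Delta_kernel_real:
  assumes "Delta \<mu> *v c = 0" "c \<noteq> 0"
  shows "cnj \<mu> = \<mu>"
  using lagrange[of \<mu> c \<mu> c] phi_norm_integral_zero[of \<mu> c] assms
  by (auto simp: cip_zero_left cip_zero_right)

text \<open>Nothing fixes \<open>phi\<close> outside \<open>{0..pi}\<close>; the extension by zero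
  is the representative that \<open>eigenspace\<close> demands.\<close>

definition eig :: "complex \<Rightarrow> complex^'m \<Rightarrow> real \<Rightarrow> complex^'m" where
  "eig \<mu> c x = (if x \<in> {0..pi} then phi \<mu> c x else 0)"

lemma ode_cong1:
  assumes "ode \<mu> y v" "\<And>x. x \<in> {0..pi} \<Longrightarrow> y x = y' x"
  shows "ode \<mu> y' v"
  unfolding ode_def
proof (intro conjI ballI)
  show "(y' has_vector_derivative v x) (at x within {0..pi})" if "x \<in> {0..pi}" for x
    by (rule has_vector_derivative_transform[OF that _ ode_deriv[OF assms(1) that]]) (simp add: assms(2))
  show "absolutely_continuous_on_interval 0 pi v" by (rule ode_ac2[OF assms(1)])
  obtain N where N: "negligible N"
    "\<And>x. x \<in> {0<..<pi} - N \<Longrightarrow> (v has_vector_derivative (Q x *v y x - \<mu> *s y x)) (at x)"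
    using ode_null[OF assms(1)] by blast
  show "\<exists>N. negligible N \<and> (\<forall>x\<in>{0<..<pi} - N. (v has_vector_derivative (Q x *v y' x - \<mu> *s y' x)) (at x))"
  proof (intro exI conjI ballI)
    fix x assume "x \<in> {0<..<pi} - N"
    then show "(v has_vector_derivative (Q x *v y' x - \<mu> *s y' x)) (at x)" using N(2)[of x] assms(2)[of x] by auto
  qed (rule N(1))
qed

lemma eigenspace_eq: "eigenspace Q h H \<mu> = eig \<mu> ` {c. Delta \<mu> *v c = 0}"
proof (intro equalityI subsetI)
  fix Y assume Y: "Y \<in> eigenspace Q h H \<mu>"
  then have o: "ode \<mu> Y (deriv_I Y)" and U: "bc_U h Y = 0" and V: "bc_V H Y = 0"
    and out: "\<And>x. x \<notin> {0..pi} \<Longrightarrow> Y x = 0"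
    using solves_ode by (auto simp: eigenspace_def)
  have d0: "deriv_I Y 0 = h *v Y 0" using U by (simp add: bc_U_def)
  note u = phi_unique[OF o refl d0]
  have "Y = eig \<mu> (Y 0)" by (auto simp: eig_def fun_eq_iff u(1)[symmetric] out)
  moreover have "Delta \<mu> *v Y 0 = 0"
    using V by (simp add: Delta_mult bc_V_def u[symmetric])
  ultimately show "Y \<in> eig \<mu> ` {c. Delta \<mu> *v c = 0}" by blast
next
  fix Y assume "Y \<in> eig \<mu> ` {c. Delta \<mu> *v c = 0}"
  then obtain c where c: "Delta \<mu> *v c = 0" "Y = eig \<mu> c" by blast
  have o: "ode \<mu> (eig \<mu> c) (dphi \<mu> c)" by (rule ode_cong1[OF phi_ode]) (simp add: eig_def)
  have d: "deriv_I (eig \<mu> c) 0 = h *v c" "deriv_I (eig \<mu> c) pi = dphi \<mu> c pi"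
    using ode_deriv_I[OF o, of 0] ode_deriv_I[OF o, of pi] by (auto simp: dphi_0)
  show "Y \<in> eigenspace Q h H \<mu>"
    unfolding eigenspace_def using c ode_solves[OF o] d
    by (simp add: bc_U_def bc_V_def Delta_mult) (simp add: eig_def phi_0)
qed

lemma eig_lincomb: "eig \<mu> (a *s c + d) = scaleF a (eig \<mu> c) + eig \<mu> d"
  by (auto simp: fun_eq_iff eig_def scaleF_def phi_lincomb)

lemma eig_0: "eig \<mu> 0 = 0"
  by (auto simp: fun_eq_iff eig_def phi_zero)

lemma eig_linear: "Vector_Spaces.linear (*s) scaleF (eig \<mu>)"
proof (intro Vector_Spaces.linear.intro module_hom.intro module_hom_axioms.intro)
  show "eig \<mu> (x + y) = eig \<mu> x + eig \<mu> y" for x y using eig_lincomb[of \<mu> 1 x y]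
    by (simp add: scaleF_def)
  show "eig \<mu> (a *s x) = scaleF a (eig \<mu> x)" for a x using eig_lincomb[of \<mu> a x 0] by (simp add: eig_0)
qed unfold_locales

lemma eig_inj: "inj (eig \<mu>)"
proof (rule injI)
  fix c d assume "eig \<mu> c = eig \<mu> d"
  from fun_cong[OF this, of 0] show "c = d" by (simp add: eig_def phi_0)
qed

text \<open>The map \<open>eig \<mu>\<close> is linear and injective, hence carries a basis of the
  kernel to a basis of the eigenspace.\<close>

lemma multiplicity_eq: "multiplicity_ev Q h H \<mu> = vec.dim {c. Delta \<mu> *v c = 0}"
proof -
  interpret E: Vector_Spaces.linear "(*s)" scaleF "eig \<mu>" by (rule eig_linear)
  let ?K = "{c. Delta \<mu> *v c = 0}"
  obtain B where B: "B \<subseteq> ?K" "vec.independent B" "?K \<subseteq> vec.span B" "card B = vec.dim ?K"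
    using vec.basis_exists by blast
  have "vfun.independent (eig \<mu> ` B)"
    using E.dependent_inj_imageD[of B] B(2) eig_inj by (metis inj_on_subset top_greatest)
  moreover have "vfun.span (eig \<mu> ` B) = vfun.span (eig \<mu> ` ?K)"
  proof -
    have "vec.span B = vec.span ?K" using B by (metis vec.span_mono vec.span_span subset_antisym)
    then show ?thesis by (simp add: E.span_image)
  qed
  ultimately have "vfun.dim (eig \<mu> ` ?K) = card (eig \<mu> ` B)" by (intro vfun.dim_eq_card)
  also have "\<dots> = card B" by (rule card_image) (use eig_inj inj_on_subset in blast)
  finally show ?thesis by (simp add: multiplicity_ev_def eigenspace_eq B)
qed

lemma is_eigenvalue_iff: "is_eigenvalue Q h H \<mu> \<longleftrightarrow> (\<exists>c. c \<noteq> 0 \<and> Delta \<mu> *v c = 0)"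
proof -
  have "eig \<mu> c = 0 \<longleftrightarrow> c = 0" for c
    using eig_inj[of \<mu>] eig_0[of \<mu>] by (metis injD)
  then show ?thesis unfolding is_eigenvalue_def eigenspace_eq by auto
qed

end

section \<open>Holomorphic dependence on the spectral parameter\<close>

lemma has_field_derivative_quadratic:
  fixes f :: "complex \<Rightarrow> complex"
  assumes "\<And>z. norm (z - a) \<le> 1 \<Longrightarrow> norm (f z - f a - D * (z - a)) \<le> C * (norm (z - a))\<^sup>2"
  shows "(f has_field_derivative D) (at a)"
  unfolding has_field_derivative_def has_derivative_at_alt
proof (intro conjI allI impI)
  show "bounded_linear ((*) D)" by (rule bounded_linear_mult_right)
  fix e :: real assume e: "e > 0"
  define d where "d = min 1 (e / (\<bar>C\<bar> + 1))"
  have "norm (f y - f a - D * (y - a)) \<le> e * norm (y - a)" if y: "norm (y - a) < d" for y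
  proof -
    have y1: "norm (y - a) \<le> 1" "norm (y - a) \<le> e / (\<bar>C\<bar> + 1)" using y by (auto simp: d_def)
    have "norm (f y - f a - D * (y - a)) \<le> C * (norm (y - a))\<^sup>2" by (rule assms[OF y1(1)])
    also have "\<dots> \<le> ((\<bar>C\<bar> + 1) * norm (y - a)) * norm (y - a)"
      unfolding power2_eq_square mult.assoc by (rule mult_right_mono) auto
    also have "\<dots> \<le> e * norm (y - a)"
      using y1(2) by (intro mult_right_mono) (auto simp: field_simps)
    finally show ?thesis .
  qed
  moreover have "d > 0" using e by (simp add: d_def)
  ultimately show "\<exists>d>0. \<forall>y. norm (y - a) < d \<longrightarrow> norm (f y - f a - D * (y - a)) \<le> e * norm (y - a)" by blast
qed

text \<open>Complex scaling of state pairs. Since \<open>bounded_linear\<close> means real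
  linearity, compatibility of the system with complex factors is recorded separately in
  \<open>sys_pscale\<close>.\<close>

definition pscale :: "complex \<Rightarrow> (complex^'n) \<times> (complex^'n) \<Rightarrow> (complex^'n) \<times> (complex^'n)" where
  "pscale a z = (a *s fst z, a *s snd z)"

lemma bounded_linear_pscale: "bounded_linear (pscale a)"
  unfolding pscale_def[abs_def]
  by (intro bounded_linear_Pair
        bounded_linear_compose[OF bounded_bilinear.bounded_linear_right[OF bounded_bilinear_cscale] bounded_linear_fst]
        bounded_linear_compose[OF bounded_bilinear.bounded_linear_right[OF bounded_bilinear_cscale] bounded_linear_snd])

lemma norm_pscale: "norm (pscale a z) = norm a * norm z"
  unfolding pscale_def norm_Pair norm_cscale
  by (cases z) (simp add: norm_Pair power_mult_distrib real_sqrt_mult flip: distrib_left)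

lemma det_holomorphic:
  fixes A :: "complex \<Rightarrow> complex^'n^'n"
  assumes "\<And>i j. (\<lambda>z. A z $ i $ j) holomorphic_on S"
  shows "(\<lambda>z. det (A z)) holomorphic_on S"
  unfolding det_def by (intro holomorphic_intros assms)

lemma matrix_entry: "(M :: complex^'n^'n) $ i $ j = (M *v axis j 1) $ i"
  by (simp add: matrix_vector_mult_def axis_def if_distrib cong: if_cong)

context sturm_liouville
begin

lemma sys_pscale: "sys \<mu> t (pscale a z) = pscale a (sys \<mu> t z)"
  by (simp add: sys_def pscale_def matvec_cscale vec_eq_iff algebra_simps)

lemma sys_shift: "sys \<nu> t z = sys \<mu> t z + pscale (\<mu> - \<nu>) (0, fst z)"
  by (simp add: sys_def pscale_def prod_eq_iff vec_eq_iff algebra_simps)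

definition state :: "complex \<Rightarrow> complex^'m \<Rightarrow> real \<Rightarrow> (complex^'m) \<times> (complex^'m)" where
  "state \<mu> c x = (phi \<mu> c x, dphi \<mu> c x)"

lemma state_cont: "continuous_on {0..pi} (state \<mu> c)"
  unfolding state_def by (intro continuous_intros phi_cont)

lemma state_eq: "x \<in> {0..pi} \<Longrightarrow> state \<mu> c x = (c, h *v c) + integral {0..x} (\<lambda>t. sys \<mu> t (state \<mu> c t))"
  using ode_integral[OF phi_ode, of x \<mu> c] by (simp add: state_def phi_0 dphi_0)

definition growth :: "complex \<Rightarrow> real" where
  "growth \<mu> = volterra.weight (\<lambda>t. (1 + norm \<mu>) + entry_sum (Q t)) pi"

text \<open>Makes the stability constant uniform for \<mu> in the unit disc around a fixed
  parameter, as \<open>state_lipschitz\<close> requires.\<close>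

lemma growth_mono:
  assumes "norm \<mu> \<le> norm \<nu>"
  shows "growth \<mu> \<le> growth \<nu>"
proof -
  have "integral {0..pi} (\<lambda>t. ((1 + norm \<mu>) + entry_sum (Q t))\<^sup>2) \<le> integral {0..pi} (\<lambda>t. ((1 + norm \<nu>) + entry_sum (Q t))\<^sup>2)"
    by (intro integral_le Q_sum_sq_int power_mono) (use assms entry_sum_nonneg in \<open>auto intro!: add_nonneg_nonneg\<close>)
  then show ?thesis unfolding growth_def volterra.weight_def[OF volterra_sys] by simp
qed

lemma growth_pos: "growth \<mu> \<ge> 2"
  unfolding growth_def by (rule volterra.weight_pos[OF volterra_sys])

lemma sys_stability:
  assumes f: "continuous_on {0..pi} f" and B: "0 \<le> B"
    and eq: "\<And>x. x \<in> {0..pi} \<Longrightarrow> f x = g x + integral {0..x} (\<lambda>t. sys \<mu> t (f t))"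
    and gB: "\<And>x. x \<in> {0..pi} \<Longrightarrow> norm (g x) \<le> B" and x: "x \<in> {0..pi}"
  shows "norm (f x) \<le> 2 * B * exp (growth \<mu> * pi)"
proof -
  have "norm (f x) \<le> 2 * B * exp (growth \<mu> * x)"
    unfolding growth_def
  proof (rule volterra.stability[OF volterra_sys f B eq _ x])
    fix y assume y: "y \<in> {0..pi}"
    have "1 \<le> exp (growth \<mu> * y)" using growth_pos[of \<mu>] y by simp
    then have "B * 1 \<le> B * exp (growth \<mu> * y)" by (intro mult_left_mono B)
    then show "norm (g y) \<le> B * exp (volterra.weight (\<lambda>t. 1 + norm \<mu> + entry_sum (Q t)) pi * y)"
      using gB[OF y] by (simp add: growth_def)
  qed
  also have "\<dots> \<le> 2 * B * exp (growth \<mu> * pi)"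
    using x B growth_pos[of \<mu>] by (intro mult_left_mono) auto
  finally show ?thesis .
qed

text \<open>Moving the difference of the parameters into a source term shows that the difference of
  two solutions satisfies a Volterra equation for one of the parameters, with a source proportional
  to \<mu> - \<nu>.\<close>

lemma state_diff_eq:
  assumes x: "x \<in> {0..pi}"
  shows "state \<mu> c x - state \<nu> c x =
     - pscale (\<mu> - \<nu>) (integral {0..x} (\<lambda>t. (0, phi \<mu> c t))) + integral {0..x} (\<lambda>t. sys \<nu> t (state \<mu> c t - state \<nu> c t))"
proof -
  have i: "(\<lambda>t. sys \<mu> t (state \<mu> c t)) integrable_on {0..x}" "(\<lambda>t. sys \<nu> t (state \<nu> c t)) integrable_on {0..x}"
    "(\<lambda>t. sys \<nu> t (state \<mu> c t)) integrable_on {0..x}"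
    by (rule sys_int, rule state_cont, use x in simp)+
  have p: "(\<lambda>t. (0 :: complex^'m, phi \<mu> c t)) integrable_on {0..x}"
    by (intro integrable_continuous_real continuous_intros continuous_on_subset[OF phi_cont(1)]) (use x in auto)
  have p': "(\<lambda>t. pscale (\<mu> - \<nu>) (0, phi \<mu> c t)) integrable_on {0..x}"
    "integral {0..x} (\<lambda>t. pscale (\<mu> - \<nu>) (0, phi \<mu> c t)) = pscale (\<mu> - \<nu>) (integral {0..x} (\<lambda>t. (0, phi \<mu> c t)))"
    using integrable_linear[OF p bounded_linear_pscale] integral_linear[OF p bounded_linear_pscale] by (simp_all add: o_def)
  have "integral {0..x} (\<lambda>t. sys \<nu> t (state \<mu> c t - state \<nu> c t)) =
     integral {0..x} (\<lambda>t. sys \<nu> t (state \<mu> c t)) - integral {0..x} (\<lambda>t. sys \<nu> t (state \<nu> c t))"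
    unfolding volterra.A_diff[OF volterra_sys] by (rule integral_diff[OF i(3,2)])
  also have "integral {0..x} (\<lambda>t. sys \<nu> t (state \<mu> c t)) =
      integral {0..x} (\<lambda>t. sys \<mu> t (state \<mu> c t)) + pscale (\<mu> - \<nu>) (integral {0..x} (\<lambda>t. (0, phi \<mu> c t)))"
    unfolding sys_shift[of \<nu> _ _ \<mu>] using i(1) p' by (simp add: integral_add state_def)
  finally show ?thesis using state_eq[OF x, of \<mu> c] state_eq[OF x, of \<nu> c] by simp
qed

lemma norm_integral_pair_le:
  fixes f :: "real \<Rightarrow> complex^'m"
  assumes "continuous_on {0..pi} f" "x \<in> {0..pi}" "\<And>t. t \<in> {0..pi} \<Longrightarrow> norm (f t) \<le> B"
  shows "norm (integral {0..x} (\<lambda>t. (0 :: complex^'m, f t))) \<le> B * pi"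
proof -
  have B: "B \<ge> 0" using assms(3)[of 0] norm_ge_zero[of "f 0"] by (meson atLeastAtMost_iff order_refl order_trans pi_ge_zero)
  have "norm (integral {0..x} (\<lambda>t. (0 :: complex^'m, f t))) \<le> B * (x - 0)"
    by (rule integral_bound) (use assms in \<open>auto simp: norm_Pair intro!: continuous_intros intro: continuous_on_subset\<close>)
  also have "\<dots> \<le> B * pi" using assms(2) B by (intro mult_left_mono) auto
  finally show ?thesis .
qed

lemma state_lipschitz:
  obtains C where "C \<ge> 0"
    "\<And>\<mu> x. norm (\<mu> - \<nu>) \<le> 1 \<Longrightarrow> x \<in> {0..pi} \<Longrightarrow> norm (state \<mu> c x - state \<nu> c x) \<le> C * norm (\<mu> - \<nu>)"
proof -
  have "bounded (phi \<nu> c ` {0..pi})" by (intro compact_imp_bounded compact_continuous_image phi_cont) auto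
  then obtain M where M: "M > 0" "\<And>x. x \<in> {0..pi} \<Longrightarrow> norm (phi \<nu> c x) \<le> M" unfolding bounded_pos by (metis imageI)
  define G where "G = growth (of_real (norm \<nu> + 1))"
  define C where "C = 2 * (M * pi) * exp (G * pi)"
  have "norm (state \<mu> c x - state \<nu> c x) \<le> C * norm (\<mu> - \<nu>)" if mu: "norm (\<mu> - \<nu>) \<le> 1" and x: "x \<in> {0..pi}" for \<mu> x
  proof -
    have "norm \<mu> \<le> norm \<nu> + 1" using mu norm_triangle_sub[of \<mu> \<nu>] by simp
    then have g: "growth \<mu> \<le> G" unfolding G_def by (intro growth_mono) (simp del: of_real_add)
    \<comment> \<open>The roles of \<mu> and \<nu> are exchanged so that the source contains
      \<open>phi \<nu>\<close>, whose bound \<open>M\<close> is independent of \<mu>.\<close>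
    have "norm (state \<nu> c x - state \<mu> c x) \<le> 2 * (norm (\<mu> - \<nu>) * (M * pi)) * exp (growth \<mu> * pi)"
    proof (rule sys_stability[OF _ _ state_diff_eq _ x])
      show "continuous_on {0..pi} (\<lambda>x. state \<nu> c x - state \<mu> c x)" by (intro continuous_intros state_cont)
      fix y assume y: "y \<in> {0..pi}"
      have "norm (integral {0..y} (\<lambda>t. (0 :: complex^'m, phi \<nu> c t))) \<le> M * pi"
        by (rule norm_integral_pair_le[OF phi_cont(1) y M(2)])
      then show "norm (- pscale (\<nu> - \<mu>) (integral {0..y} (\<lambda>t. (0, phi \<nu> c t)))) \<le> norm (\<mu> - \<nu>) * (M * pi)"
        unfolding norm_minus_cancel norm_pscale norm_minus_commute[of \<nu>] by (intro mult_left_mono) auto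
    qed (use M in auto)
    also have "\<dots> \<le> 2 * (norm (\<mu> - \<nu>) * (M * pi)) * exp (G * pi)"
      using g M by (intro mult_left_mono) auto
    finally show ?thesis by (simp add: C_def norm_minus_commute mult_ac)
  qed
  moreover have "C \<ge> 0" using M by (simp add: C_def)
  ultimately show thesis using that by blast
qed

text \<open>The candidate \<open>w\<close> for the derivative solves the equation differentiated in the spectral parameter.\<close>

lemma state_differentiable:
  obtains w C where
    "\<And>\<mu>. norm (\<mu> - \<nu>) \<le> 1 \<Longrightarrow> norm (state \<mu> c pi - state \<nu> c pi - pscale (\<mu> - \<nu>) w) \<le> C * (norm (\<mu> - \<nu>))\<^sup>2"
proof -
  define g0 where "g0 x = - integral {0..x} (\<lambda>t. (0 :: complex^'m, phi \<nu> c t))" for x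
  have pint: "(\<lambda>t. (0 :: complex^'m, phi \<mu> c t)) integrable_on {0..pi}" for \<mu>
    by (intro integrable_continuous_real continuous_intros phi_cont)
  have "continuous_on {0..pi} g0" unfolding g0_def
    by (intro continuous_on_minus indefinite_integral_continuous_1 pint)
  then obtain f where f: "continuous_on {0..pi} f"
    "\<And>x. x \<in> {0..pi} \<Longrightarrow> f x = g0 x + integral {0..x} (\<lambda>t. sys \<nu> t (f t))"
    using volterra.solution_exists[OF volterra_sys, of g0 \<nu>] by blast
  obtain L where L: "L \<ge> 0"
    "\<And>\<mu> x. norm (\<mu> - \<nu>) \<le> 1 \<Longrightarrow> x \<in> {0..pi} \<Longrightarrow> norm (state \<mu> c x - state \<nu> c x) \<le> L * norm (\<mu> - \<nu>)"
    by (rule state_lipschitz[of \<nu> c]) (rule that, assumption, blast)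
  have "norm (state \<mu> c pi - state \<nu> c pi - pscale (\<mu> - \<nu>) (f pi)) \<le>
      2 * (L * pi) * exp (growth \<nu> * pi) * (norm (\<mu> - \<nu>))\<^sup>2" if mu: "norm (\<mu> - \<nu>) \<le> 1" for \<mu>
  proof -
    \<comment> \<open>The remainder solves the Volterra equation for \<nu> with source (\<mu> -
      \<nu>) times an integral of \<open>phi \<mu> c - phi \<nu> c\<close>; by the Lipschitz bound
      this source is quadratic in \<mu> - \<nu>.\<close>
    define r where "r x = state \<mu> c x - state \<nu> c x - pscale (\<mu> - \<nu>) (f x)" for x
    have cp: "continuous_on {0..pi} (\<lambda>x. pscale (\<mu> - \<nu>) (f x))"
      by (rule bounded_linear.continuous_on[OF bounded_linear_pscale f(1)])
    have r: "continuous_on {0..pi} r" unfolding r_def by (intro continuous_intros state_cont cp)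
    have "norm (r pi) \<le> 2 * (norm (\<mu> - \<nu>) * (L * norm (\<mu> - \<nu>) * pi)) * exp (growth \<nu> * pi)"
    proof (rule sys_stability[OF r])
      fix x assume x: "x \<in> {0..pi}"
      have p: "(\<lambda>t. (0 :: complex^'m, phi \<mu> c t)) integrable_on {0..x}" for \<mu>
        by (rule integrable_on_subinterval[OF pint]) (use x in auto)
      have s1: "(\<lambda>t. sys \<nu> t (state \<mu> c t - state \<nu> c t)) integrable_on {0..x}"
        by (rule sys_int) (use x in \<open>auto intro!: continuous_intros state_cont\<close>)
      have s2: "(\<lambda>t. sys \<nu> t (f t)) integrable_on {0..x}" by (rule sys_int[OF f(1)]) (use x in auto)
      have s3: "(\<lambda>t. pscale (\<mu> - \<nu>) (sys \<nu> t (f t))) integrable_on {0..x}"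
        "integral {0..x} (\<lambda>t. pscale (\<mu> - \<nu>) (sys \<nu> t (f t))) = pscale (\<mu> - \<nu>) (integral {0..x} (\<lambda>t. sys \<nu> t (f t)))"
        using integrable_linear[OF s2 bounded_linear_pscale] integral_linear[OF s2 bounded_linear_pscale] by (simp_all add: o_def)
      have lin: "pscale a (u + v) = pscale a u + pscale a v" "pscale a (u - v) = pscale a u - pscale a v"
        "pscale a (- u) = - pscale a u" for a and u v :: "(complex^'m) \<times> (complex^'m)"
        using bounded_linear_pscale bounded_linear.linear linear_add linear_diff linear_neg by blast+
      have "integral {0..x} (\<lambda>t. sys \<nu> t (r t)) =
         integral {0..x} (\<lambda>t. sys \<nu> t (state \<mu> c t - state \<nu> c t)) - pscale (\<mu> - \<nu>) (integral {0..x} (\<lambda>t. sys \<nu> t (f t)))"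
        unfolding r_def volterra.A_diff[OF volterra_sys, of _ _ "_ - _"] sys_pscale s3(2)[symmetric]
        by (rule integral_diff[OF s1 s3(1)])
      then have "r x = - pscale (\<mu> - \<nu>) (integral {0..x} (\<lambda>t. (0, phi \<mu> c t)) - integral {0..x} (\<lambda>t. (0, phi \<nu> c t)))
          + integral {0..x} (\<lambda>t. sys \<nu> t (r t))"
        unfolding r_def[of x] state_diff_eq[OF x] f(2)[OF x] g0_def by (simp add: lin)
      also have "integral {0..x} (\<lambda>t. (0 :: complex^'m, phi \<mu> c t)) - integral {0..x} (\<lambda>t. (0, phi \<nu> c t)) =
          integral {0..x} (\<lambda>t. (0, phi \<mu> c t - phi \<nu> c t))"
        by (subst integral_diff[OF p p, symmetric]) simp
      finally show "r x = - pscale (\<mu> - \<nu>) (integral {0..x} (\<lambda>t. (0, phi \<mu> c t - phi \<nu> c t)))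
          + integral {0..x} (\<lambda>t. sys \<nu> t (r t))" .
      have "norm (integral {0..x} (\<lambda>t. (0 :: complex^'m, phi \<mu> c t - phi \<nu> c t))) \<le> L * norm (\<mu> - \<nu>) * pi"
      proof (rule norm_integral_pair_le[OF _ x])
        show "continuous_on {0..pi} (\<lambda>t. phi \<mu> c t - phi \<nu> c t)" by (intro continuous_intros phi_cont)
        fix t assume t: "t \<in> {0..pi}"
        have "norm (phi \<mu> c t - phi \<nu> c t) \<le> norm (state \<mu> c t - state \<nu> c t)"
          unfolding state_def by (simp add: norm_fst_le)
        then show "norm (phi \<mu> c t - phi \<nu> c t) \<le> L * norm (\<mu> - \<nu>)" using L(2)[OF mu t] by linarith
      qed
      then show "norm (- pscale (\<mu> - \<nu>) (integral {0..x} (\<lambda>t. (0, phi \<mu> c t - phi \<nu> c t)))) \<le>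
          norm (\<mu> - \<nu>) * (L * norm (\<mu> - \<nu>) * pi)"
        unfolding norm_minus_cancel norm_pscale by (intro mult_left_mono) auto
    qed (use L in auto)
    then show ?thesis by (simp add: r_def power2_eq_square mult_ac)
  qed
  then show thesis by (rule that)
qed

lemma phi_pi_has_derivative:
  shows "\<exists>D. ((\<lambda>\<mu>. phi \<mu> c pi $ i) has_field_derivative D) (at \<nu>)"
    and "\<exists>D. ((\<lambda>\<mu>. dphi \<mu> c pi $ i) has_field_derivative D) (at \<nu>)"
proof -
  obtain w C where wC: "\<And>\<mu>. norm (\<mu> - \<nu>) \<le> 1 \<Longrightarrow> norm (state \<mu> c pi - state \<nu> c pi - pscale (\<mu> - \<nu>) w) \<le> C * (norm (\<mu> - \<nu>))\<^sup>2"
    by (rule state_differentiable[of \<nu> c]) (rule that, blast)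
  have "((\<lambda>\<mu>. phi \<mu> c pi $ i) has_field_derivative (fst w $ i)) (at \<nu>)"
  proof (rule has_field_derivative_quadratic)
    fix \<mu> assume mu: "norm (\<mu> - \<nu>) \<le> 1"
    have "phi \<mu> c pi $ i - phi \<nu> c pi $ i - fst w $ i * (\<mu> - \<nu>) =
       fst (state \<mu> c pi - state \<nu> c pi - pscale (\<mu> - \<nu>) w) $ i"
      by (simp add: state_def pscale_def algebra_simps)
    also have "norm \<dots> \<le> norm (state \<mu> c pi - state \<nu> c pi - pscale (\<mu> - \<nu>) w)"
      by (metis Finite_Cartesian_Product.norm_nth_le norm_fst_le order_trans prod.collapse)
    finally show "norm (phi \<mu> c pi $ i - phi \<nu> c pi $ i - fst w $ i * (\<mu> - \<nu>)) \<le> C * (norm (\<mu> - \<nu>))\<^sup>2"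
      using wC[OF mu] by linarith
  qed
  then show "\<exists>D. ((\<lambda>\<mu>. phi \<mu> c pi $ i) has_field_derivative D) (at \<nu>)" by blast
  have "((\<lambda>\<mu>. dphi \<mu> c pi $ i) has_field_derivative (snd w $ i)) (at \<nu>)"
  proof (rule has_field_derivative_quadratic)
    fix \<mu> assume mu: "norm (\<mu> - \<nu>) \<le> 1"
    have "dphi \<mu> c pi $ i - dphi \<nu> c pi $ i - snd w $ i * (\<mu> - \<nu>) =
       snd (state \<mu> c pi - state \<nu> c pi - pscale (\<mu> - \<nu>) w) $ i"
      by (simp add: state_def pscale_def algebra_simps)
    also have "norm \<dots> \<le> norm (state \<mu> c pi - state \<nu> c pi - pscale (\<mu> - \<nu>) w)"
      by (metis Finite_Cartesian_Product.norm_nth_le norm_snd_le order_trans prod.collapse)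
    finally show "norm (dphi \<mu> c pi $ i - dphi \<nu> c pi $ i - snd w $ i * (\<mu> - \<nu>)) \<le> C * (norm (\<mu> - \<nu>))\<^sup>2"
      using wC[OF mu] by linarith
  qed
  then show "\<exists>D. ((\<lambda>\<mu>. dphi \<mu> c pi $ i) has_field_derivative D) (at \<nu>)" by blast
qed

lemma Delta_mult_holomorphic: "(\<lambda>\<mu>. (Delta \<mu> *v c) $ i) holomorphic_on UNIV"
proof -
  have 1: "(\<lambda>\<mu>. phi \<mu> c pi $ j) holomorphic_on UNIV" for j
    using phi_pi_has_derivative(1) by (auto simp: holomorphic_on_open)
  have 2: "(\<lambda>\<mu>. dphi \<mu> c pi $ j) holomorphic_on UNIV" for j
    using phi_pi_has_derivative(2) by (auto simp: holomorphic_on_open)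
  have "(\<lambda>\<mu>. dphi \<mu> c pi $ i + (\<Sum>j\<in>UNIV. H $ i $ j * phi \<mu> c pi $ j)) holomorphic_on UNIV"
    by (intro holomorphic_intros 1 2)
  then show ?thesis unfolding Delta_mult by (simp add: matrix_vector_mult_def)
qed

lemma Delta_entry_holomorphic: "(\<lambda>\<mu>. Delta \<mu> $ i $ j) holomorphic_on UNIV"
  unfolding matrix_entry by (rule Delta_mult_holomorphic)

lemma det_Delta_holomorphic: "(\<lambda>\<mu>. det (Delta \<mu>)) holomorphic_on UNIV"
  by (rule det_holomorphic[OF Delta_entry_holomorphic])

end

section \<open>The order of a zero of the characteristic determinant\<close>

text \<open>A basis of the kernel is extended to the whole space and indexed by the type
  \<open>'n\<close> itself, so that it can serve as the columns of a square matrix; \<open>J\<close>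
  marks the kernel columns.\<close>

lemma kernel_adapted_basis:
  fixes A :: "complex^'n^'n"
  obtains f :: "'n \<Rightarrow> complex^'n" and J where
    "card J = vec.dim {c. A *v c = 0}"
    "\<And>j. j \<in> J \<Longrightarrow> A *v f j = 0"
    "\<And>x :: complex^'n. (\<Sum>j\<in>UNIV. x $ j *s f j) = 0 \<Longrightarrow> x = 0"
    "\<And>w. A *v w = 0 \<Longrightarrow> \<exists>x :: complex^'n. (\<forall>j. j \<notin> J \<longrightarrow> x $ j = 0) \<and> w = (\<Sum>j\<in>UNIV. x $ j *s f j)"
proof -
  let ?K = "{c. A *v c = 0}"
  obtain B where B: "B \<subseteq> ?K" "vec.independent B" "?K \<subseteq> vec.span B" "card B = vec.dim ?K"
    using vec.basis_exists by blast
  define B' where "B' = vec.extend_basis B"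
  have B': "B \<subseteq> B'" "vec.independent B'" "vec.span B' = UNIV"
    using vec.extend_basis_superset[OF B(2)] vec.independent_extend_basis[OF B(2)] vec.span_extend_basis[OF B(2)]
    by (auto simp: B'_def)
  have fin: "finite B'" using B'(2) vec.finiteI_independent by blast
  have "card B' = vec.dim (UNIV :: (complex^'n) set)"
    using B' by (metis vec.dim_eq_card vec.span_UNIV)
  then have "card B' = CARD('n)" by (simp add: vec.dim_UNIV card_cart_basis vec.dimension_def)
  then obtain f :: "'n \<Rightarrow> complex^'n" where f: "bij_betw f UNIV B'"
    using finite_same_card_bij[of "UNIV :: 'n set" B'] fin by auto
  define g where "g = inv_into UNIV f"
  have inj: "inj f" and rng: "range f = B'" using f by (auto simp: bij_betw_def)
  have gf: "g (f j) = j" for j using inj by (simp add: g_def)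
  have sumf: "(\<Sum>j\<in>UNIV. u j *s f j) = (\<Sum>b\<in>B'. u (g b) *s b)" for u
    unfolding rng[symmetric] by (subst sum.reindex[OF inj]) (simp add: gf)
  define J where "J = {j. f j \<in> B}"
  have "f ` J = B" using B'(1) rng by (auto simp: J_def)
  then have cJ: "card J = card B" using inj by (metis card_image inj_on_subset top_greatest)
  show thesis
  proof (rule that[of J f])
    show "card J = vec.dim ?K" using cJ B(4) by simp
    show "A *v f j = 0" if "j \<in> J" for j using that B(1) by (auto simp: J_def)
  next
    fix x :: "complex^'n" assume "(\<Sum>j\<in>UNIV. x $ j *s f j) = 0"
    then have "(\<Sum>b\<in>B'. x $ (g b) *s b) = 0" using sumf[of "\<lambda>j. x $ j"] by simp
    then have "x $ (g b) = 0" if "b \<in> B'" for b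
      using vec.independentD[OF B'(2) fin order_refl, of "\<lambda>b. x $ g b"] that by blast
    then have "x $ j = 0" for j using rng gf by (metis rangeI)
    then show "x = 0" by (simp add: vec_eq_iff)
  next
    fix w assume "A *v w = 0"
    then have "w \<in> vec.span B" using B(3) by blast
    moreover have "finite B" using fin B'(1) finite_subset by blast
    ultimately obtain u where u: "w = (\<Sum>b\<in>B. u b *s b)" by (auto simp: vec.span_finite)
    define x :: "complex^'n" where "x = (\<chi> j. if f j \<in> B then u (f j) else 0)"
    have "(\<Sum>j\<in>UNIV. x $ j *s f j) = (\<Sum>j\<in>UNIV. (if f j \<in> B then u (f j) else 0) *s f j)" by (simp add: x_def)
    also have "\<dots> = (\<Sum>b\<in>B'. (if b \<in> B then u b else 0) *s b)"
      unfolding rng[symmetric] by (subst sum.reindex[OF inj]) simp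
    also have "\<dots> = w" unfolding u
      by (rule sum.mono_neutral_cong_right[OF fin B'(1)]) auto
    finally have "w = (\<Sum>j\<in>UNIV. x $ j *s f j)" by simp
    then show "\<exists>x :: complex^'n. (\<forall>j. j \<notin> J \<longrightarrow> x $ j = 0) \<and> w = (\<Sum>j\<in>UNIV. x $ j *s f j)"
      by (intro exI[of _ x]) (auto simp: x_def J_def)
  qed
qed

lemma det_nonzero_iff_kernel:
  fixes A :: "complex^'n^'n"
  shows "det A \<noteq> 0 \<longleftrightarrow> (\<forall>x. A *v x = 0 \<longrightarrow> x = 0)"
  using matrix_left_invertible_ker[of A] invertible_left_inverse[of A] invertible_det_nz[of A] by auto

lemma sum_cscale_matvec: "(M :: complex^'n^'n) *v (\<Sum>j\<in>S. u j *s f j) = (\<Sum>j\<in>S. u j *s (M *v f j))"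
  by (induction S rule: infinite_finite_induct) (simp_all add: matrix_vector_right_distrib matvec_cscale)

context sturm_liouville
begin

lemma is_eigenvalue_det: "is_eigenvalue Q h H \<mu> \<longleftrightarrow> det (Delta \<mu>) = 0"
  using det_nonzero_iff_kernel[of "Delta \<mu>"] unfolding is_eigenvalue_iff by blast

definition dDelta :: "complex \<Rightarrow> complex^'m^'m" where
  "dDelta \<mu> = (\<chi> i j. deriv (\<lambda>\<mu>. Delta \<mu> $ i $ j) \<mu>)"

lemma Delta_mult_deriv: "((\<lambda>\<mu>. (Delta \<mu> *v c) $ i) has_field_derivative (dDelta \<nu> *v c) $ i) (at \<nu>)"
proof -
  have "((\<lambda>\<mu>. Delta \<mu> $ i $ j) has_field_derivative dDelta \<nu> $ i $ j) (at \<nu>)" for j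
    unfolding dDelta_def using Delta_entry_holomorphic[of i j] by (simp add: holomorphic_derivI)
  then have "((\<lambda>\<mu>. \<Sum>j\<in>UNIV. Delta \<mu> $ i $ j * c $ j) has_field_derivative (\<Sum>j\<in>UNIV. dDelta \<nu> $ i $ j * c $ j)) (at \<nu>)"
    by (intro DERIV_sum DERIV_cmult_right)
  then show ?thesis by (simp add: matrix_vector_mult_def)
qed

text \<open>Removable singularity: a holomorphic vector function that vanishes at \<nu> is divisible
  by \<mu> - \<nu>, and the quotient takes the derivative as its value there.\<close>

lemma Delta_mult_quotient:
  assumes "Delta \<nu> *v c = 0"
  obtains b :: "complex \<Rightarrow> complex^'m" where "\<And>i. (\<lambda>\<mu>. b \<mu> $ i) holomorphic_on UNIV" "b \<nu> = dDelta \<nu> *v c"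
    "\<And>\<mu>. Delta \<mu> *v c = (\<mu> - \<nu>) *s b \<mu>"
proof -
  define b :: "complex \<Rightarrow> complex^'m" where
    "b \<mu> = (\<chi> i. if \<mu> = \<nu> then deriv (\<lambda>\<mu>. (Delta \<mu> *v c) $ i) \<nu> else ((Delta \<mu> *v c) $ i - (Delta \<nu> *v c) $ i) / (\<mu> - \<nu>))" for \<mu>
  show thesis
  proof (rule that[of b])
    show "(\<lambda>\<mu>. b \<mu> $ i) holomorphic_on UNIV" for i
      unfolding b_def vec_lambda_beta by (rule pole_lemma_open[OF Delta_mult_holomorphic open_UNIV])
    show "b \<nu> = dDelta \<nu> *v c"
      unfolding b_def vec_eq_iff using DERIV_imp_deriv[OF Delta_mult_deriv] by simp
    have "(Delta \<mu> *v c) $ i = (\<mu> - \<nu>) * b \<mu> $ i" for \<mu> i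
      using assms by (cases "\<mu> = \<nu>") (auto simp: b_def)
    then show "Delta \<mu> *v c = (\<mu> - \<nu>) *s b \<mu>" for \<mu>
      unfolding vec_eq_iff vector_smult_component by blast
  qed
qed

lemma integral_phi_tendsto:
  "((\<lambda>\<mu>. integral {0..pi} (\<lambda>t. cip (phi \<nu> c t) (phi \<mu> d t))) \<longlongrightarrow>
     integral {0..pi} (\<lambda>t. cip (phi \<nu> c t) (phi \<nu> d t))) (at \<nu>)"
proof -
  obtain L where L: "L \<ge> 0"
    "\<And>\<mu> x. norm (\<mu> - \<nu>) \<le> 1 \<Longrightarrow> x \<in> {0..pi} \<Longrightarrow> norm (state \<mu> d x - state \<nu> d x) \<le> L * norm (\<mu> - \<nu>)"
    by (rule state_lipschitz[of \<nu> d]) (rule that, assumption, blast)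
  have "bounded (phi \<nu> c ` {0..pi})" by (intro compact_imp_bounded compact_continuous_image phi_cont) auto
  then obtain M where M: "M > 0" "\<And>x. x \<in> {0..pi} \<Longrightarrow> norm (phi \<nu> c x) \<le> M" unfolding bounded_pos by (metis imageI)
  obtain K where K: "K > 0" "\<And>u w :: complex^'m. norm (cip u w) \<le> norm u * norm w * K"
    using bounded_bilinear.pos_bounded[OF bounded_bilinear_cip] by blast
  have int: "(\<lambda>t. cip (phi \<nu> c t) (phi \<mu> d t)) integrable_on {0..pi}" for \<mu>
    by (intro integrable_continuous_real continuous_intros phi_cont)
  have bnd: "norm (integral {0..pi} (\<lambda>t. cip (phi \<nu> c t) (phi \<mu> d t)) - integral {0..pi} (\<lambda>t. cip (phi \<nu> c t) (phi \<nu> d t)))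
     \<le> norm (\<mu> - \<nu>) * (M * L * K * pi)" if mu: "norm (\<mu> - \<nu>) \<le> 1" for \<mu>
  proof -
    have "integral {0..pi} (\<lambda>t. cip (phi \<nu> c t) (phi \<mu> d t)) - integral {0..pi} (\<lambda>t. cip (phi \<nu> c t) (phi \<nu> d t))
      = integral {0..pi} (\<lambda>t. cip (phi \<nu> c t) (phi \<mu> d t - phi \<nu> d t))"
      unfolding cip_diff_right by (rule integral_diff[OF int int, symmetric])
    also have "norm \<dots> \<le> (M * (L * norm (\<mu> - \<nu>)) * K) * (pi - 0)"
    proof (rule integral_bound)
      show "continuous_on {0..pi} (\<lambda>t. cip (phi \<nu> c t) (phi \<mu> d t - phi \<nu> d t))" by (intro continuous_intros phi_cont)
      fix t assume t: "t \<in> {0..pi}"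
      have "norm (phi \<mu> d t - phi \<nu> d t) \<le> norm (state \<mu> d t - state \<nu> d t)"
        unfolding state_def by (simp add: norm_fst_le)
      then have "norm (phi \<mu> d t - phi \<nu> d t) \<le> L * norm (\<mu> - \<nu>)" using L(2)[OF mu t] by linarith
      then have "norm (phi \<nu> c t) * norm (phi \<mu> d t - phi \<nu> d t) * K \<le> M * (L * norm (\<mu> - \<nu>)) * K"
        using M(2)[OF t] M(1) K(1) by (intro mult_right_mono mult_mono) auto
      then show "norm (cip (phi \<nu> c t) (phi \<mu> d t - phi \<nu> d t)) \<le> M * (L * norm (\<mu> - \<nu>)) * K"
        using K(2) order_trans by blast
    qed simp
    finally show ?thesis by (simp add: mult_ac)
  qed
  show ?thesis unfolding LIM_def
  proof (intro allI impI)
    fix e :: real assume e: "e > 0"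
    define G where "G = M * L * K * pi + 1"
    have G: "G > 0" unfolding G_def using M K L by (intro add_nonneg_pos mult_nonneg_nonneg) auto
    have "norm (integral {0..pi} (\<lambda>t. cip (phi \<nu> c t) (phi \<mu> d t)) - integral {0..pi} (\<lambda>t. cip (phi \<nu> c t) (phi \<nu> d t))) < e"
      if "\<mu> \<noteq> \<nu>" "norm (\<mu> - \<nu>) < min 1 (e / G)" for \<mu>
    proof -
      have "norm (integral {0..pi} (\<lambda>t. cip (phi \<nu> c t) (phi \<mu> d t)) - integral {0..pi} (\<lambda>t. cip (phi \<nu> c t) (phi \<nu> d t)))
        \<le> norm (\<mu> - \<nu>) * (M * L * K * pi)" by (rule bnd) (use that in simp)
      also have "\<dots> \<le> norm (\<mu> - \<nu>) * G" by (intro mult_left_mono) (auto simp: G_def)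
      also have "\<dots> < e" using that G by (simp add: field_simps)
      finally show ?thesis .
    qed
    then show "\<exists>s>0. \<forall>x. x \<noteq> \<nu> \<and> dist x \<nu> < s \<longrightarrow>
      dist (integral {0..pi} (\<lambda>t. cip (phi \<nu> c t) (phi x d t))) (integral {0..pi} (\<lambda>t. cip (phi \<nu> c t) (phi \<nu> d t))) < e"
      using e G by (intro exI[of _ "min 1 (e / G)"]) (auto simp: dist_norm)
  qed
qed

text \<open>With \<open>c\<close> and \<open>d\<close> in the kernel and \<nu> real, both sides of
  Lagrange's identity carry the factor \<mu> - \<nu>. It is cancelled for \<mu> different from
  \<nu>, and then \<mu> tends to \<nu>.\<close>

lemma cip_Phi_dDelta:
  assumes c: "Delta \<nu> *v c = 0" and d: "Delta \<nu> *v d = 0" and real: "cnj \<nu> = \<nu>"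
  shows "cip (Phi \<nu> *v c) (dDelta \<nu> *v d) = - integral {0..pi} (\<lambda>t. cip (phi \<nu> c t) (phi \<nu> d t))"
proof -
  obtain b :: "complex \<Rightarrow> complex^'m" where b: "\<And>i. (\<lambda>\<mu>. b \<mu> $ i) holomorphic_on UNIV" "b \<nu> = dDelta \<nu> *v d"
    "\<And>\<mu>. Delta \<mu> *v d = (\<mu> - \<nu>) *s b \<mu>"
    using Delta_mult_quotient[OF d] by blast
  have eq: "cip (Phi \<nu> *v c) (b \<mu>) = - integral {0..pi} (\<lambda>t. cip (phi \<nu> c t) (phi \<mu> d t))" if "\<mu> \<noteq> \<nu>" for \<mu>
  proof -
    have "(\<mu> - \<nu>) * (- cip (Phi \<nu> *v c) (b \<mu>)) = (\<mu> - \<nu>) * integral {0..pi} (\<lambda>t. cip (phi \<nu> c t) (phi \<mu> d t))"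
      using lagrange[of \<nu> c \<mu> d] unfolding c real b(3)[of \<mu>] cip_zero_left cip_scale_right by simp
    then have "- cip (Phi \<nu> *v c) (b \<mu>) = integral {0..pi} (\<lambda>t. cip (phi \<nu> c t) (phi \<mu> d t))"
      by (subst (asm) mult_left_cancel) (use that in auto)
    then show ?thesis by (metis minus_minus)
  qed
  have "((\<lambda>\<mu>. \<Sum>i\<in>UNIV. cnj ((Phi \<nu> *v c) $ i) * b \<mu> $ i) \<longlongrightarrow> (\<Sum>i\<in>UNIV. cnj ((Phi \<nu> *v c) $ i) * b \<nu> $ i)) (at \<nu>)"
  proof (rule tendsto_sum, rule tendsto_mult_left)
    fix i
    have "isCont (\<lambda>\<mu>. b \<mu> $ i) \<nu>"
      using holomorphic_on_imp_continuous_on[OF b(1)] by (simp add: continuous_on_eq_continuous_at)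
    then show "((\<lambda>\<mu>. b \<mu> $ i) \<longlongrightarrow> b \<nu> $ i) (at \<nu>)" by (simp add: isCont_def)
  qed
  then have l1: "((\<lambda>\<mu>. cip (Phi \<nu> *v c) (b \<mu>)) \<longlongrightarrow> cip (Phi \<nu> *v c) (b \<nu>)) (at \<nu>)"
    by (simp add: cip_def)
  have "((\<lambda>\<mu>. - integral {0..pi} (\<lambda>t. cip (phi \<nu> c t) (phi \<mu> d t))) \<longlongrightarrow>
     - integral {0..pi} (\<lambda>t. cip (phi \<nu> c t) (phi \<nu> d t))) (at \<nu>)"
    by (intro tendsto_minus integral_phi_tendsto)
  then have l2: "((\<lambda>\<mu>. cip (Phi \<nu> *v c) (b \<mu>)) \<longlongrightarrow> - integral {0..pi} (\<lambda>t. cip (phi \<nu> c t) (phi \<nu> d t))) (at \<nu>)"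
    by (rule Lim_transform_eventually) (auto simp: eventually_at_filter eq)
  show ?thesis using tendsto_unique[OF _ l1 l2] b(2) by simp
qed

text \<open>In a basis adapted to the kernel of \<open>Delta \<nu>\<close>, divide the columns belonging to the kernel by
  \<open>\<mu> - \<nu>\<close>. Self-adjointness enters in the proof that the quotient is invertible at \<open>\<nu>\<close>.\<close>

lemma zorder_det_Delta:
  assumes "det (Delta \<nu>) = 0"
  shows "zorder (\<lambda>\<mu>. det (Delta \<mu>)) \<nu> = int (vec.dim {c. Delta \<nu> *v c = 0})"
proof -
  obtain f :: "'m \<Rightarrow> complex^'m" and J where
    fJ: "card J = vec.dim {c. Delta \<nu> *v c = 0}"
    "\<And>j. j \<in> J \<Longrightarrow> Delta \<nu> *v f j = 0"
    "\<And>x :: complex^'m. (\<Sum>j\<in>UNIV. x $ j *s f j) = 0 \<Longrightarrow> x = 0"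
    "\<And>w. Delta \<nu> *v w = 0 \<Longrightarrow> \<exists>x :: complex^'m. (\<forall>j. j \<notin> J \<longrightarrow> x $ j = 0) \<and> w = (\<Sum>j\<in>UNIV. x $ j *s f j)"
    by (rule kernel_adapted_basis[of "Delta \<nu>"]) (rule that, assumption, blast, blast, blast)
  have real: "cnj \<nu> = \<nu>"
    using assms det_nonzero_iff_kernel[of "Delta \<nu>"] Delta_kernel_real by blast
  have "\<exists>b :: complex \<Rightarrow> complex^'m. (\<forall>i. (\<lambda>\<mu>. b \<mu> $ i) holomorphic_on UNIV) \<and> (j \<in> J \<longrightarrow> b \<nu> = dDelta \<nu> *v f j \<and>
     (\<forall>\<mu>. Delta \<mu> *v f j = (\<mu> - \<nu>) *s b \<mu>)) \<and> (j \<notin> J \<longrightarrow> b = (\<lambda>\<mu>. Delta \<mu> *v f j))" for j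
  proof (cases "j \<in> J")
    case True
    then show ?thesis using Delta_mult_quotient[OF fJ(2)[OF True]] by metis
  next
    case False
    then show ?thesis by (intro exI[of _ "\<lambda>\<mu>. Delta \<mu> *v f j"]) (simp add: Delta_mult_holomorphic)
  qed
  then obtain b :: "'m \<Rightarrow> complex \<Rightarrow> complex^'m" where b: "\<And>j i. (\<lambda>\<mu>. b j \<mu> $ i) holomorphic_on UNIV"
    "\<And>j. j \<in> J \<Longrightarrow> b j \<nu> = dDelta \<nu> *v f j"
    "\<And>j \<mu>. j \<in> J \<Longrightarrow> Delta \<mu> *v f j = (\<mu> - \<nu>) *s b j \<mu>"
    "\<And>j \<mu>. j \<notin> J \<Longrightarrow> b j \<mu> = Delta \<mu> *v f j"
    by metis
  define C :: "complex^'m^'m" where "C = (\<chi> i j. f j $ i)"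
  define B :: "complex \<Rightarrow> complex^'m^'m" where "B \<mu> = (\<chi> i j. b j \<mu> $ i)" for \<mu>
  define D :: "complex \<Rightarrow> complex^'m^'m" where "D \<mu> = (\<chi> i j. if i = j then (if j \<in> J then \<mu> - \<nu> else 1) else 0)" for \<mu>
  have Cx: "C *v x = (\<Sum>j\<in>UNIV. x $ j *s f j)" for x
    by (simp add: C_def matrix_vector_mult_def vec_eq_iff mult.commute)
  have Bx: "B \<mu> *v x = (\<Sum>j\<in>UNIV. x $ j *s b j \<mu>)" for x \<mu>
    by (simp add: B_def matrix_vector_mult_def vec_eq_iff mult.commute)
  have detC: "det C \<noteq> 0" unfolding det_nonzero_iff_kernel Cx using fJ(3) by blast
  have detD: "det (D \<mu>) = (\<mu> - \<nu>) ^ card J" for \<mu>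
    by (subst det_diagonal) (auto simp: D_def prod.If_cases)
  \<comment> \<open>Taking determinants gives det Delta * det C = det B * (\<mu> - \<nu>)^(card J),
    so only the invertibility of \<open>B \<nu>\<close> remains to be shown.\<close>
  have fac: "Delta \<mu> ** C = B \<mu> ** D \<mu>" for \<mu>
  proof -
    have "(Delta \<mu> ** C) $ i $ j = (Delta \<mu> *v f j) $ i" for i j
      by (simp add: matrix_matrix_mult_def matrix_vector_mult_def C_def)
    moreover have "(B \<mu> ** D \<mu>) $ i $ j = (if j \<in> J then \<mu> - \<nu> else 1) * b j \<mu> $ i" for i j
      by (simp add: matrix_matrix_mult_def B_def D_def if_distrib mult.commute cong: if_cong)
    ultimately show ?thesis using b(3,4) by (simp add: vec_eq_iff left_diff_distrib)
  qed
  have detB: "det (B \<nu>) \<noteq> 0"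
    unfolding det_nonzero_iff_kernel
  proof (intro allI impI)
    fix x assume x: "B \<nu> *v x = 0"
    define u where "u = (\<Sum>j\<in>J. x $ j *s f j)"
    define w where "w = (\<Sum>j\<in>-J. x $ j *s f j)"
    have "0 = (\<Sum>j\<in>J. x $ j *s b j \<nu>) + (\<Sum>j\<in>-J. x $ j *s b j \<nu>)"
      using x unfolding Bx by (subst sum.union_disjoint[symmetric]) auto
    also have "\<dots> = dDelta \<nu> *v u + Delta \<nu> *v w"
      unfolding u_def w_def sum_cscale_matvec by (simp add: b(2,4))
    finally have 0: "dDelta \<nu> *v u + Delta \<nu> *v w = 0" by simp
    have Du: "Delta \<nu> *v u = 0" unfolding u_def sum_cscale_matvec by (simp add: fJ(2))
    \<comment> \<open>Pairing the relation with \<open>Phi \<nu> *v u\<close> removes the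
      \<open>w\<close> term by Lagrange's identity and leaves minus the integral of |phi u|^2, which
      forces \<open>u = 0\<close>.\<close>
    have "cip (Phi \<nu> *v u) (Delta \<nu> *v w) = 0"
      using lagrange[of \<nu> u \<nu> w] by (simp add: Du real cip_zero_left)
    then have "integral {0..pi} (\<lambda>t. cip (phi \<nu> u t) (phi \<nu> u t)) = 0"
      using arg_cong[OF 0, of "cip (Phi \<nu> *v u)"] cip_Phi_dDelta[OF Du Du real]
      by (simp add: cip_add_right cip_zero_right)
    then have u0: "u = 0" by (rule phi_norm_integral_zero)
    then have "Delta \<nu> *v w = 0" using 0 by simp
    \<comment> \<open>Now \<open>w\<close> lies in the kernel but is a combination of basis vectors
      outside \<open>J\<close>; comparing both expansions shows that it vanishes.\<close>
    from fJ(4)[OF this] obtain x' :: "complex^'m" where x': "\<And>j. j \<notin> J \<Longrightarrow> x' $ j = 0" "w = (\<Sum>j\<in>UNIV. x' $ j *s f j)" by blast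
    have uw: "u + w = (\<Sum>j\<in>UNIV. x $ j *s f j)" unfolding u_def w_def
      by (subst sum.union_disjoint[symmetric]) auto
    have "(\<Sum>j\<in>UNIV. (x - x') $ j *s f j) = 0"
      using uw u0 x'(2) by (simp add: vec.scale_left_diff_distrib sum_subtractf)
    then have "x - x' = 0" by (rule fJ(3))
    then have "x $ j = 0" if "j \<notin> J" for j using x'(1)[OF that] by simp
    then have "w = 0" unfolding w_def by simp
    then have "(\<Sum>j\<in>UNIV. x $ j *s f j) = 0" using uw u0 by simp
    then show "x = 0" by (rule fJ(3))
  qed
  have "zorder (\<lambda>\<mu>. det (Delta \<mu>)) \<nu> = int (card J)"
  proof (rule zorder_eqI[of UNIV _ "\<lambda>\<mu>. det (B \<mu>) / det C"])
    have "(\<lambda>\<mu>. det (B \<mu>)) holomorphic_on UNIV"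
      by (rule det_holomorphic) (simp add: B_def b(1))
    then show "(\<lambda>\<mu>. det (B \<mu>) / det C) holomorphic_on UNIV" using detC by (intro holomorphic_intros) auto
    show "det (B \<nu>) / det C \<noteq> 0" using detB detC by simp
    fix \<mu>
    have "det (Delta \<mu>) * det C = det (B \<mu>) * (\<mu> - \<nu>) ^ card J"
      using arg_cong[OF fac[of \<mu>], of det] by (simp add: det_mul detD)
    then show "det (Delta \<mu>) = det (B \<mu>) / det C * (\<mu> - \<nu>) powi int (card J)"
      using detC by (simp add: field_simps)
  qed auto
  then show ?thesis by (simp add: fJ(1))
qed

end

section \<open>Asymptotics of the characteristic matrix\<close>

lemma norm_cos_le_Im: "norm (cos z) \<le> exp \<bar>Im z\<bar>" for z :: complex
proof -
  have "norm (cos z) \<le> (norm (exp (\<i> * z)) + norm (exp (- \<i> * z))) / 2"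
    using norm_triangle_ineq[of "exp (\<i> * z)" "exp (- \<i> * z)"] by (simp add: cos_exp_eq)
  also have "\<dots> = (exp (- Im z) + exp (Im z)) / 2" by (simp add: norm_exp)
  also have "\<dots> \<le> exp \<bar>Im z\<bar>"
  proof -
    have "exp (- Im z) + exp (Im z) \<le> exp \<bar>Im z\<bar> + exp \<bar>Im z\<bar>" by (intro add_mono) auto
    then show ?thesis by simp
  qed
  finally show ?thesis .
qed

lemma norm_sin_le_Im: "norm (sin z) \<le> exp \<bar>Im z\<bar>" for z :: complex
proof -
  have "norm (sin z) \<le> (norm (exp (\<i> * z)) + norm (exp (- \<i> * z))) / 2"
    using norm_triangle_ineq4[of "exp (\<i> * z)" "exp (- \<i> * z)"] by (simp add: sin_exp_eq norm_divide norm_mult)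
  also have "\<dots> = (exp (- Im z) + exp (Im z)) / 2" by (simp add: norm_exp)
  also have "\<dots> \<le> exp \<bar>Im z\<bar>"
  proof -
    have "exp (- Im z) + exp (Im z) \<le> exp \<bar>Im z\<bar> + exp \<bar>Im z\<bar>" by (intro add_mono) auto
    then show ?thesis by simp
  qed
  finally show ?thesis .
qed

lemma norm_cos_real_le: "0 \<le> s \<Longrightarrow> norm (cos (\<rho> * of_real s :: complex)) \<le> exp (\<bar>Im \<rho>\<bar> * s)"
  using norm_cos_le_Im[of "\<rho> * of_real s"] by (simp add: abs_mult)

lemma norm_sin_real_le: "0 \<le> s \<Longrightarrow> norm (sin (\<rho> * of_real s :: complex)) \<le> exp (\<bar>Im \<rho>\<bar> * s)"
  using norm_sin_le_Im[of "\<rho> * of_real s"] by (simp add: abs_mult)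

lemma cos_shift_deriv:
  "((\<lambda>t. cos (\<rho> * of_real (x - t) :: complex)) has_vector_derivative \<rho> * sin (\<rho> * of_real (x - t))) (at t within S)"
proof -
  have "((\<lambda>z. cos (\<rho> * (of_real x - z))) has_field_derivative \<rho> * sin (\<rho> * (of_real x - of_real t))) (at (of_real t))"
    by (auto intro!: derivative_eq_intros)
  from has_vector_derivative_real_field[OF this]
  show ?thesis by (simp add: has_vector_derivative_at_within)
qed

lemma sin_shift_deriv:
  "((\<lambda>t. sin (\<rho> * of_real (x - t) :: complex)) has_vector_derivative - \<rho> * cos (\<rho> * of_real (x - t))) (at t within S)"
proof -
  have "((\<lambda>z. sin (\<rho> * (of_real x - z))) has_field_derivative - \<rho> * cos (\<rho> * (of_real x - of_real t))) (at (of_real t))"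
    by (auto intro!: derivative_eq_intros)
  from has_vector_derivative_real_field[OF this]
  show ?thesis by (simp add: has_vector_derivative_at_within)
qed

lemma ac_cos_shift: "absolutely_continuous_on_interval a b (\<lambda>t. c * cos (\<rho> * of_real (x - t) :: complex))"
  by (rule ac_of_C1[where f'="\<lambda>t. c * (\<rho> * sin (\<rho> * of_real (x - t)))"])
    (intro has_vector_derivative_mult_right cos_shift_deriv continuous_intros)+

lemma ac_sin_shift: "absolutely_continuous_on_interval a b (\<lambda>t. c * sin (\<rho> * of_real (x - t) :: complex))"
  by (rule ac_of_C1[where f'="\<lambda>t. c * (- \<rho> * cos (\<rho> * of_real (x - t)))"])
    (intro has_vector_derivative_mult_right sin_shift_deriv continuous_intros)+

lemma cscale_deriv:
  assumes "(f has_vector_derivative f') (at t)" "(g has_vector_derivative g') (at t)"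
  shows "((\<lambda>t. f t *s (g t :: complex^'n)) has_vector_derivative (f t *s g' + f' *s g t)) (at t)"
  by (rule bounded_bilinear.has_vector_derivative[OF bounded_bilinear_cscale assms])

context sturm_liouville
begin

text \<open>The function \<open>G\<close> is the combination of \<open>v\<close> and
  \<open>y\<close> with coefficients sin(\<rho>(x - t))/\<rho> and cos(\<rho>(x - t)). In its
  derivative the terms in \<open>v\<close> and in \<open>\<mu> y\<close> cancel, only the one with
  \<open>Q\<close> survives, and \<open>G x = y x\<close>.\<close>

lemma variation_of_constants:
  assumes rho: "\<rho> \<noteq> 0" and x: "x \<in> {0..pi}" and mu: "\<mu> = \<rho>\<^sup>2"
  shows "((\<lambda>t. (sin (\<rho> * of_real (x - t)) / \<rho>) *s (Q t *v phi \<mu> c t)) has_integral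
     (phi \<mu> c x - cos (\<rho> * of_real x) *s c - (sin (\<rho> * of_real x) / \<rho>) *s (h *v c))) {0..x}"
proof -
  define y where "y = phi \<mu> c"
  define v where "v = dphi \<mu> c"
  have o: "ode \<mu> y v" unfolding y_def v_def by (rule phi_ode)
  define G where "G t = ((1 / \<rho>) * sin (\<rho> * of_real (x - t))) *s v t + (1 * cos (\<rho> * of_real (x - t))) *s y t" for t
  obtain N where N: "negligible N"
    "\<And>t. t \<in> {0<..<pi} - N \<Longrightarrow> (v has_vector_derivative (Q t *v y t - \<mu> *s y t)) (at t)"
    using ode_null[OF o] by blast
  have ac: "absolutely_continuous_on_interval 0 x G"
    unfolding G_def
    by (intro ac_add bounded_bilinear.ac_bilinear[OF bounded_bilinear_cscale] ac_sin_shift ac_cos_shift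
        ac_subinterval[OF ode_ac1[OF o]] ac_subinterval[OF ode_ac2[OF o]]) (use x in auto)
  have "((\<lambda>t. (sin (\<rho> * of_real (x - t)) / \<rho>) *s (Q t *v y t)) has_integral (G x - G 0)) {0..x}"
  proof (rule ac_fundamental_theorem[OF _ ac N(1)])
    fix t assume t: "t \<in> {0<..<x} - N"
    define s k where "s = sin (\<rho> * of_real (x - t))" and "k = cos (\<rho> * of_real (x - t))"
    have "(G has_vector_derivative
        ((((1 / \<rho>) * s) *s (Q t *v y t - \<mu> *s y t) + ((1 / \<rho>) * (- \<rho> * k)) *s v t) +
         ((1 * k) *s v t + (1 * (\<rho> * s)) *s y t))) (at t)"
      unfolding G_def s_def k_def
      by (intro has_vector_derivative_add cscale_deriv has_vector_derivative_mult_right sin_shift_deriv cos_shift_deriv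
          N(2) ode_deriv_interior[OF o]) (use t x in auto)
    also have "(((1 / \<rho>) * s) *s (Q t *v y t - \<mu> *s y t) + ((1 / \<rho>) * (- \<rho> * k)) *s v t) +
         ((1 * k) *s v t + (1 * (\<rho> * s)) *s y t) = (s / \<rho>) *s (Q t *v y t)"
      using rho by (simp add: vec_eq_iff mu power2_eq_square field_simps)
    finally show "(G has_vector_derivative (sin (\<rho> * of_real (x - t)) / \<rho>) *s (Q t *v y t)) (at t)"
      by (simp add: s_def)
  qed (use x in auto)
  moreover have "G x - G 0 = y x - cos (\<rho> * of_real x) *s c - (sin (\<rho> * of_real x) / \<rho>) *s (h *v c)"
    by (simp add: G_def y_def v_def phi_0 dphi_0)
  ultimately show ?thesis by (simp add: y_def)
qed

text \<open>Same argument with the kernel differentiated in the upper end point. No division by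
  \<rho> occurs, so \<rho> = 0 is included; the free problem at the eigenvalue 0 relies on
  this.\<close>

lemma variation_of_constants_deriv:
  assumes mu: "\<mu> = \<rho>\<^sup>2"
  shows "((\<lambda>t. cos (\<rho> * of_real (pi - t)) *s (Q t *v phi \<mu> c t)) has_integral
     (dphi \<mu> c pi - cos (\<rho> * of_real pi) *s (h *v c) + (\<rho> * sin (\<rho> * of_real pi)) *s c)) {0..pi}"
proof -
  define y where "y = phi \<mu> c"
  define v where "v = dphi \<mu> c"
  have o: "ode \<mu> y v" unfolding y_def v_def by (rule phi_ode)
  define G where "G t = (1 * cos (\<rho> * of_real (pi - t))) *s v t + ((- \<rho>) * sin (\<rho> * of_real (pi - t))) *s y t" for t
  obtain N where N: "negligible N"
    "\<And>t. t \<in> {0<..<pi} - N \<Longrightarrow> (v has_vector_derivative (Q t *v y t - \<mu> *s y t)) (at t)"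
    using ode_null[OF o] by blast
  have ac: "absolutely_continuous_on_interval 0 pi G"
    unfolding G_def
    by (intro ac_add bounded_bilinear.ac_bilinear[OF bounded_bilinear_cscale] ac_sin_shift ac_cos_shift
        ode_ac1[OF o] ode_ac2[OF o])
  have "((\<lambda>t. cos (\<rho> * of_real (pi - t)) *s (Q t *v y t)) has_integral (G pi - G 0)) {0..pi}"
  proof (rule ac_fundamental_theorem[OF _ ac N(1)])
    fix t assume t: "t \<in> {0<..<pi} - N"
    define s k where "s = sin (\<rho> * of_real (pi - t))" and "k = cos (\<rho> * of_real (pi - t))"
    have "(G has_vector_derivative
        (((1 * k) *s (Q t *v y t - \<mu> *s y t) + (1 * (\<rho> * s)) *s v t) +
         (((- \<rho>) * s) *s v t + ((- \<rho>) * (- \<rho> * k)) *s y t))) (at t)"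
      unfolding G_def s_def k_def
      by (intro has_vector_derivative_add cscale_deriv has_vector_derivative_mult_right sin_shift_deriv cos_shift_deriv
          N(2) ode_deriv_interior[OF o]) (use t in auto)
    also have "((1 * k) *s (Q t *v y t - \<mu> *s y t) + (1 * (\<rho> * s)) *s v t) +
         (((- \<rho>) * s) *s v t + ((- \<rho>) * (- \<rho> * k)) *s y t) = k *s (Q t *v y t)"
      by (simp add: vec_eq_iff mu power2_eq_square algebra_simps)
    finally show "(G has_vector_derivative cos (\<rho> * of_real (pi - t)) *s (Q t *v y t)) (at t)"
      by (simp add: k_def)
  qed auto
  moreover have "G pi - G 0 = v pi - cos (\<rho> * of_real pi) *s (h *v c) + (\<rho> * sin (\<rho> * of_real pi)) *s c"
    by (simp add: G_def y_def v_def phi_0 dphi_0 vec_eq_iff)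
  ultimately show ?thesis by (simp add: y_def v_def)
qed

definition Q1 :: real where
  "Q1 = integral {0..pi} (\<lambda>t. entry_sum (Q t))"

lemma Q1_nonneg: "0 \<le> Q1"
  unfolding Q1_def by (rule integral_nonneg[OF Q_sum_int]) (simp add: entry_sum_nonneg)

lemma weighted_Q_integral_le:
  fixes g :: "real \<Rightarrow> complex^'m"
  assumes int: "g integrable_on {0..x}" and x: "x \<in> {0..pi}" and B: "0 \<le> B"
    and le: "\<And>t. t \<in> {0..x} \<Longrightarrow> norm (g t) \<le> B * entry_sum (Q t)"
  shows "norm (integral {0..x} g) \<le> B * Q1"
proof -
  have qx: "(\<lambda>t. entry_sum (Q t)) integrable_on {0..x}"
    by (rule integrable_on_subinterval[OF Q_sum_int]) (use x in auto)
  have "norm (integral {0..x} g) \<le> integral {0..x} (\<lambda>t. B * entry_sum (Q t))"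
    by (rule integral_norm_bound_integral[OF int]) (use le qx in \<open>auto intro: integrable_on_mult_right\<close>)
  also have "\<dots> = B * integral {0..x} (\<lambda>t. entry_sum (Q t))" by simp
  also have "\<dots> \<le> B * Q1" unfolding Q1_def
    by (intro mult_left_mono[OF _ B] integral_subset_le qx Q_sum_int) (use x entry_sum_nonneg in auto)
  finally show ?thesis .
qed

text \<open>The growth of kernel and solution multiplies to exp(\<tau>(x - t)) exp(\<tau>t) =
  exp(\<tau>x), independent of t, so that only the integral of \<open>Q\<close> is left.\<close>

lemma kernel_Q_integral_le:
  assumes int: "(\<lambda>t. k t *s (Q t *v g t)) integrable_on {0..x}" and x: "x \<in> {0..pi}" and AB: "0 \<le> A" "0 \<le> B"
    and k: "\<And>t. t \<in> {0..x} \<Longrightarrow> norm (k t) \<le> A * exp (\<tau> * (x - t))"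
    and g: "\<And>t. t \<in> {0..x} \<Longrightarrow> norm (g t) \<le> B * exp (\<tau> * t)"
  shows "norm (integral {0..x} (\<lambda>t. k t *s (Q t *v g t))) \<le> A * B * exp (\<tau> * x) * Q1"
proof (rule weighted_Q_integral_le[OF int x])
  fix t assume t: "t \<in> {0..x}"
  have "norm (k t *s (Q t *v g t)) \<le> (A * exp (\<tau> * (x - t))) * (entry_sum (Q t) * (B * exp (\<tau> * t)))"
    unfolding norm_cscale
    by (intro mult_mono k t order_trans[OF norm_matvec_le] mult_left_mono g entry_sum_nonneg) (use AB in auto)
  also have "\<dots> = A * B * (exp (\<tau> * (x - t)) * exp (\<tau> * t)) * entry_sum (Q t)" by simp
  also have "exp (\<tau> * (x - t)) * exp (\<tau> * t) = exp (\<tau> * x)" by (simp add: algebra_simps flip: exp_add)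
  finally show "norm (k t *s (Q t *v g t)) \<le> A * B * exp (\<tau> * x) * entry_sum (Q t)" .
qed (use AB in auto)

lemma sin_kernel_le:
  assumes "t \<in> {0..x}"
  shows "norm (sin (\<rho> * of_real (x - t)) / \<rho>) \<le> 1 / norm \<rho> * exp (\<bar>Im \<rho>\<bar> * (x - t))"
  unfolding norm_divide using norm_sin_real_le[of "x - t" \<rho>] assms by (simp add: divide_right_mono)

text \<open>At a maximum of |phi| exp(-\<tau>t) the integral term is at most half of that maximum,
  because |\<rho>| >= 2 \<open>Q1\<close>, and can be absorbed on the left.\<close>

lemma phi_bound:
  assumes rho: "norm \<rho> \<ge> 1" "norm \<rho> \<ge> 2 * Q1" and x: "x \<in> {0..pi}"
  shows "norm (phi (\<rho>\<^sup>2) c x) \<le> 2 * (1 + entry_sum h) * norm c * exp (\<bar>Im \<rho>\<bar> * x)"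
proof -
  define \<tau> where "\<tau> = \<bar>Im \<rho>\<bar>"
  define y where "y = phi (\<rho>\<^sup>2) c"
  define f where "f t = norm (y t) * exp (- \<tau> * t)" for t
  have r0: "\<rho> \<noteq> 0" using rho by auto
  have "continuous_on {0..pi} f" unfolding f_def y_def by (intro continuous_intros phi_cont)
  then obtain z where z: "z \<in> {0..pi}" "\<And>t. t \<in> {0..pi} \<Longrightarrow> f t \<le> f z"
    using continuous_attains_sup[of "{0..pi}" f] by auto
  have yf: "norm (y t) = f t * exp (\<tau> * t)" for t by (simp add: f_def flip: exp_add)
  have f0: "f z \<ge> 0" by (simp add: f_def)
  note V = variation_of_constants[OF r0 z(1) refl, of c, folded y_def]
  have "norm (integral {0..z} (\<lambda>t. (sin (\<rho> * of_real (z - t)) / \<rho>) *s (Q t *v y t))) \<le>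
      1 / norm \<rho> * f z * exp (\<tau> * z) * Q1"
  proof (rule kernel_Q_integral_le)
    show "norm (sin (\<rho> * of_real (z - t)) / \<rho>) \<le> 1 / norm \<rho> * exp (\<tau> * (z - t))" if "t \<in> {0..z}" for t
      unfolding \<tau>_def by (rule sin_kernel_le[OF that])
    show "norm (y t) \<le> f z * exp (\<tau> * t)" if "t \<in> {0..z}" for t
      unfolding yf using z that by (intro mult_right_mono) auto
  qed (use V z f0 in auto)
  also have "\<dots> = f z * exp (\<tau> * z) * (Q1 / norm \<rho>)" by simp
  also have "\<dots> \<le> f z * exp (\<tau> * z) * (1 / 2)"
  proof (rule mult_left_mono)
    have "norm \<rho> > 0" using r0 by simp
    then show "Q1 / norm \<rho> \<le> 1 / 2" using rho(2) by (simp add: field_simps)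
  qed (use f0 in auto)
  finally have 1: "norm (y z - cos (\<rho> * of_real z) *s c - (sin (\<rho> * of_real z) / \<rho>) *s (h *v c)) \<le> f z * exp (\<tau> * z) / 2"
    unfolding integral_unique[OF V] by simp
  have 2: "norm (cos (\<rho> * of_real z) *s c) \<le> exp (\<tau> * z) * norm c"
    unfolding norm_cscale \<tau>_def by (intro mult_right_mono norm_cos_real_le) (use z in auto)
  have 3: "norm ((sin (\<rho> * of_real z) / \<rho>) *s (h *v c)) \<le> exp (\<tau> * z) * (entry_sum h * norm c)"
    unfolding norm_cscale
  proof (rule mult_mono[OF _ norm_matvec_le])
    have "norm (sin (\<rho> * of_real z)) / norm \<rho> \<le> norm (sin (\<rho> * of_real z)) / 1"
      using rho by (intro divide_left_mono) auto
    then show "norm (sin (\<rho> * of_real z) / \<rho>) \<le> exp (\<tau> * z)"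
      using norm_sin_real_le[of z \<rho>] z by (simp add: norm_divide \<tau>_def)
  qed auto
  have "norm (y z) \<le> norm (y z - cos (\<rho> * of_real z) *s c - (sin (\<rho> * of_real z) / \<rho>) *s (h *v c)) +
     norm (cos (\<rho> * of_real z) *s c) + norm ((sin (\<rho> * of_real z) / \<rho>) *s (h *v c))"
    using norm_triangle_ineq[of "y z - cos (\<rho> * of_real z) *s c - (sin (\<rho> * of_real z) / \<rho>) *s (h *v c)" "cos (\<rho> * of_real z) *s c + (sin (\<rho> * of_real z) / \<rho>) *s (h *v c)"]
      norm_triangle_ineq[of "cos (\<rho> * of_real z) *s c" "(sin (\<rho> * of_real z) / \<rho>) *s (h *v c)"] by simp
  then have "f z * exp (\<tau> * z) \<le> (f z / 2 + norm c * (1 + entry_sum h)) * exp (\<tau> * z)"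
    using 1 2 3 unfolding yf by (simp add: algebra_simps)
  then have "f z \<le> 2 * (norm c * (1 + entry_sum h))" by simp
  then have "f x \<le> 2 * (norm c * (1 + entry_sum h))" using z(2)[OF x] by linarith
  then have "f x * exp (\<tau> * x) \<le> 2 * (norm c * (1 + entry_sum h)) * exp (\<tau> * x)" by (intro mult_right_mono) auto
  then show ?thesis unfolding yf[symmetric] by (simp add: y_def \<tau>_def mult_ac)
qed

text \<open>Reinserting \<open>phi_bound\<close> into variation of constants gains the factor
  1/|\<rho>| of the kernel.\<close>

lemma phi_minus_cos_bound:
  assumes rho: "norm \<rho> \<ge> 1" "norm \<rho> \<ge> 2 * Q1" and x: "x \<in> {0..pi}"
  shows "norm (phi (\<rho>\<^sup>2) c x - cos (\<rho> * of_real x) *s c) \<le>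
     (entry_sum h + 2 * (1 + entry_sum h) * Q1) * norm c * exp (\<bar>Im \<rho>\<bar> * x) / norm \<rho>"
proof -
  define \<tau> where "\<tau> = \<bar>Im \<rho>\<bar>"
  define y where "y = phi (\<rho>\<^sup>2) c"
  define K where "K = 2 * (1 + entry_sum h) * norm c"
  have K: "K \<ge> 0" unfolding K_def using entry_sum_nonneg[of h] by simp
  have r0: "\<rho> \<noteq> 0" using rho by auto
  note V = variation_of_constants[OF r0 x refl, of c, folded y_def]
  have "norm (integral {0..x} (\<lambda>t. (sin (\<rho> * of_real (x - t)) / \<rho>) *s (Q t *v y t))) \<le>
      1 / norm \<rho> * K * exp (\<tau> * x) * Q1"
  proof (rule kernel_Q_integral_le)
    show "norm (sin (\<rho> * of_real (x - t)) / \<rho>) \<le> 1 / norm \<rho> * exp (\<tau> * (x - t))" if "t \<in> {0..x}" for t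
      unfolding \<tau>_def by (rule sin_kernel_le[OF that])
    show "norm (y t) \<le> K * exp (\<tau> * t)" if "t \<in> {0..x}" for t
      unfolding y_def K_def \<tau>_def using phi_bound[OF rho, of t c] x that by simp
  qed (use V x K in auto)
  then have 1: "norm (y x - cos (\<rho> * of_real x) *s c - (sin (\<rho> * of_real x) / \<rho>) *s (h *v c)) \<le> 1 / norm \<rho> * K * exp (\<tau> * x) * Q1"
    unfolding integral_unique[OF V] .
  have 3: "norm ((sin (\<rho> * of_real x) / \<rho>) *s (h *v c)) \<le> exp (\<tau> * x) / norm \<rho> * (entry_sum h * norm c)"
    unfolding norm_cscale norm_divide \<tau>_def
    by (intro mult_mono norm_matvec_le divide_right_mono norm_sin_real_le) (use x in auto)
  have "norm (y x - cos (\<rho> * of_real x) *s c) \<le> 1 / norm \<rho> * K * exp (\<tau> * x) * Q1 + exp (\<tau> * x) / norm \<rho> * (entry_sum h * norm c)"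
    using 1 3 norm_triangle_sub[of "y x - cos (\<rho> * of_real x) *s c" "(sin (\<rho> * of_real x) / \<rho>) *s (h *v c)"] by linarith
  also have "\<dots> = (entry_sum h + 2 * (1 + entry_sum h) * Q1) * norm c * exp (\<tau> * x) / norm \<rho>"
    using r0 by (simp add: K_def field_simps)
  finally show ?thesis by (simp add: y_def \<tau>_def)
qed

end

section \<open>Bessel's inequality and cosine integrals of \<open>Q\<close>\<close>

lemma cos_cos_integral:
  assumes "m \<ge> 1" "n \<ge> 1"
  shows "((\<lambda>t. cos (2 * real m * t) * cos (2 * real n * t)) has_integral (if m = n then pi / 2 else 0)) {0..pi}"
proof -
  have E: "((\<lambda>t. cos (2 * of_int k * t)) has_integral (if k = 0 then pi else 0)) {0..pi}" for k :: int
  proof (cases "k = 0")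
    case True
    then show ?thesis using has_integral_const_real[of "1::real" 0 pi] by simp
  next
    case False
    have "((\<lambda>t. cos (2 * of_int k * t)) has_integral
        (sin (2 * of_int k * pi) / (2 * of_int k) - sin (2 * of_int k * 0) / (2 * of_int k))) {0..pi}"
      by (rule fundamental_theorem_of_calculus)
        (use False in \<open>auto intro!: derivative_eq_intros simp flip: has_real_derivative_iff_has_vector_derivative\<close>)
    moreover have "sin (2 * of_int k * pi) = 0"
      using sin_zero_iff_int2 by (metis mult.commute mult.left_commute of_int_mult of_int_numeral)
    ultimately show ?thesis using False by simp
  qed
  have "((\<lambda>t. (cos (2 * of_int (int m - int n) * t) + cos (2 * of_int (int m + int n) * t)) / 2) has_integral
     ((if int m - int n = 0 then pi else 0) + (if int m + int n = 0 then pi else 0)) / 2) {0..pi}"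
    by (rule has_integral_divide[OF has_integral_add[OF E E]])
  moreover have "(cos (2 * of_int (int m - int n) * t) + cos (2 * of_int (int m + int n) * t)) / 2 =
      cos (2 * real m * t) * cos (2 * real n * t)" for t
    by (simp add: cos_times_cos algebra_simps)
  ultimately show ?thesis using assms by (simp split: if_splits)
qed

text \<open>Orthogonality of cos 2nt for n >= 1, each with squared norm \<pi>/2. The index 0 has
  norm \<pi> and is left out by the shift to \<open>Suc n\<close>; a single term does not affect
  summability.\<close>

lemma bessel_cos_real:
  fixes f :: "real \<Rightarrow> real"
  assumes f: "f absolutely_integrable_on {0..pi}" and f2: "(\<lambda>t. (f t)\<^sup>2) integrable_on {0..pi}"
  shows "summable (\<lambda>n. (integral {0..pi} (\<lambda>t. cos (2 * real n * t) * f t))\<^sup>2)"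
proof -
  define a where "a n = integral {0..pi} (\<lambda>t. cos (2 * real n * t) * f t)" for n
  have cf: "(\<lambda>t. cos (2 * real n * t) * f t) integrable_on {0..pi}" for n
  proof -
    have c: "continuous_on {0..pi} (\<lambda>t. cos (2 * real n * t))" by (intro continuous_intros)
    have "(\<lambda>t. cos (2 * real n * t) * f t) absolutely_integrable_on {0..pi}"
    proof (rule absolutely_integrable_bounded_measurable_product[where h="(*)"])
      show "(\<lambda>t. cos (2 * real n * t)) \<in> borel_measurable (lebesgue_on {0..pi})"
        using c by (intro continuous_imp_measurable_on_sets_lebesgue) auto
      show "bounded ((\<lambda>t. cos (2 * real n * t)) ` {0..pi})"
        by (intro compact_imp_bounded compact_continuous_image c) auto
    qed (use f in \<open>auto intro: bounded_bilinear_mult simp: bilinear_conv_bounded_bilinear\<close>)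
    then show ?thesis by (rule set_lebesgue_integral_eq_integral(1))
  qed
  have part: "(\<Sum>n<N. (a (Suc n))\<^sup>2) \<le> pi / 2 * integral {0..pi} (\<lambda>t. (f t)\<^sup>2)" for N
  proof -
    define g where "g t = (\<Sum>n<N. a (Suc n) * cos (2 * real (Suc n) * t))" for t
    define S where "S = (\<Sum>n<N. (a (Suc n))\<^sup>2)"
    have fg: "((\<lambda>t. f t * g t) has_integral S) {0..pi}"
    proof -
      have "((\<lambda>t. \<Sum>n<N. a (Suc n) * (cos (2 * real (Suc n) * t) * f t)) has_integral (\<Sum>n<N. a (Suc n) * a (Suc n))) {0..pi}"
        unfolding a_def by (intro has_integral_sum has_integral_mult_right integrable_integral cf) auto
      then show ?thesis by (simp add: g_def S_def power2_eq_square sum_distrib_left mult_ac)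
    qed
    have gg: "((\<lambda>t. (g t)\<^sup>2) has_integral pi / 2 * S) {0..pi}"
    proof -
      have "((\<lambda>t. \<Sum>m<N. \<Sum>n<N. (a (Suc m) * a (Suc n)) * (cos (2 * real (Suc m) * t) * cos (2 * real (Suc n) * t)))
        has_integral (\<Sum>m<N. \<Sum>n<N. (a (Suc m) * a (Suc n)) * (if Suc m = Suc n then pi / 2 else 0))) {0..pi}"
        by (intro has_integral_sum has_integral_mult_right cos_cos_integral) auto
      moreover have "(\<Sum>m<N. \<Sum>n<N. (a (Suc m) * a (Suc n)) * (cos (2 * real (Suc m) * t) * cos (2 * real (Suc n) * t))) = (g t)\<^sup>2" for t
        unfolding g_def power2_eq_square sum_product by (intro sum.cong refl) (simp add: mult_ac)
      moreover have "(\<Sum>m<N. \<Sum>n<N. (a (Suc m) * a (Suc n)) * (if Suc m = Suc n then pi / 2 else 0)) = pi / 2 * S"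
        by (simp add: S_def sum_distrib_left power2_eq_square if_distrib mult_ac cong: if_cong)
      ultimately show ?thesis by (simp only:)
    qed
    \<comment> \<open>This is the square of \<open>f - 2 / pi * g\<close>, where 2/\<pi> is the
      reciprocal of the squared norm of the cosines.\<close>
    have "((\<lambda>t. (f t)\<^sup>2 - (4 / pi) * (f t * g t) + (4 / pi\<^sup>2) * (g t)\<^sup>2) has_integral
       (integral {0..pi} (\<lambda>t. (f t)\<^sup>2) - (4 / pi) * S + (4 / pi\<^sup>2) * (pi / 2 * S))) {0..pi}"
      by (intro has_integral_add has_integral_diff has_integral_mult_right integrable_integral f2 fg gg)
    moreover have "0 \<le> (f t)\<^sup>2 - (4 / pi) * (f t * g t) + (4 / pi\<^sup>2) * (g t)\<^sup>2" for t
    proof -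
      have "0 \<le> (f t - 2 / pi * g t)\<^sup>2" by simp
      then show ?thesis by (simp add: power2_eq_square algebra_simps)
    qed
    ultimately have "0 \<le> integral {0..pi} (\<lambda>t. (f t)\<^sup>2) - (4 / pi) * S + (4 / pi\<^sup>2) * (pi / 2 * S)"
      by (meson has_integral_nonneg)
    also have "\<dots> = integral {0..pi} (\<lambda>t. (f t)\<^sup>2) - 2 / pi * S" by (simp add: power2_eq_square field_simps)
    finally show ?thesis using pi_gt_zero by (simp add: S_def field_simps)
  qed
  have "summable (\<lambda>n. (a (Suc n))\<^sup>2)"
  proof (rule bounded_imp_summable)
    show "(\<Sum>k\<le>n. (a (Suc k))\<^sup>2) \<le> pi / 2 * integral {0..pi} (\<lambda>t. (f t)\<^sup>2)" for n
      using part[of "Suc n"] unfolding lessThan_Suc_atMost .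
  qed simp
  then show ?thesis unfolding a_def by (subst (asm) summable_Suc_iff)
qed

lemma bessel_cos:
  fixes f :: "real \<Rightarrow> complex"
  assumes f: "f absolutely_integrable_on {0..pi}" and f2: "(\<lambda>t. (norm (f t))\<^sup>2) integrable_on {0..pi}"
  shows "summable (\<lambda>n. (norm (integral {0..pi} (\<lambda>t. cos (of_real (2 * real n * t)) * f t)))\<^sup>2)"
proof -
  have re: "(\<lambda>t. Re (f t)) absolutely_integrable_on {0..pi}" and im: "(\<lambda>t. Im (f t)) absolutely_integrable_on {0..pi}"
    using absolutely_integrable_linear[OF f bounded_linear_Re] absolutely_integrable_linear[OF f bounded_linear_Im]
    by (auto simp: o_def)
  have sq: "(\<lambda>t. (g t)\<^sup>2) integrable_on {0..pi}" if g: "g absolutely_integrable_on {0..pi}" "\<And>t. \<bar>g t\<bar> \<le> norm (f t)" for g :: "real \<Rightarrow> real"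
  proof (rule measurable_bounded_by_integrable_imp_integrable[OF _ f2])
    show "(\<lambda>t. (g t)\<^sup>2) \<in> borel_measurable (lebesgue_on {0..pi})"
      by (intro borel_measurable_power absolutely_integrable_measurable[THEN iffD1, THEN conjunct1] g) auto
    show "norm ((g t)\<^sup>2) \<le> (norm (f t))\<^sup>2" for t using power_mono[OF g(2)[of t], of 2] by simp
  qed auto
  have cf: "(\<lambda>t. cos (of_real (2 * real n * t)) * f t) integrable_on {0..pi}" for n
  proof -
    have c: "continuous_on {0..pi} (\<lambda>t. cos (of_real (2 * real n * t)) :: complex)" by (intro continuous_intros)
    have "(\<lambda>t. cos (of_real (2 * real n * t)) * f t) absolutely_integrable_on {0..pi}"
    proof (rule absolutely_integrable_bounded_measurable_product[where h="(*)"])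
      show "(\<lambda>t. cos (of_real (2 * real n * t)) :: complex) \<in> borel_measurable (lebesgue_on {0..pi})"
        using c by (intro continuous_imp_measurable_on_sets_lebesgue) auto
      show "bounded ((\<lambda>t. cos (of_real (2 * real n * t)) :: complex) ` {0..pi})"
        by (intro compact_imp_bounded compact_continuous_image c) auto
    qed (use f in \<open>auto intro: bounded_bilinear_mult simp: bilinear_conv_bounded_bilinear\<close>)
    then show ?thesis by (rule set_lebesgue_integral_eq_integral(1))
  qed
  have "(norm (integral {0..pi} (\<lambda>t. cos (of_real (2 * real n * t)) * f t)))\<^sup>2 =
     (integral {0..pi} (\<lambda>t. cos (2 * real n * t) * Re (f t)))\<^sup>2 + (integral {0..pi} (\<lambda>t. cos (2 * real n * t) * Im (f t)))\<^sup>2" for n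
  proof -
    have cs: "(cos (of_real s) :: complex) = of_real (cos s)" for s by (simp add: cos_of_real)
    have "Re (integral {0..pi} (\<lambda>t. cos (of_real (2 * real n * t)) * f t)) = integral {0..pi} (\<lambda>t. cos (2 * real n * t) * Re (f t))"
      "Im (integral {0..pi} (\<lambda>t. cos (of_real (2 * real n * t)) * f t)) = integral {0..pi} (\<lambda>t. cos (2 * real n * t) * Im (f t))"
      using integral_linear[OF cf[of n] bounded_linear_Re] integral_linear[OF cf[of n] bounded_linear_Im]
      unfolding o_def cs by (simp_all del: of_real_mult)
    then show ?thesis by (simp add: cmod_power2)
  qed
  moreover have "summable (\<lambda>n. (integral {0..pi} (\<lambda>t. cos (2 * real n * t) * Re (f t)))\<^sup>2 + (integral {0..pi} (\<lambda>t. cos (2 * real n * t) * Im (f t)))\<^sup>2)"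
    by (intro summable_add bessel_cos_real re im sq) (auto simp: abs_Re_le_cmod abs_Im_le_cmod)
  ultimately show ?thesis by simp
qed

text \<open>Mean value estimate on the convex strip |Im u| <= b, where the sine is bounded by exp
  b.\<close>

lemma cos_diff_le:
  assumes "\<bar>Im z\<bar> \<le> b" "\<bar>Im w\<bar> \<le> b"
  shows "norm (cos z - cos w :: complex) \<le> exp b * norm (z - w)"
proof -
  let ?S = "{u :: complex. \<bar>Im u\<bar> \<le> b}"
  have "?S = {u. Im u \<le> b} \<inter> {u. Im u \<ge> - b}" by auto
  then have conv: "convex ?S" using convex_halfspace_Im_le[of b] convex_halfspace_Im_ge[of "- b"] by (simp add: convex_Int)
  show ?thesis
  proof (rule field_differentiable_bound[OF conv, of cos "\<lambda>u. - sin u"])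
    show "(cos has_field_derivative - sin u) (at u within ?S)" for u :: complex
      by (auto intro!: derivative_eq_intros)
    show "norm (- sin u) \<le> exp b" if "u \<in> ?S" for u
      using norm_sin_le_Im[of u] that by (simp add: order_trans)
  qed (use assms in auto)
qed

lemma entry_le_entry_sum: "norm (M $ i $ j) \<le> entry_sum M"
proof -
  have "norm (M $ i $ j) \<le> (\<Sum>j\<in>UNIV. norm (M $ i $ j))" by (rule member_le_sum) auto
  also have "\<dots> \<le> entry_sum M" unfolding entry_sum_def by (rule member_le_sum) (auto intro: sum_nonneg)
  finally show ?thesis .
qed

context sturm_liouville
begin

text \<open>The oscillating half of the product 2 cos(\<rho>(\<pi> - t)) cos(\<rho>t) =
  cos(\<rho>(\<pi> - 2t)) + cos \<rho>\<pi>; the constant half goes into \<open>Om\<close>.\<close>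

definition Four :: "complex \<Rightarrow> 'm \<Rightarrow> 'm \<Rightarrow> complex" where
  "Four \<rho> i j = integral {0..pi} (\<lambda>t. cos (\<rho> * of_real (pi - 2 * t)) * Q t $ i $ j)"

definition cos_coeff :: "nat \<Rightarrow> 'm \<Rightarrow> 'm \<Rightarrow> complex" where
  "cos_coeff n i j = integral {0..pi} (\<lambda>t. cos (of_real (2 * real n * t)) * Q t $ i $ j)"

text \<open>The matrix \<omega> entry by entry, with scalar gauge integrals in place of the Lebesgue
  integral of a matrix function in \<open>class_A\<close>; \<open>class_A_Om\<close> identifies the
  two.\<close>

definition Om :: "'m \<Rightarrow> 'm \<Rightarrow> complex" where
  "Om i j = h $ i $ j + H $ i $ j + 1 / 2 * integral {0..pi} (\<lambda>t. Q t $ i $ j)"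

lemma cos_Q_int:
  fixes k :: "real \<Rightarrow> complex"
  assumes "continuous_on {0..pi} k"
  shows "(\<lambda>t. k t * Q t $ i $ j) integrable_on {0..pi}"
proof -
  have "(\<lambda>t. k t * Q t $ i $ j) absolutely_integrable_on {0..pi}"
  proof (rule absolutely_integrable_bounded_measurable_product[where h="(*)"])
    show "k \<in> borel_measurable (lebesgue_on {0..pi})"
      using assms by (intro continuous_imp_measurable_on_sets_lebesgue) auto
    show "bounded (k ` {0..pi})"
      by (intro compact_imp_bounded compact_continuous_image assms) auto
  qed (use Q_abs_int in \<open>auto intro: bounded_bilinear_mult simp: bilinear_conv_bounded_bilinear\<close>)
  then show ?thesis by (rule set_lebesgue_integral_eq_integral(1))
qed

lemma Q_entry_integral_le:
  fixes k :: "real \<Rightarrow> complex"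
  assumes k: "continuous_on {0..pi} k" and B: "\<And>t. t \<in> {0..pi} \<Longrightarrow> norm (k t) \<le> B" "0 \<le> B"
  shows "norm (integral {0..pi} (\<lambda>t. k t * Q t $ i $ j)) \<le> B * Q1"
proof -
  have "norm (integral {0..pi} (\<lambda>t. k t * Q t $ i $ j)) \<le> integral {0..pi} (\<lambda>t. B * entry_sum (Q t))"
    by (rule integral_norm_bound_integral[OF cos_Q_int[OF k]])
      (use B in \<open>auto intro: integrable_on_mult_right Q_sum_int simp: norm_mult intro!: mult_mono entry_le_entry_sum\<close>)
  then show ?thesis by (simp add: Q1_def)
qed

lemma Four_bound: "norm (Four \<rho> i j) \<le> exp (\<bar>Im \<rho>\<bar> * pi) * Q1"
  unfolding Four_def
proof (rule Q_entry_integral_le)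
  fix t assume t: "t \<in> {0..pi}"
  have "norm (cos (\<rho> * of_real (pi - 2 * t))) \<le> exp \<bar>Im (\<rho> * of_real (pi - 2 * t))\<bar>" by (rule norm_cos_le_Im)
  also have "\<dots> = exp (\<bar>Im \<rho>\<bar> * \<bar>pi - 2 * t\<bar>)" by (simp add: abs_mult)
  also have "\<dots> \<le> exp (\<bar>Im \<rho>\<bar> * pi)" using t by (auto intro!: mult_left_mono)
  finally show "norm (cos (\<rho> * of_real (pi - 2 * t))) \<le> exp (\<bar>Im \<rho>\<bar> * pi)" .
qed (auto intro!: continuous_intros)

text \<open>At \<rho> = n the kernel is cos n(\<pi> - 2t) = (-1)^n cos 2nt, so \<open>Four\<close>
  is a cosine coefficient up to sign; leaving the integer costs a Lipschitz term on the strip |Im|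
  <= \<pi>.\<close>

lemma Four_near_integer:
  assumes "norm (\<rho> - of_nat n) \<le> 1"
  shows "norm (Four \<rho> i j) \<le> norm (cos_coeff n i j)
     + exp pi * pi * Q1 * norm (\<rho> - of_nat n)"
proof -
  have Im: "\<bar>Im \<rho>\<bar> \<le> 1" using abs_Im_le_cmod[of "\<rho> - of_nat n"] assms by simp
  have c: "cos (of_nat n * of_real (pi - 2 * t) :: complex) = (-1) ^ n * cos (of_real (2 * real n * t))" for t
  proof -
    have "cos (real n * (pi - 2 * t)) = (-1) ^ n * cos (2 * real n * t)"
      by (simp add: right_diff_distrib cos_diff mult_ac)
    then show ?thesis by (metis cos_of_real of_real_mult of_real_of_nat_eq of_real_power of_real_minus of_real_1)
  qed
  have eq: "Four \<rho> i j = (-1) ^ n * cos_coeff n i j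
     + integral {0..pi} (\<lambda>t. (cos (\<rho> * of_real (pi - 2 * t)) - cos (of_nat n * of_real (pi - 2 * t))) * Q t $ i $ j)"
  proof -
    have "Four \<rho> i j = integral {0..pi} (\<lambda>t. cos (of_nat n * of_real (pi - 2 * t)) * Q t $ i $ j +
       (cos (\<rho> * of_real (pi - 2 * t)) - cos (of_nat n * of_real (pi - 2 * t))) * Q t $ i $ j)"
      unfolding Four_def by (simp add: algebra_simps)
    also have "\<dots> = integral {0..pi} (\<lambda>t. cos (of_nat n * of_real (pi - 2 * t)) * Q t $ i $ j) +
       integral {0..pi} (\<lambda>t. (cos (\<rho> * of_real (pi - 2 * t)) - cos (of_nat n * of_real (pi - 2 * t))) * Q t $ i $ j)"
      by (intro integral_add cos_Q_int continuous_intros)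
    also have "integral {0..pi} (\<lambda>t. cos (of_nat n * of_real (pi - 2 * t)) * Q t $ i $ j) =
       (-1) ^ n * cos_coeff n i j"
      unfolding c mult.assoc cos_coeff_def by (rule integral_mult_right)
    finally show ?thesis .
  qed
  have "norm (integral {0..pi} (\<lambda>t. (cos (\<rho> * of_real (pi - 2 * t)) - cos (of_nat n * of_real (pi - 2 * t))) * Q t $ i $ j))
    \<le> (exp pi * (norm (\<rho> - of_nat n) * pi)) * Q1"
  proof (rule Q_entry_integral_le)
    fix t assume t: "t \<in> {0..pi}"
    have "norm (cos (\<rho> * of_real (pi - 2 * t)) - cos (of_nat n * of_real (pi - 2 * t))) \<le>
       exp pi * norm (\<rho> * of_real (pi - 2 * t) - of_nat n * of_real (pi - 2 * t))"
    proof (rule cos_diff_le)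
      have "\<bar>Im \<rho>\<bar> * \<bar>pi - 2 * t\<bar> \<le> 1 * pi" using Im t by (intro mult_mono) auto
      then show "\<bar>Im (\<rho> * of_real (pi - 2 * t))\<bar> \<le> pi" by (simp add: abs_mult)
    qed auto
    also have "\<rho> * of_real (pi - 2 * t) - of_nat n * of_real (pi - 2 * t) = (\<rho> - of_nat n) * of_real (pi - 2 * t)"
      by (simp add: left_diff_distrib)
    also have "norm \<dots> = norm (\<rho> - of_nat n) * \<bar>pi - 2 * t\<bar>" by (simp only: norm_mult norm_of_real)
    also have "exp pi * (norm (\<rho> - of_nat n) * \<bar>pi - 2 * t\<bar>) \<le> exp pi * (norm (\<rho> - of_nat n) * pi)"
      using t by (intro mult_left_mono) auto
    finally show "norm (cos (\<rho> * of_real (pi - 2 * t)) - cos (of_nat n * of_real (pi - 2 * t))) \<le> exp pi * (norm (\<rho> - of_nat n) * pi)" .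
  qed (auto intro!: continuous_intros)
  moreover have "norm (Four \<rho> i j) \<le> norm (cos_coeff n i j)
    + norm (integral {0..pi} (\<lambda>t. (cos (\<rho> * of_real (pi - 2 * t)) - cos (of_nat n * of_real (pi - 2 * t))) * Q t $ i $ j))"
    unfolding eq using norm_triangle_ineq by (metis (no_types, lifting) mult_1 norm_mult norm_neg_numeral norm_power norm_one norm_minus_cancel power_one)
  ultimately show ?thesis by (simp add: mult_ac)
qed

lemma cos_coeff_l2: "summable (\<lambda>n. (norm (cos_coeff n i j))\<^sup>2)"
  unfolding cos_coeff_def by (rule bessel_cos[OF Q_abs_int Q_sq_int])

end

section \<open>Determinants near diagonal matrices and Rouche's theorem on discs\<close>

lemma norm_matrix_le_entry_sum: "norm (M :: complex^'n^'n) \<le> entry_sum M"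
proof -
  have "norm M \<le> (\<Sum>i\<in>UNIV. norm (M $ i))" unfolding norm_vec_def[of M] by (rule L2_set_le_sum) auto
  also have "\<dots> \<le> entry_sum M" unfolding entry_sum_def by (intro sum_mono norm_cvec_le_sum)
  finally show ?thesis .
qed

lemma det_continuous: "continuous (at A) (det :: complex^'n^'n \<Rightarrow> complex)"
  unfolding det_def[abs_def] by (intro continuous_intros)

text \<open>Dividing row i by \<open>d i\<close> gives a matrix close to the identity, whose
  determinant is close to 1 by continuity. The constant depends on the size alone, the error in a
  row is measured against that row's own diagonal entry, and the conclusion is the hypothesis of
  Rouche's theorem.\<close>

lemma det_near_diagonal:
  obtains \<eta> :: real where "\<eta> > 0"
    "\<And>(d :: 'n \<Rightarrow> complex) (A :: complex^'n^'n).
       (\<And>i. d i \<noteq> 0) \<Longrightarrow> (\<And>i j. norm (A $ i $ j - (if i = j then d i else 0)) \<le> \<eta> * norm (d i)) \<Longrightarrow>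
       norm (det A - (\<Prod>i\<in>UNIV. d i)) < norm (\<Prod>i\<in>UNIV. d i)"
proof -
  obtain \<delta> where d: "\<delta> > 0" and \<delta>: "\<And>X :: complex^'n^'n. dist X (mat 1) < \<delta> \<Longrightarrow> dist (det X) (det (mat 1 :: complex^'n^'n)) < 1"
    using det_continuous[of "mat 1 :: complex^'n^'n"] unfolding continuous_at_eps_delta by (metis zero_less_one)
  \<comment> \<open>The sum over all entries of the scaled matrix then stays below
    \<open>\<delta> / 2\<close>.\<close>
  define \<eta> where "\<eta> = \<delta> / (2 * (real CARD('n))\<^sup>2)"
  have eta: "\<eta> > 0" using d by (simp add: \<eta>_def)
  show thesis
  proof (rule that[OF eta])
    fix d :: "'n \<Rightarrow> complex" and A :: "complex^'n^'n"
    assume d0: "\<And>i. d i \<noteq> 0" and A: "\<And>i j. norm (A $ i $ j - (if i = j then d i else 0)) \<le> \<eta> * norm (d i)"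
    define X :: "complex^'n^'n" where "X = (\<chi> i j. A $ i $ j / d i)"
    define E :: "complex^'n^'n" where "E = (\<chi> i j. if i = j then d i else 0)"
    have "(E ** X) $ i $ j = d i * (A $ i $ j / d i)" for i j
      by (simp add: matrix_matrix_mult_def E_def X_def if_distrib[of "\<lambda>x. x * _"] cong: if_cong del: times_divide_eq_right)
    then have "A = E ** X" using d0 by (simp add: vec_eq_iff)
    then have detA: "det A = (\<Prod>i\<in>UNIV. d i) * det X"
      by (simp add: det_mul) (simp add: E_def det_diagonal)
    have "norm (X - mat 1) \<le> entry_sum (X - mat 1)" by (rule norm_matrix_le_entry_sum)
    also have "\<dots> \<le> (\<Sum>i\<in>(UNIV::'n set). \<Sum>j\<in>(UNIV::'n set). \<eta>)"
      unfolding entry_sum_def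
    proof (intro sum_mono)
      fix i j :: 'n
      have e: "(X - mat 1) $ i $ j = (A $ i $ j - (if i = j then d i else 0)) / d i"
        using d0[of i] by (cases "i = j") (simp_all add: X_def mat_def diff_divide_distrib)
      show "norm ((X - mat 1) $ i $ j) \<le> \<eta>"
        unfolding e norm_divide using A[of i j] d0[of i] by (simp add: pos_divide_le_eq)
    qed
    also have "\<dots> = \<delta> / 2" by (simp add: \<eta>_def power2_eq_square)
    also have "\<dots> < \<delta>" using d by simp
    finally have "norm (det X - 1) < 1" using \<delta>[of X] by (simp add: dist_norm)
    moreover have "norm (det A - (\<Prod>i\<in>UNIV. d i)) = norm (\<Prod>i\<in>UNIV. d i) * norm (det X - 1)"
      unfolding detA by (simp add: algebra_simps flip: norm_mult)
    moreover have "norm (\<Prod>i\<in>UNIV. d i) > 0" using d0 by simp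
    ultimately show "norm (det A - (\<Prod>i\<in>UNIV. d i)) < norm (\<Prod>i\<in>UNIV. d i)" by simp
  qed
qed

lemma entire_finite_zeros:
  assumes "f holomorphic_on UNIV" "f w \<noteq> (0 :: complex)"
  shows "finite {z \<in> cball a r. f z = 0}"
proof (cases "f constant_on UNIV")
  case True
  then have "{z \<in> cball a r. f z = 0} = {}" using assms(2) unfolding constant_on_def by auto
  then show ?thesis by (metis finite.emptyI)
next
  case False
  then show ?thesis
    using holomorphic_compact_finite_zeros[of f UNIV "cball a r"] assms(1) by auto
qed

text \<open>The strict inequality excludes zeros on the circle. Zeros in the larger disc of radius
  \<open>r + 1\<close> thus have winding number 1 or 0, and the weighted sums of Rouche's theorem
  become counts over the open ball.\<close>

lemma rouche_ball:
  assumes f: "f holomorphic_on UNIV" and g: "g holomorphic_on UNIV" and r: "r > 0"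
    and less: "\<And>z. norm (z - a) = r \<Longrightarrow> norm (g z - f z) < norm (f z)"
  shows "(\<Sum>p | p \<in> ball a r \<and> g p = 0. zorder g p) = (\<Sum>p | p \<in> ball a r \<and> f p = 0. zorder f p)"
proof -
  define w where "w = a + of_real r"
  have w: "norm (w - a) = r" using r by (simp add: w_def)
  have fw: "f w \<noteq> 0" using less[OF w] by auto
  have gw: "g w \<noteq> 0" using less[OF w] by (auto simp: norm_minus_commute)
  have nz: "f z \<noteq> 0" "g z \<noteq> 0" if "norm (z - a) = r" for z
    using less[OF that] by (auto simp: norm_minus_commute)
  let ?s = "ball a (r + 1)"
  have eq: "(\<Sum>p\<in>{p\<in>?s. F p = 0}. winding_number (circlepath a r) p * zorder F p) =
      of_int (\<Sum>p | p \<in> ball a r \<and> F p = 0. zorder F p)"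
    if F: "F holomorphic_on UNIV" "\<And>z. norm (z - a) = r \<Longrightarrow> F z \<noteq> 0" for F
  proof -
    have fin: "finite {p\<in>?s. F p = 0}"
      by (rule finite_subset[OF _ entire_finite_zeros[OF F(1) F(2)[OF w], of a "r + 1"]]) auto
    have "(\<Sum>p\<in>{p\<in>?s. F p = 0}. winding_number (circlepath a r) p * of_int (zorder F p)) =
        (\<Sum>p | p \<in> ball a r \<and> F p = 0. of_int (zorder F p))"
    proof (rule sum.mono_neutral_cong_right[OF fin])
      show "{p. p \<in> ball a r \<and> F p = 0} \<subseteq> {p \<in> ?s. F p = 0}" by auto
      show "\<forall>p\<in>{p \<in> ?s. F p = 0} - {p. p \<in> ball a r \<and> F p = 0}. winding_number (circlepath a r) p * of_int (zorder F p) = 0"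
      proof
        fix p assume p: "p \<in> {p \<in> ?s. F p = 0} - {p. p \<in> ball a r \<and> F p = 0}"
        then have "norm (p - a) \<ge> r" "norm (p - a) \<noteq> r" using F(2)[of p] by (auto simp: dist_norm norm_minus_commute)
        then have "p \<notin> cball a r" by (simp add: dist_norm norm_minus_commute)
        then have "winding_number (circlepath a r) p = 0"
          by (intro winding_number_zero_outside[of _ "cball a r"]) (use r in auto)
        then show "winding_number (circlepath a r) p * of_int (zorder F p) = 0" by simp
      qed
      fix p assume "p \<in> {p. p \<in> ball a r \<and> F p = 0}"
      then have "norm (p - a) < r" by (simp add: dist_norm norm_minus_commute)
      then show "winding_number (circlepath a r) p * of_int (zorder F p) = of_int (zorder F p)"
        by (simp add: winding_number_circlepath)
    qed
    then show ?thesis by simp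
  qed
  have "(\<Sum>p\<in>{p\<in>?s. f p + (g p - f p) = 0}. winding_number (circlepath a r) p * zorder (\<lambda>p. f p + (g p - f p)) p) =
     (\<Sum>p\<in>{p\<in>?s. f p = 0}. winding_number (circlepath a r) p * zorder f p)"
  proof (rule Rouche_theorem)
    show "finite {p \<in> ?s. f p + (g p - f p) = 0}"
      by (rule finite_subset[OF _ entire_finite_zeros[OF g gw, of a "r + 1"]]) auto
    show "finite {p \<in> ?s. f p = 0}"
      by (rule finite_subset[OF _ entire_finite_zeros[OF f fw, of a "r + 1"]]) auto
    show "f holomorphic_on ?s" using f holomorphic_on_subset by blast
    show "(\<lambda>p. g p - f p) holomorphic_on ?s"
      by (intro holomorphic_intros) (use f g holomorphic_on_subset in blast)+
    show "\<forall>z\<in>path_image (circlepath a r). norm (g z - f z) < norm (f z)"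
      using less r by (auto simp: dist_norm norm_minus_commute)
    show "\<forall>z. z \<notin> ?s \<longrightarrow> winding_number (circlepath a r) z = 0"
    proof (intro allI impI)
      fix z assume "z \<notin> ?s"
      then have "z \<notin> cball a r" using r by auto
      then show "winding_number (circlepath a r) z = 0"
        by (intro winding_number_zero_outside[of _ "cball a r"]) (use r in auto)
    qed
  qed (use r in auto)
  then have "(\<Sum>p\<in>{p\<in>?s. g p = 0}. winding_number (circlepath a r) p * zorder g p) =
     (\<Sum>p\<in>{p\<in>?s. f p = 0}. winding_number (circlepath a r) p * zorder f p)" by simp
  with eq[OF f nz(1)] eq[OF g nz(2)]
  have "(of_int (\<Sum>p | p \<in> ball a r \<and> g p = 0. zorder g p) :: complex) = of_int (\<Sum>p | p \<in> ball a r \<and> f p = 0. zorder f p)"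
    by (simp only:)
  then show ?thesis by (simp only: of_int_eq_iff)
qed

context sturm_liouville
begin

lemma Q_abs_int_matrix: "Q absolutely_integrable_on {0..pi}"
proof (rule absolutely_integrable_componentwise)
  fix b :: "complex^'m^'m" assume "b \<in> Basis"
  then obtain i u where u: "b = axis i u" "u \<in> Basis" by (auto simp: Basis_vec_def)
  then obtain j v where v: "u = axis j v" by (auto simp: Basis_vec_def)
  have "(\<lambda>t. Q t $ i $ j \<bullet> v) absolutely_integrable_on {0..pi}"
    by (rule absolutely_integrable_component[OF Q_abs_int])
  then show "(\<lambda>t. Q t \<bullet> b) absolutely_integrable_on {0..pi}" by (simp add: u v inner_axis)
qed

lemma class_A_Om:
  assumes "class_A \<omega> Q h H"
  shows "Om i j = \<omega> $ i $ j"
proof -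
  have "Q absolutely_integrable_on {0<..<pi}"
    by (rule set_integrable_subset[OF Q_abs_int_matrix]) auto
  then have "integrable (lebesgue_on {0<..<pi}) Q" by (rule absolutely_integrable_imp_integrable) auto
  then have "(LINT x|lebesgue_on {0<..<pi}. Q x) = integral {0<..<pi} Q"
    by (rule lebesgue_integral_eq_integral) auto
  also have "\<dots> = integral {0..pi} Q" by (simp add: integral_open_interval_real)
  finally have L: "(LINT x|lebesgue_on {0<..<pi}. Q x) = integral {0..pi} Q" .
  have "integral {0..pi} Q $ i $ j = integral {0..pi} (\<lambda>t. Q t $ i $ j)"
  proof -
    have bl: "bounded_linear (\<lambda>M :: complex^'m^'m. M $ i $ j)"
      by (intro bounded_linear_compose[OF bounded_linear_vec_nth bounded_linear_vec_nth])
    show ?thesis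
      using integral_linear[OF set_lebesgue_integral_eq_integral(1)[OF Q_abs_int_matrix] bl] by (simp add: o_def)
  qed
  then have "(h + H + (1/2) *\<^sub>R (LINT x|lebesgue_on {0<..<pi}. Q x)) $ i $ j = Om i j"
    unfolding L Om_def by (simp add: scaleR_conv_of_real[of _ "_ :: complex"])
  then show ?thesis using assms unfolding class_A_def by simp
qed

text \<open>In the formula for \<open>dphi\<close> at \<pi>, \<open>phi\<close> is replaced by
  cos(\<rho>t) c at relative cost 1/|\<rho>|. The product formula for cosines then separates cos
  \<rho>\<pi>, which collects \<open>h\<close>, \<open>H\<close> and the mean of \<open>Q\<close>
  into \<open>Om\<close>, from the oscillating \<open>Four\<close>.\<close>

lemma Delta_entry_asym:
  obtains K R :: real where "K \<ge> 0" "R \<ge> 1"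
    "\<And>\<rho> i j. norm \<rho> \<ge> R \<Longrightarrow>
       norm (Delta (\<rho>\<^sup>2) $ i $ j - (if i = j then - \<rho> * sin (\<rho> * of_real pi) else 0) -
         cos (\<rho> * of_real pi) * Om i j - 1 / 2 * Four \<rho> i j) \<le> K * exp (\<bar>Im \<rho>\<bar> * pi) / norm \<rho>"
proof -
  define A where "A = entry_sum h + 2 * (1 + entry_sum h) * Q1"
  \<comment> \<open>\<open>A\<close> is the constant of \<open>phi_minus_cos_bound\<close> for a
    unit vector; it enters once through the integral against \<open>Q\<close> and once through the
    boundary term with \<open>H\<close>.\<close>
  define K where "K = A * Q1 + entry_sum H * A"
  define R where "R = max 1 (2 * Q1)"
  have A: "A \<ge> 0" unfolding A_def using entry_sum_nonneg[of h] Q1_nonneg by simp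
  have "K \<ge> 0" unfolding K_def using A Q1_nonneg entry_sum_nonneg[of H] by simp
  moreover have "R \<ge> 1" by (simp add: R_def)
  moreover have "norm (Delta (\<rho>\<^sup>2) $ i $ j - (if i = j then - \<rho> * sin (\<rho> * of_real pi) else 0) -
         cos (\<rho> * of_real pi) * Om i j - 1 / 2 * Four \<rho> i j) \<le> K * exp (\<bar>Im \<rho>\<bar> * pi) / norm \<rho>"
    if rho: "norm \<rho> \<ge> R" for \<rho> i j
  proof -
    define \<tau> where "\<tau> = \<bar>Im \<rho>\<bar>"
    have r: "norm \<rho> \<ge> 1" "norm \<rho> \<ge> 2 * Q1" using rho by (auto simp: R_def)
    define c :: "complex^'m" where "c = axis j 1"
    have nc: "norm c = 1" by (simp add: c_def norm_axis_1)
    have col: "(M *v c) $ i = M $ i $ j" for M :: "complex^'m^'m" by (simp add: c_def matrix_entry)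
    have ci: "c $ i = (if i = j then 1 else 0)" by (simp add: c_def axis_def)
    define y where "y = phi (\<rho>\<^sup>2) c"
    note V = variation_of_constants_deriv[OF refl, of \<rho> c, folded y_def]
    have yb: "norm (y t - cos (\<rho> * of_real t) *s c) \<le> A * exp (\<tau> * t) / norm \<rho>" if "t \<in> {0..pi}" for t
      using phi_minus_cos_bound[OF r that, of c] by (simp add: nc y_def A_def \<tau>_def)
    have cy: "continuous_on {0..pi} y" unfolding y_def by (rule phi_cont)
    define E1 where "E1 = integral {0..pi} (\<lambda>t. cos (\<rho> * of_real (pi - t)) *s (Q t *v (y t - cos (\<rho> * of_real t) *s c)))"
    have int: "(\<lambda>t. cos (\<rho> * of_real (pi - t)) *s (Q t *v g t)) integrable_on {0..pi}" if "continuous_on {0..pi} g" for g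
      unfolding matvec_cscale[symmetric]
      by (intro matvec_integrable Q_abs_int continuous_intros that)
    have E1: "norm E1 \<le> 1 * (A / norm \<rho>) * exp (\<tau> * pi) * Q1"
      unfolding E1_def
    proof (rule kernel_Q_integral_le)
      show "(\<lambda>t. cos (\<rho> * of_real (pi - t)) *s (Q t *v (y t - cos (\<rho> * of_real t) *s c))) integrable_on {0..pi}"
        by (intro int continuous_intros cy)
      show "norm (cos (\<rho> * of_real (pi - t))) \<le> 1 * exp (\<tau> * (pi - t))" if "t \<in> {0..pi}" for t
        using norm_cos_real_le[of "pi - t" \<rho>] that by (simp add: \<tau>_def)
      show "norm (y t - cos (\<rho> * of_real t) *s c) \<le> A / norm \<rho> * exp (\<tau> * t)" if "t \<in> {0..pi}" for t
        using yb[OF that] by simp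
    qed (use A in auto)
    have "dphi (\<rho>\<^sup>2) c pi - cos (\<rho> * of_real pi) *s (h *v c) + (\<rho> * sin (\<rho> * of_real pi)) *s c =
        integral {0..pi} (\<lambda>t. cos (\<rho> * of_real (pi - t)) *s (Q t *v y t))"
      using integral_unique[OF V] by simp
    also have "\<dots> = E1 + integral {0..pi} (\<lambda>t. cos (\<rho> * of_real (pi - t)) *s (Q t *v (cos (\<rho> * of_real t) *s c)))"
    proof -
      have i1: "(\<lambda>t. cos (\<rho> * of_real (pi - t)) *s (Q t *v (y t - cos (\<rho> * of_real t) *s c))) integrable_on {0..pi}"
        by (intro int continuous_intros cy)
      have i2: "(\<lambda>t. cos (\<rho> * of_real (pi - t)) *s (Q t *v (cos (\<rho> * of_real t) *s c))) integrable_on {0..pi}"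
        by (intro int continuous_intros)
      show ?thesis unfolding E1_def integral_add[OF i1 i2, symmetric]
        by (intro integral_cong) (simp add: vector_add_ldistrib[symmetric] matrix_vector_right_distrib[symmetric])
    qed
    finally have V1: "dphi (\<rho>\<^sup>2) c pi = cos (\<rho> * of_real pi) *s (h *v c) - (\<rho> * sin (\<rho> * of_real pi)) *s c + E1 +
       integral {0..pi} (\<lambda>t. cos (\<rho> * of_real (pi - t)) *s (Q t *v (cos (\<rho> * of_real t) *s c)))"
      by (simp add: algebra_simps)
    have I: "integral {0..pi} (\<lambda>t. cos (\<rho> * of_real (pi - t)) *s (Q t *v (cos (\<rho> * of_real t) *s c))) $ i =
       1 / 2 * cos (\<rho> * of_real pi) * integral {0..pi} (\<lambda>t. Q t $ i $ j) + 1 / 2 * Four \<rho> i j"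
    proof -
      have "integral {0..pi} (\<lambda>t. cos (\<rho> * of_real (pi - t)) *s (Q t *v (cos (\<rho> * of_real t) *s c))) $ i =
        integral {0..pi} (\<lambda>t. (cos (\<rho> * of_real (pi - t)) *s (Q t *v (cos (\<rho> * of_real t) *s c))) $ i)"
      proof -
        have i2: "(\<lambda>t. cos (\<rho> * of_real (pi - t)) *s (Q t *v (cos (\<rho> * of_real t) *s c))) integrable_on {0..pi}"
          by (intro int continuous_intros)
        show ?thesis using integral_linear[OF i2 bounded_linear_vec_nth[of i]] by (simp add: o_def)
      qed
      also have "\<dots> = integral {0..pi} (\<lambda>t. (1 / 2 * cos (\<rho> * of_real pi)) * Q t $ i $ j + (1 / 2 * cos (\<rho> * of_real (pi - 2 * t))) * Q t $ i $ j)"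
      proof (rule integral_cong)
        fix t
        have "cos (\<rho> * of_real (pi - t)) * cos (\<rho> * of_real t) = (cos (\<rho> * of_real (pi - 2 * t)) + cos (\<rho> * of_real pi)) / 2"
          unfolding cos_times_cos by (simp add: algebra_simps)
        then show "(cos (\<rho> * of_real (pi - t)) *s (Q t *v (cos (\<rho> * of_real t) *s c))) $ i =
          (1 / 2 * cos (\<rho> * of_real pi)) * Q t $ i $ j + (1 / 2 * cos (\<rho> * of_real (pi - 2 * t))) * Q t $ i $ j"
          unfolding matvec_cscale vector_smult_component col mult.assoc[symmetric] by (simp only:) (simp add: field_simps)
      qed
      also have "\<dots> = integral {0..pi} (\<lambda>t. (1 / 2 * cos (\<rho> * of_real pi)) * Q t $ i $ j) + integral {0..pi} (\<lambda>t. (1 / 2 * cos (\<rho> * of_real (pi - 2 * t))) * Q t $ i $ j)"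
        by (intro integral_add cos_Q_int continuous_intros)
      also have "\<dots> = 1 / 2 * cos (\<rho> * of_real pi) * integral {0..pi} (\<lambda>t. Q t $ i $ j) + 1 / 2 * Four \<rho> i j"
        unfolding Four_def by (simp add: mult.assoc)
      finally show ?thesis .
    qed
    have V2: "dphi (\<rho>\<^sup>2) c pi $ i = cos (\<rho> * of_real pi) * h $ i $ j - (\<rho> * sin (\<rho> * of_real pi)) * (if i = j then 1 else 0) + E1 $ i +
       (1 / 2 * cos (\<rho> * of_real pi) * integral {0..pi} (\<lambda>t. Q t $ i $ j) + 1 / 2 * Four \<rho> i j)"
      unfolding V1 vector_add_component vector_minus_component vector_smult_component I col ci ..
    have "Delta (\<rho>\<^sup>2) $ i $ j = dphi (\<rho>\<^sup>2) c pi $ i + (H *v y pi) $ i"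
      unfolding col[symmetric] Delta_mult by (simp add: y_def)
    also have "(H *v y pi) $ i = (H *v (y pi - cos (\<rho> * of_real pi) *s c)) $ i + cos (\<rho> * of_real pi) * H $ i $ j"
      by (simp add: matrix_vector_mult_diff_distrib matvec_cscale col)
    finally have "Delta (\<rho>\<^sup>2) $ i $ j - (if i = j then - \<rho> * sin (\<rho> * of_real pi) else 0) -
         cos (\<rho> * of_real pi) * Om i j - 1 / 2 * Four \<rho> i j = E1 $ i + (H *v (y pi - cos (\<rho> * of_real pi) *s c)) $ i"
      unfolding V2 by (cases "i = j") (simp_all add: Om_def algebra_simps)
    also have "norm \<dots> \<le> norm E1 + norm (H *v (y pi - cos (\<rho> * of_real pi) *s c))"
      by (intro norm_triangle_mono Finite_Cartesian_Product.norm_nth_le)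
    also have "\<dots> \<le> 1 * (A / norm \<rho>) * exp (\<tau> * pi) * Q1 + entry_sum H * (A * exp (\<tau> * pi) / norm \<rho>)"
      by (intro add_mono E1 order_trans[OF norm_matvec_le] mult_left_mono yb entry_sum_nonneg) auto
    also have "\<dots> = K * exp (\<bar>Im \<rho>\<bar> * pi) / norm \<rho>" unfolding K_def \<tau>_def by (simp add: add_divide_distrib algebra_simps)
    finally show ?thesis .
  qed
  ultimately show thesis by (rule that)
qed

end

section \<open>Counting eigenvalues\<close>

text \<open>With Y = exp(2\<pi>|Im \<rho>|), |sin \<rho>\<pi>|^2 = (Y + 1/Y - 2 cos(2\<pi> Re
  \<rho>))/4. For |Im \<rho>| >= 1 the term Y dominates. Otherwise Re \<rho> lies between N + 1/4
  and N + 1/2, where that cosine is not positive.\<close>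

lemma sin_lower_bound:
  fixes \<rho> :: complex
  assumes rho: "norm \<rho> = real N + 1 / 2" and N: "N \<ge> 4" and re: "Re \<rho> \<ge> 0"
  shows "exp (\<bar>Im \<rho>\<bar> * pi) / 3 \<le> norm (sin (\<rho> * of_real pi))"
proof -
  define y where "y = \<bar>Im \<rho>\<bar>"
  define x where "x = Re \<rho>"
  define Y where "Y = exp (2 * pi * y)"
  have xy: "x\<^sup>2 + y\<^sup>2 = (real N + 1 / 2)\<^sup>2" using rho cmod_power2[of \<rho>] by (simp add: x_def y_def)
  have y0: "y \<ge> 0" by (simp add: y_def)
  have Y0: "Y > 0" by (simp add: Y_def)
  have sq: "(norm (sin (\<rho> * of_real pi)))\<^sup>2 = (Y + inverse Y - 2 * cos (2 * pi * x)) / 4"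
  proof (cases "Im \<rho> \<ge> 0")
    case True
    then show ?thesis by (simp add: norm_sin_squared Y_def y_def x_def mult_ac)
  next
    case False
    then show ?thesis by (simp add: norm_sin_squared Y_def y_def x_def mult_ac flip: exp_minus)
  qed
  define I where "I = inverse Y"
  define k where "k = cos (2 * pi * x)"
  \<comment> \<open>The claim squared asks only for Y/9, so Y/8 is more than enough.\<close>
  have "Y / 8 \<le> (Y + I - 2 * k) / 4"
  proof (cases "y \<ge> 1")
    case True
    have "4 \<le> 1 + 2 * pi * 1" using pi_gt3 by simp
    also have "\<dots> \<le> 1 + 2 * pi * y" using True by (intro add_left_mono mult_left_mono) auto
    also have "\<dots> \<le> Y" unfolding Y_def by (rule exp_ge_add_one_self)
    finally have "Y \<ge> 4" .
    moreover have "k \<le> 1" by (simp add: k_def)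
    moreover have "I \<ge> 0" using Y0 by (simp add: I_def)
    ultimately show ?thesis by (simp add: field_simps)
  next
    case False
    have x0: "x \<ge> 0" using re by (simp add: x_def)
    have "x\<^sup>2 \<le> (real N + 1 / 2)\<^sup>2" using xy zero_le_power2[of y] by linarith
    then have "x \<le> real N + 1 / 2" by (rule power2_le_imp_le) simp
    moreover have "x \<ge> real N + 1 / 4"
    proof (rule ccontr)
      assume "\<not> x \<ge> real N + 1 / 4"
      then have "x\<^sup>2 \<le> (real N + 1 / 4)\<^sup>2" using x0 by (intro power_mono) auto
      moreover have "y\<^sup>2 \<le> 1" using False y0 by (simp add: power_le_one)
      ultimately have "(real N + 1 / 2)\<^sup>2 \<le> (real N + 1 / 4)\<^sup>2 + 1" using xy by linarith
      then show False using N by (simp add: power2_eq_square field_simps)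
    qed
    ultimately have s: "0 \<le> x - real N - 1 / 4" "x - real N - 1 / 4 \<le> 1 / 4" by auto
    have "cos (2 * pi * x) = cos (2 * pi * (x - real N) + of_int (2 * int N) * pi)"
      by (simp add: algebra_simps)
    also have "\<dots> = cos (2 * pi * (x - real N))"
      using cos.plus_of_int[of "2 * pi * (x - real N)" "int N"] by (simp add: mult_ac)
    also have "\<dots> = - sin (2 * pi * (x - real N - 1 / 4))"
      using cos_add[of "2 * pi * (x - real N - 1 / 4)" "pi / 2"] by (simp add: algebra_simps)
    also have "\<dots> \<le> 0"
    proof -
      have "2 * pi * (x - real N - 1 / 4) \<le> 2 * pi * (1 / 4)" using s by (intro mult_left_mono) auto
      then have "2 * pi * (x - real N - 1 / 4) \<le> pi" using pi_gt_zero by linarith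
      moreover have "0 \<le> 2 * pi * (x - real N - 1 / 4)" using s by (intro mult_nonneg_nonneg) auto
      ultimately show ?thesis using sin_ge_zero by simp
    qed
    finally have "k \<le> 0" by (simp add: k_def)
    moreover have "I \<ge> 0" using Y0 by (simp add: I_def)
    ultimately show ?thesis using Y0 by (simp add: field_simps)
  qed
  moreover have "(exp (y * pi) / 3)\<^sup>2 = Y / 9"
    by (simp add: Y_def power_divide mult_ac flip: exp_double)
  ultimately have "(exp (y * pi) / 3)\<^sup>2 \<le> (norm (sin (\<rho> * of_real pi)))\<^sup>2"
    unfolding sq I_def[symmetric] k_def[symmetric] using Y0 by linarith
  then show ?thesis unfolding y_def by (rule power2_le_imp_le) simp
qed

text \<open>Taking the problem with \<open>Q = h = H = 0\<close> for comparison in Rouche's theorem makes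
  \<open>(- \<rho> sin \<rho>\<pi>)\<^sup>m\<close> an entire function of \<open>\<rho>\<^sup>2\<close> whose zeros have known order, without regard to the
  branch of the square root.\<close>

lemma free_problem: "sturm_liouville (\<lambda>_. 0 :: complex^'m^'m) 0 0"
proof
  have "hermitian (0 :: complex^'m^'m)" by (simp add: hermitian_def conj_transpose_def vec_eq_iff)
  then show "selfadjoint_problem (\<lambda>_. 0 :: complex^'m^'m) 0 0"
    by (simp add: selfadjoint_problem_def L2_entries_def)
qed

abbreviation freeDelta :: "complex \<Rightarrow> complex^'m^'m" where
  "freeDelta \<equiv> sturm_liouville.Delta (\<lambda>_. 0) 0 0"

lemma freeDelta_mult: "freeDelta (\<rho>\<^sup>2) *v c = (- \<rho> * sin (\<rho> * of_real pi)) *s (c :: complex^'m)"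
proof -
  interpret F: sturm_liouville "\<lambda>_. 0 :: complex^'m^'m" 0 0 by (rule free_problem)
  have "F.dphi (\<rho>\<^sup>2) c pi + (\<rho> * sin (\<rho> * of_real pi)) *s c = 0"
    using integral_unique[OF F.variation_of_constants_deriv[OF refl, of \<rho> c]] by simp
  then have "F.dphi (\<rho>\<^sup>2) c pi = - ((\<rho> * sin (\<rho> * of_real pi)) *s c)" by (simp add: add_eq_0_iff2)
  then show ?thesis by (simp add: F.Delta_mult vec_eq_iff)
qed

lemma freeDelta_entry: "freeDelta (\<rho>\<^sup>2) $ i $ j = (if i = j then - \<rho> * sin (\<rho> * of_real pi) else 0)"
  unfolding matrix_entry freeDelta_mult by (simp add: axis_def)

lemma det_freeDelta: "det (freeDelta (\<rho>\<^sup>2) :: complex^'m^'m) = (\<Prod>i\<in>(UNIV :: 'm set). - \<rho> * sin (\<rho> * of_real pi))"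
  by (subst det_diagonal) (simp_all add: freeDelta_entry)

lemma det_freeDelta_eq_0_iff: "det (freeDelta \<mu> :: complex^'m^'m) = 0 \<longleftrightarrow> (\<exists>n :: nat. \<mu> = (of_nat n)\<^sup>2)"
proof -
  define \<rho> where "\<rho> = csqrt \<mu>"
  have mu: "\<mu> = \<rho>\<^sup>2" by (simp add: \<rho>_def)
  have "det (freeDelta \<mu> :: complex^'m^'m) = 0 \<longleftrightarrow> \<rho> = 0 \<or> sin (\<rho> * of_real pi) = 0"
    unfolding mu det_freeDelta by simp
  also have "\<dots> \<longleftrightarrow> (\<exists>n :: nat. \<mu> = (of_nat n)\<^sup>2)"
  proof
    assume "\<rho> = 0 \<or> sin (\<rho> * of_real pi) = 0"
    then obtain k :: int where "\<rho> * of_real pi = of_int k * of_real pi"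
      by (auto simp: sin_eq_0 intro: that[of 0])
    then have "\<mu> = (of_int k)\<^sup>2" using mu by simp
    also have "\<dots> = (of_nat (nat \<bar>k\<bar>))\<^sup>2" by (simp flip: of_int_power)
    finally show "\<exists>n :: nat. \<mu> = (of_nat n)\<^sup>2" by blast
  next
    assume "\<exists>n :: nat. \<mu> = (of_nat n)\<^sup>2"
    then obtain n :: nat where "\<mu> = (of_nat n)\<^sup>2" by blast
    then have "\<rho> = of_nat n" by (simp add: \<rho>_def csqrt_square)
    then have "\<rho> * of_real pi = of_real (of_int (int n) * pi)" by simp
    then show "\<rho> = 0 \<or> sin (\<rho> * of_real pi) = 0" unfolding sin_eq_0 by blast
  qed
  finally show ?thesis .
qed

text \<open>An instance of the general theorem on orders: at n^2 the free characteristic matrix is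
  zero, so its kernel is the whole space. The case n = 0 needs no separate treatment, since the
  order is taken in \<rho>^2 and not in \<rho>.\<close>

lemma zorder_det_freeDelta:
  "zorder (\<lambda>\<mu>. det (freeDelta \<mu> :: complex^'m^'m)) ((of_nat n)\<^sup>2) = int CARD('m)"
proof -
  have "det (freeDelta ((of_nat n)\<^sup>2) :: complex^'m^'m) = 0" using det_freeDelta_eq_0_iff[where 'm='m] by blast
  moreover have "{c :: complex^'m. freeDelta ((of_nat n)\<^sup>2) *v c = 0} = UNIV"
  proof -
    have "(of_nat n * of_real pi :: complex) = of_real (of_int (int n) * pi)" by simp
    then have "sin (of_nat n * of_real pi :: complex) = 0" unfolding sin_eq_0 by blast
    then show ?thesis by (simp add: freeDelta_mult)
  qed
  ultimately show ?thesis
    using sturm_liouville.zorder_det_Delta[OF free_problem[where 'm='m], of "(of_nat n)\<^sup>2"]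
    by (simp add: vec.dim_UNIV card_cart_basis vec.dimension_def)
qed

lemma free_count:
  "(\<Sum>p | p \<in> ball 0 ((real N + 1 / 2)\<^sup>2) \<and> det (freeDelta p :: complex^'m^'m) = 0.
     zorder (\<lambda>\<mu>. det (freeDelta \<mu> :: complex^'m^'m)) p) = int ((N + 1) * CARD('m))"
proof -
  have set: "{p. p \<in> ball 0 ((real N + 1 / 2)\<^sup>2) \<and> det (freeDelta p :: complex^'m^'m) = 0} =
      (\<lambda>n. (of_nat n)\<^sup>2) ` {..N}" (is "?L = ?R")
  proof (intro equalityI subsetI)
    fix p assume "p \<in> ?L"
    then obtain n :: nat where n: "p = (of_nat n)\<^sup>2" "norm p < (real N + 1 / 2)\<^sup>2" using det_freeDelta_eq_0_iff[where 'm='m] by auto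
    then have "(real n)\<^sup>2 < (real N + 1 / 2)\<^sup>2" by (simp add: norm_power)
    then have "real n < real N + 1 / 2" by (rule power2_less_imp_less) simp
    then have "n \<le> N" by linarith
    then show "p \<in> ?R" using n by blast
  next
    fix p assume "p \<in> ?R"
    then obtain n where n: "n \<le> N" "p = (of_nat n)\<^sup>2" by auto
    have "(real n)\<^sup>2 < (real N + 1 / 2)\<^sup>2" using n by (intro power_strict_mono) auto
    then have "norm p < (real N + 1 / 2)\<^sup>2" using n by (simp add: norm_power)
    then show "p \<in> ?L" using n det_freeDelta_eq_0_iff[where 'm='m] by auto
  qed
  have inj: "inj_on (\<lambda>n. (of_nat n :: complex)\<^sup>2) {..N}"
  proof (rule inj_onI)
    fix a b assume "(of_nat a :: complex)\<^sup>2 = (of_nat b)\<^sup>2"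
    then have "norm ((of_nat a :: complex)\<^sup>2) = norm ((of_nat b :: complex)\<^sup>2)" by simp
    then have "(real a)\<^sup>2 = (real b)\<^sup>2" by (simp add: norm_power)
    then show "a = b" by simp
  qed
  show ?thesis unfolding set
    by (subst sum.reindex[OF inj]) (simp add: zorder_det_freeDelta algebra_simps)
qed

context sturm_liouville
begin

definition Om_sum :: real where
  "Om_sum = (\<Sum>i\<in>UNIV. \<Sum>j\<in>UNIV. norm (Om i j))"

lemma Om_le: "norm (Om i j) \<le> Om_sum"
proof -
  have "norm (Om i j) \<le> (\<Sum>j\<in>UNIV. norm (Om i j))" by (rule member_le_sum) auto
  also have "\<dots> \<le> Om_sum" unfolding Om_sum_def by (rule member_le_sum) (auto intro: sum_nonneg)
  finally show ?thesis .
qed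

text \<open>On the large circles the entries differ from the free ones by O(exp(\<tau>\<pi>)), while
  the free diagonal is at least |\<rho>| exp(\<tau>\<pi>)/3; the relative error is thus eventually
  below the threshold of \<open>det_near_diagonal\<close>.\<close>

lemma eigenvalue_count:
  obtains N0 where "\<And>N. N \<ge> N0 \<Longrightarrow>
    (\<Sum>p | p \<in> ball 0 ((real N + 1 / 2)\<^sup>2) \<and> det (Delta p) = 0. zorder (\<lambda>\<mu>. det (Delta \<mu>)) p) = int ((N + 1) * CARD('m))"
proof -
  obtain K R where KR: "K \<ge> 0" "R \<ge> 1"
    "\<And>\<rho> i j. norm \<rho> \<ge> R \<Longrightarrow>
       norm (Delta (\<rho>\<^sup>2) $ i $ j - (if i = j then - \<rho> * sin (\<rho> * of_real pi) else 0) -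
         cos (\<rho> * of_real pi) * Om i j - 1 / 2 * Four \<rho> i j) \<le> K * exp (\<bar>Im \<rho>\<bar> * pi) / norm \<rho>"
    by (rule Delta_entry_asym) (rule that, assumption, assumption, blast)
  obtain \<eta> where eta: "\<eta> > 0" and det: "\<And>(d :: 'm \<Rightarrow> complex) (A :: complex^'m^'m).
       (\<And>i. d i \<noteq> 0) \<Longrightarrow> (\<And>i j. norm (A $ i $ j - (if i = j then d i else 0)) \<le> \<eta> * norm (d i)) \<Longrightarrow>
       norm (det A - (\<Prod>i\<in>UNIV. d i)) < norm (\<Prod>i\<in>UNIV. d i)"
    by (rule det_near_diagonal[where 'n='m]) (rule that, assumption, blast)
  define C where "C = Om_sum + Q1 + K"
  \<comment> \<open>The bound 4 serves \<open>sin_lower_bound\<close>, \<open>R\<close> the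
    asymptotics, and \<open>3 * C / \<eta>\<close> makes the error \<open>e * C\<close> at most
    \<open>\<eta>\<close> times |\<rho>| e/3.\<close>
  obtain N0 :: nat where N0: "real N0 \<ge> max 4 (max R (3 * C / \<eta>))" using real_arch_simple by blast
  show thesis
  proof (rule that[of N0])
    fix N assume N: "N \<ge> N0"
    then have N': "N \<ge> 4" "real N \<ge> R" "real N \<ge> 3 * C / \<eta>" using N0 by auto
    have "(\<Sum>p | p \<in> ball 0 ((real N + 1 / 2)\<^sup>2) \<and> det (Delta p) = 0. zorder (\<lambda>\<mu>. det (Delta \<mu>)) p) =
      (\<Sum>p | p \<in> ball 0 ((real N + 1 / 2)\<^sup>2) \<and> det (freeDelta p :: complex^'m^'m) = 0.
         zorder (\<lambda>\<mu>. det (freeDelta \<mu> :: complex^'m^'m)) p)"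
    proof (rule rouche_ball)
      show "(\<lambda>\<mu>. det (freeDelta \<mu> :: complex^'m^'m)) holomorphic_on UNIV"
        by (rule sturm_liouville.det_Delta_holomorphic[OF free_problem])
      show "(\<lambda>\<mu>. det (Delta \<mu>)) holomorphic_on UNIV" by (rule det_Delta_holomorphic)
      show "(real N + 1 / 2)\<^sup>2 > 0" by simp
      fix z :: complex assume z: "norm (z - 0) = (real N + 1 / 2)\<^sup>2"
      define \<rho> where "\<rho> = csqrt z"
      define e where "e = exp (\<bar>Im \<rho>\<bar> * pi)"
      have zr: "z = \<rho>\<^sup>2" by (simp add: \<rho>_def)
      have "(norm \<rho>)\<^sup>2 = (real N + 1 / 2)\<^sup>2" using z zr by (simp add: norm_power)
      then have nr: "norm \<rho> = real N + 1 / 2" by (subst (asm) power2_eq_iff_nonneg) auto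
      have low: "e / 3 \<le> norm (sin (\<rho> * of_real pi))"
        unfolding e_def by (rule sin_lower_bound[OF nr N'(1)]) (use csqrt_principal[of z] in \<open>auto simp: \<rho>_def\<close>)
      have e0: "e > 0" by (simp add: e_def)
      have "norm (det (Delta z) - (\<Prod>i\<in>(UNIV :: 'm set). - \<rho> * sin (\<rho> * of_real pi))) <
         norm (\<Prod>i\<in>(UNIV :: 'm set). - \<rho> * sin (\<rho> * of_real pi))"
      proof (rule det)
        show "- \<rho> * sin (\<rho> * of_real pi) \<noteq> 0" using low e0 nr by auto
        fix i j :: 'm
        define d where "d = (if i = j then - \<rho> * sin (\<rho> * of_real pi) else 0)"
        have "norm (Delta z $ i $ j - d) \<le> norm (Delta z $ i $ j - d - cos (\<rho> * of_real pi) * Om i j - 1 / 2 * Four \<rho> i j)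
            + norm (cos (\<rho> * of_real pi) * Om i j) + norm (1 / 2 * Four \<rho> i j)"
          using norm_triangle_ineq[of "Delta z $ i $ j - d - cos (\<rho> * of_real pi) * Om i j - 1 / 2 * Four \<rho> i j"
              "cos (\<rho> * of_real pi) * Om i j + 1 / 2 * Four \<rho> i j"]
            norm_triangle_ineq[of "cos (\<rho> * of_real pi) * Om i j" "1 / 2 * Four \<rho> i j"] by simp
        also have "\<dots> \<le> K * e / norm \<rho> + e * Om_sum + 1 / 2 * (e * Q1)"
        proof (intro add_mono)
          show "norm (Delta z $ i $ j - d - cos (\<rho> * of_real pi) * Om i j - 1 / 2 * Four \<rho> i j) \<le> K * e / norm \<rho>"
            unfolding zr d_def e_def by (rule KR(3)) (use nr N' in simp)
          show "norm (cos (\<rho> * of_real pi) * Om i j) \<le> e * Om_sum"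
            unfolding norm_mult e_def by (intro mult_mono Om_le norm_cos_real_le) auto
          show "norm (1 / 2 * Four \<rho> i j) \<le> 1 / 2 * (e * Q1)"
            using Four_bound[of \<rho> i j] by (simp add: norm_mult e_def)
        qed
        also have "\<dots> \<le> K * e + e * Om_sum + e * Q1"
        proof (intro add_mono order_refl)
          have "K * e / norm \<rho> \<le> K * e / 1" using nr KR(1) e0 N' by (intro divide_left_mono) auto
          then show "K * e / norm \<rho> \<le> K * e" by simp
          show "1 / 2 * (e * Q1) \<le> e * Q1" using e0 Q1_nonneg by simp
        qed
        also have "\<dots> = e * C" by (simp add: C_def algebra_simps)
        also have "\<dots> \<le> e * (\<eta> * norm \<rho> / 3)"
        proof (rule mult_left_mono)
          have "3 * C / \<eta> \<le> norm \<rho>" using N' nr by simp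
          then show "C \<le> \<eta> * norm \<rho> / 3" using eta by (simp add: field_simps)
        qed (use e0 in simp)
        also have "\<dots> = \<eta> * (norm \<rho> * (e / 3))" by simp
        also have "\<dots> \<le> \<eta> * (norm \<rho> * norm (sin (\<rho> * of_real pi)))"
          using eta low by (intro mult_left_mono) auto
        finally show "norm (Delta z $ i $ j - (if i = j then - \<rho> * sin (\<rho> * of_real pi) else 0)) \<le>
            \<eta> * norm (- \<rho> * sin (\<rho> * of_real pi))"
          by (simp add: d_def norm_mult)
      qed
      then show "norm (det (Delta z) - det (freeDelta z :: complex^'m^'m)) < norm (det (freeDelta z :: complex^'m^'m))"
        unfolding zr det_freeDelta by (simp add: zr[symmetric])
    qed
    also have "\<dots> = int ((N + 1) * CARD('m))" by (rule free_count)
    finally show "(\<Sum>p | p \<in> ball 0 ((real N + 1 / 2)\<^sup>2) \<and> det (Delta p) = 0. zorder (\<lambda>\<mu>. det (Delta \<mu>)) p) = int ((N + 1) * CARD('m))" .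
  qed
qed

end

section \<open>Localization of the eigenvalues near the squares\<close>

text \<open>The quadratic rate is enough: the argument is O(1/n), and the difference gets multiplied
  by \<rho>, which is of order n.\<close>

lemma sin_minus_self_le:
  fixes u :: complex
  assumes "norm u \<le> b"
  shows "norm (sin u - u) \<le> exp b * (norm u)\<^sup>2"
proof -
  have der: "((\<lambda>v. sin v - v) has_field_derivative cos v - 1) (at v within cball 0 (norm u))" for v :: complex
    by (auto intro!: derivative_eq_intros)
  have bd: "norm (cos v - 1) \<le> exp b * norm u" if "v \<in> cball 0 (norm u)" for v :: complex
  proof -
    have v: "norm v \<le> norm u" using that by simp
    have "\<bar>Im v\<bar> \<le> b" using v assms abs_Im_le_cmod[of v] by linarith
    moreover have "b \<ge> 0" using assms norm_ge_zero order_trans by blast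
    ultimately have "norm (cos v - cos 0) \<le> exp b * norm (v - 0)" by (intro cos_diff_le) auto
    also have "\<dots> \<le> exp b * norm u" using v by simp
    finally show ?thesis by simp
  qed
  have "norm ((sin u - u) - (sin 0 - 0)) \<le> exp b * norm u * norm (u - 0)"
    by (rule field_differentiable_bound[OF convex_cball der bd]) auto
  then show ?thesis by (simp add: power2_eq_square mult_ac)
qed

lemma cos_sin_int_shift:
  fixes n :: nat and \<delta> :: complex
  shows "cos ((of_nat n + \<delta>) * of_real pi) = (-1) ^ n * cos (\<delta> * of_real pi)"
    and "sin ((of_nat n + \<delta>) * of_real pi) = (-1) ^ n * sin (\<delta> * of_real pi)"
proof -
  have c: "cos (of_nat n * of_real pi :: complex) = (-1) ^ n"
    by (metis cos_npi cos_of_real of_real_1 of_real_minus of_real_mult of_real_of_nat_eq of_real_power)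
  have s: "sin (of_nat n * of_real pi :: complex) = 0"
    by (metis sin_npi sin_of_real of_real_0 of_real_mult of_real_of_nat_eq)
  show "cos ((of_nat n + \<delta>) * of_real pi) = (-1) ^ n * cos (\<delta> * of_real pi)"
    by (simp add: distrib_right cos_add c s)
  show "sin ((of_nat n + \<delta>) * of_real pi) = (-1) ^ n * sin (\<delta> * of_real pi)"
    by (simp add: distrib_right sin_add c s)
qed

text \<open>The principal root has nonnegative real part, hence |\<rho> + n| >= n, and \<zeta> =
  (\<rho> - n)(\<rho> + n) can be divided by this factor.\<close>

lemma csqrt_near_square:
  fixes n :: nat and \<zeta> :: complex
  assumes n: "n \<ge> 1"
  shows "norm (csqrt ((of_nat n)\<^sup>2 + \<zeta>) - of_nat n) \<le> norm \<zeta> / real n"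
    and "\<zeta> = (csqrt ((of_nat n)\<^sup>2 + \<zeta>) - of_nat n) * (csqrt ((of_nat n)\<^sup>2 + \<zeta>) + of_nat n)"
    and "norm (csqrt ((of_nat n)\<^sup>2 + \<zeta>) + of_nat n) \<ge> real n"
proof -
  define \<rho> where "\<rho> = csqrt ((of_nat n)\<^sup>2 + \<zeta>)"
  have re: "Re \<rho> \<ge> 0" using csqrt_principal[of "(of_nat n)\<^sup>2 + \<zeta>"] by (auto simp: \<rho>_def)
  have sq: "\<rho>\<^sup>2 = (of_nat n)\<^sup>2 + \<zeta>" by (simp add: \<rho>_def)
  have fac: "\<zeta> = (\<rho> - of_nat n) * (\<rho> + of_nat n)" using sq by (simp add: power2_eq_square algebra_simps)
  have low: "real n \<le> norm (\<rho> + of_nat n)" using complex_Re_le_cmod[of "\<rho> + of_nat n"] re by simp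
  have "norm (\<rho> - of_nat n) * real n \<le> norm (\<rho> - of_nat n) * norm (\<rho> + of_nat n)"
    using low by (intro mult_left_mono) auto
  also have "\<dots> = norm \<zeta>" by (subst fac) (simp add: norm_mult)
  finally show "norm (csqrt ((of_nat n)\<^sup>2 + \<zeta>) - of_nat n) \<le> norm \<zeta> / real n"
    using n by (simp add: \<rho>_def field_simps)
  show "\<zeta> = (csqrt ((of_nat n)\<^sup>2 + \<zeta>) - of_nat n) * (csqrt ((of_nat n)\<^sup>2 + \<zeta>) + of_nat n)"
    using fac by (simp add: \<rho>_def)
  show "norm (csqrt ((of_nat n)\<^sup>2 + \<zeta>) + of_nat n) \<ge> real n" using low by (simp add: \<rho>_def)
qed

lemma summable_square_add:
  fixes f g :: "nat \<Rightarrow> real"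
  assumes "summable (\<lambda>n. (f n)\<^sup>2)" "summable (\<lambda>n. (g n)\<^sup>2)"
  shows "summable (\<lambda>n. (f n + g n)\<^sup>2)"
proof (rule summable_comparison_test')
  show "summable (\<lambda>n. 2 * (f n)\<^sup>2 + 2 * (g n)\<^sup>2)" by (intro summable_add summable_mult assms)
  have "(f n + g n)\<^sup>2 \<le> 2 * (f n)\<^sup>2 + 2 * (g n)\<^sup>2" for n
    using sum_squares_bound[of "f n" "g n"] by (simp add: power2_sum)
  then show "norm ((f n + g n)\<^sup>2) \<le> 2 * (f n)\<^sup>2 + 2 * (g n)\<^sup>2" for n by simp
qed

lemma summable_square_cmult:
  fixes f :: "nat \<Rightarrow> real"
  assumes "summable (\<lambda>n. (f n)\<^sup>2)"
  shows "summable (\<lambda>n. (c * f n)\<^sup>2)"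
  unfolding power_mult_distrib by (intro summable_mult assms)

lemma summable_square_sum:
  fixes f :: "'i \<Rightarrow> nat \<Rightarrow> real"
  assumes "\<And>i. i \<in> I \<Longrightarrow> summable (\<lambda>n. (f i n)\<^sup>2)"
  shows "summable (\<lambda>n. (\<Sum>i\<in>I. f i n)\<^sup>2)"
  using assms by (induction I rule: infinite_finite_induct) (auto intro: summable_square_add)

lemma summable_square_inverse: "summable (\<lambda>n. (1 / real (Suc n))\<^sup>2)"
proof -
  have "summable (\<lambda>n. 1 / (real n)\<^sup>2)" using inverse_power_summable[of 2] by (simp add: inverse_eq_divide)
  then have "summable (\<lambda>n. 1 / (real (Suc n))\<^sup>2)" by (subst summable_Suc_iff)
  then show ?thesis by (simp only: power_divide power_one)
qed

text \<open>Factors with \<open>d i = w\<close> combine to a power of z - p0. Any other factor has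
  its root at distance 2 |d i - w| / \<pi> >= r from p0, outside the open ball.\<close>

lemma linear_product_count:
  fixes d :: "'n::finite \<Rightarrow> real" and a s :: complex
  assumes s: "s \<noteq> 0" and r: "r > 0" and w: "w \<in> range d"
    and gap: "\<And>i. d i \<noteq> w \<Longrightarrow> pi / 2 * r \<le> \<bar>d i - w\<bar>"
  defines "f \<equiv> \<lambda>z. \<Prod>i\<in>UNIV. s * (of_real (d i) - of_real pi / 2 * (z - a))"
  shows "(\<Sum>p | p \<in> ball (a + of_real (2 * w / pi)) r \<and> f p = 0. zorder f p) = int (card {i. d i = w})"
proof -
  define p0 where "p0 = a + of_real (2 * w / pi)"
  have lin: "of_real x - of_real pi / 2 * (z - a) = of_real (x - w) - of_real pi / 2 * (z - p0)" for x :: real and z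
  proof -
    define P :: complex where "P = of_real pi / 2"
    have "P * of_real (2 * w / pi) = of_real w" by (simp add: P_def)
    then show ?thesis unfolding p0_def P_def[symmetric] by (simp add: right_diff_distrib distrib_left del: of_real_mult of_real_divide)
  qed
  have nz: "of_real (d i) - of_real pi / 2 * (z - a) \<noteq> 0" if "z \<in> ball p0 r" "d i \<noteq> w" for i z
  proof
    assume "of_real (d i) - of_real pi / 2 * (z - a) = 0"
    then have "of_real (d i - w) = of_real pi / 2 * (z - p0)" unfolding lin by simp
    then have "\<bar>d i - w\<bar> = pi / 2 * norm (z - p0)"
      by (metis norm_divide norm_mult norm_numeral norm_of_real abs_of_nonneg pi_ge_zero)
    also have "\<dots> < pi / 2 * r" using that(1) by (simp add: dist_norm norm_minus_commute)
    finally show False using gap[OF that(2)] by simp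
  qed
  have zeros: "{p. p \<in> ball p0 r \<and> f p = 0} = {p0}"
  proof (intro equalityI subsetI)
    fix p assume "p \<in> {p. p \<in> ball p0 r \<and> f p = 0}"
    then have p: "p \<in> ball p0 r" "f p = 0" by auto
    then obtain i where i: "of_real (d i) - of_real pi / 2 * (p - a) = 0" using s by (auto simp: f_def)
    then have "d i = w" using nz[OF p(1)] by blast
    then show "p \<in> {p0}" using i unfolding lin by simp
  next
    fix p assume p: "p \<in> {p0}"
    obtain i where "d i = w" using w by auto
    then have "of_real (d i) - of_real pi / 2 * (p0 - a) = 0" unfolding lin by simp
    then have "s * (of_real (d i) - of_real pi / 2 * (p0 - a)) = 0" by (simp only: mult_zero_right)
    then have "f p0 = 0" unfolding f_def by (intro prod_zero) auto
    then show "p \<in> {p. p \<in> ball p0 r \<and> f p = 0}" using p r by simp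
  qed
  define g where "g z = (\<Prod>i\<in>{i. d i = w}. s * (- (of_real pi / 2))) * (\<Prod>i\<in>{i. d i \<noteq> w}. s * (of_real (d i) - of_real pi / 2 * (z - a)))" for z
  have "zorder f p0 = int (card {i. d i = w})"
  proof (rule zorder_eqI[of UNIV _ g])
    show "g holomorphic_on UNIV" unfolding g_def by (intro holomorphic_intros)
    show "g p0 \<noteq> 0" unfolding g_def using s nz[of p0] r by simp
    fix z :: complex
    have "f z = (\<Prod>i\<in>{i. d i = w}. s * (of_real (d i) - of_real pi / 2 * (z - a))) *
        (\<Prod>i\<in>{i. d i \<noteq> w}. s * (of_real (d i) - of_real pi / 2 * (z - a)))"
      unfolding f_def by (subst prod.union_disjoint[symmetric]) (auto intro!: prod.cong)
    also have "(\<Prod>i\<in>{i. d i = w}. s * (of_real (d i) - of_real pi / 2 * (z - a))) =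
       (\<Prod>i\<in>{i. d i = w}. (s * (- (of_real pi / 2))) * (z - p0))"
    proof (rule prod.cong[OF refl])
      fix i assume "i \<in> {i. d i = w}"
      then show "s * (of_real (d i) - of_real pi / 2 * (z - a)) = (s * (- (of_real pi / 2))) * (z - p0)"
        unfolding lin by simp
    qed
    also have "\<dots> = (\<Prod>i\<in>{i. d i = w}. s * (- (of_real pi / 2))) * (z - p0) ^ card {i. d i = w}"
      by (simp only: prod.distrib prod_constant)
    finally show "f z = g z * (z - p0) powi int (card {i. d i = w})" by (simp add: g_def mult_ac)
  qed auto
  then show ?thesis using zeros by (simp add: p0_def)
qed

context sturm_liouville
begin

text \<open>The cosine coefficient is kept apart from \<open>C / real n\<close>: it is not claimed
  to be O(1/n), only to be square summable in n.\<close>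

lemma Delta_near_square:
  fixes Z :: real
  obtains C n0 where "C \<ge> 0" "n0 \<ge> 1"
    "\<And>n \<zeta> i j. n \<ge> n0 \<Longrightarrow> norm \<zeta> \<le> Z \<Longrightarrow>
      norm (Delta ((of_nat n)\<^sup>2 + \<zeta>) $ i $ j - (-1) ^ n * (Om i j - (if i = j then of_real pi / 2 * \<zeta> else 0)))
      \<le> C / real n + norm (cos_coeff n i j)"
proof -
  obtain K R where KR: "K \<ge> 0" "R \<ge> 1"
    "\<And>\<rho> i j. norm \<rho> \<ge> R \<Longrightarrow>
       norm (Delta (\<rho>\<^sup>2) $ i $ j - (if i = j then - \<rho> * sin (\<rho> * of_real pi) else 0) -
         cos (\<rho> * of_real pi) * Om i j - 1 / 2 * Four \<rho> i j) \<le> K * exp (\<bar>Im \<rho>\<bar> * pi) / norm \<rho>"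
    by (rule Delta_entry_asym) (rule that, assumption, assumption, blast)
  define Z' where "Z' = max Z 0"
  \<comment> \<open>In turn: the remainder of the asymptotics, with factor 2 since |\<rho>| >= n/2;
    the linearization of \<rho> sin \<rho>\<pi>; the replacement of cos \<rho>\<pi> by (-1)^n; the
    shift of \<open>Four\<close> from \<rho> to n. All exponentials are at most exp \<pi>, as |Im
    \<rho>| <= 1.\<close>
  define C1 where "C1 = 2 * K * exp pi"
  define C2 where "C2 = 2 * (exp pi * pi\<^sup>2 + pi) * Z'\<^sup>2"
  define C3 where "C3 = exp pi * (pi * Z') * Om_sum"
  define C4 where "C4 = exp pi * pi * Q1 * Z'"
  define C where "C = C1 + C2 + C3 + C4"
  have Z': "Z' \<ge> 0" by (simp add: Z'_def)
  have Om0: "Om_sum \<ge> 0" unfolding Om_sum_def by (intro sum_nonneg) auto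
  have C0: "C1 \<ge> 0" "C2 \<ge> 0" "C3 \<ge> 0" "C4 \<ge> 0"
    using KR(1) Z' Om0 Q1_nonneg by (auto simp: C1_def C2_def C3_def C4_def)
  obtain n0 :: nat where n0: "real n0 \<ge> max 2 (max (R + 1) Z')" using real_arch_simple by blast
  show thesis
  proof (rule that[of C n0])
    show "C \<ge> 0" using C0 by (simp add: C_def)
    show "n0 \<ge> 1" using n0 by auto
    fix n :: nat and \<zeta> :: complex and i j :: 'm assume "n \<ge> n0" and z: "norm \<zeta> \<le> Z"
    then have n: "n \<ge> 2" "real n \<ge> R + 1" "real n \<ge> Z'" using n0 by auto
    have z': "norm \<zeta> \<le> Z'" using z by (simp add: Z'_def)
    define \<rho> where "\<rho> = csqrt ((of_nat n)\<^sup>2 + \<zeta>)"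
    define \<delta> where "\<delta> = \<rho> - of_nat n"
    have rd: "\<rho> = of_nat n + \<delta>" by (simp add: \<delta>_def)
    have sq: "(of_nat n)\<^sup>2 + \<zeta> = \<rho>\<^sup>2" by (simp add: \<rho>_def)
    have n1: "n \<ge> 1" using n by simp
    have zfac: "\<zeta> = \<delta> * (\<rho> + of_nat n)" using csqrt_near_square(2)[OF n1, of \<zeta>] by (simp add: \<rho>_def \<delta>_def)
    have "norm \<delta> \<le> norm \<zeta> / real n" using csqrt_near_square(1)[OF n1, of \<zeta>] by (simp add: \<rho>_def \<delta>_def)
    also have "\<dots> \<le> Z' / real n" using z' by (intro divide_right_mono) auto
    finally have dn: "norm \<delta> \<le> Z' / real n" .
    also have "\<dots> \<le> 1" using n by (simp add: field_simps)
    finally have d1: "norm \<delta> \<le> 1" .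
    have Im: "\<bar>Im \<rho>\<bar> \<le> 1" using abs_Im_le_cmod[of \<delta>] d1 by (simp add: rd)
    have nr: "real n - 1 \<le> norm \<rho>" "norm \<rho> \<le> real n + 1"
      using norm_triangle_ineq[of "of_nat n" \<delta>] norm_diff_ineq[of "of_nat n" \<delta>] d1 unfolding rd by auto
    have half: "real n / 2 \<le> norm \<rho>" using nr(1) n(1) by linarith
    have rR: "norm \<rho> \<ge> R" using nr(1) n(2) by linarith
    let ?a = "norm (cos_coeff n i j)"
    define T where "T = (if i = j then - \<rho> * sin (\<rho> * of_real pi) else 0)"
    define T' where "T' = (if i = j then of_real pi / 2 * \<zeta> else 0)"
    define A where "A = Delta (\<rho>\<^sup>2) $ i $ j - T - cos (\<rho> * of_real pi) * Om i j - 1 / 2 * Four \<rho> i j"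
    have b1: "norm A \<le> C1 / real n"
    proof -
      have "norm A \<le> K * exp (\<bar>Im \<rho>\<bar> * pi) / norm \<rho>" unfolding A_def T_def by (rule KR(3)[OF rR])
      also have "\<dots> \<le> K * exp pi / (real n / 2)"
      proof (rule frac_le)
        have "\<bar>Im \<rho>\<bar> * pi \<le> 1 * pi" using Im by (intro mult_right_mono) auto
        then show "K * exp (\<bar>Im \<rho>\<bar> * pi) \<le> K * exp pi" using KR(1) by (intro mult_left_mono) auto
      qed (use KR(1) n half in auto)
      finally show ?thesis by (simp add: C1_def mult_ac)
    qed
    have dpi: "norm (\<delta> * of_real pi) \<le> pi" using d1 by (simp add: norm_mult)
    have b2: "norm (T + (-1) ^ n * T') \<le> C2 / real n"
    proof (cases "i = j")
      case True
      define u where "u = \<delta> * of_real pi"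
      \<comment> \<open>Here \<rho> sin \<rho>\<pi> = (-1)^n \<rho> sin u, and \<zeta> =
        \<delta>(2\<rho> - \<delta>) gives \<pi>\<zeta>/2 = \<rho>u - \<pi>\<delta>^2/2. The terms
        linear in \<delta> cancel and the rest is quadratic.\<close>
      have "T + (-1) ^ n * T' = - ((-1) ^ n * (\<rho> * (sin u - u) + of_real pi * \<delta>\<^sup>2 / 2))"
      proof -
        have "sin (\<rho> * of_real pi) = (-1) ^ n * sin u" unfolding u_def rd by (rule cos_sin_int_shift(2))
        then have t1: "T = - ((-1) ^ n * (\<rho> * sin u))" using True by (simp add: T_def)
        have "T' = of_real pi / 2 * (\<delta> * (2 * \<rho> - \<delta>))" using True unfolding T'_def by (subst zfac) (simp add: rd)
        also have "\<dots> = of_real pi * \<delta> * \<rho> - of_real pi * (\<delta> * \<delta>) / 2" by (simp add: field_simps)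
        finally have t2: "T' = of_real pi * \<delta> * \<rho> - of_real pi * (\<delta> * \<delta>) / 2" .
        show ?thesis unfolding t1 t2 by (simp add: u_def algebra_simps power2_eq_square)
      qed
      then have "norm (T + (-1) ^ n * T') = norm (\<rho> * (sin u - u) + of_real pi * \<delta>\<^sup>2 / 2)"
        by (simp add: norm_mult norm_power)
      also have "\<dots> \<le> norm \<rho> * norm (sin u - u) + pi * (norm \<delta>)\<^sup>2 / 2"
        using norm_triangle_ineq[of "\<rho> * (sin u - u)" "of_real pi * \<delta>\<^sup>2 / 2"] by (simp add: norm_mult norm_power)
      also have "\<dots> \<le> (2 * real n) * (exp pi * (pi\<^sup>2 * (norm \<delta>)\<^sup>2)) + (2 * real n) * (pi * (norm \<delta>)\<^sup>2)"
      proof (rule add_mono)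
        show "norm \<rho> * norm (sin u - u) \<le> (2 * real n) * (exp pi * (pi\<^sup>2 * (norm \<delta>)\<^sup>2))"
        proof (rule mult_mono)
          have "norm u = norm \<delta> * pi" by (simp add: u_def norm_mult)
          then show "norm (sin u - u) \<le> exp pi * (pi\<^sup>2 * (norm \<delta>)\<^sup>2)"
            using sin_minus_self_le[of u pi] dpi by (simp add: u_def power_mult_distrib mult_ac)
        qed (use nr n in auto)
        have "pi * (norm \<delta>)\<^sup>2 * (1 / 2) \<le> pi * (norm \<delta>)\<^sup>2 * (2 * real n)"
          using n by (intro mult_left_mono) auto
        then show "pi * (norm \<delta>)\<^sup>2 / 2 \<le> (2 * real n) * (pi * (norm \<delta>)\<^sup>2)" by (simp add: mult_ac)
      qed
      also have "\<dots> = (2 * real n) * (exp pi * pi\<^sup>2 + pi) * (norm \<delta>)\<^sup>2" by (simp add: algebra_simps)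
      also have "\<dots> \<le> (2 * real n) * (exp pi * pi\<^sup>2 + pi) * (Z' / real n)\<^sup>2"
        using dn by (intro mult_left_mono power_mono) auto
      also have "\<dots> = C2 / real n" using n by (simp add: C2_def power2_eq_square field_simps)
      finally show ?thesis .
    next
      case False
      then show ?thesis using C0 by (simp add: T_def T'_def)
    qed
    have b3: "norm ((cos (\<rho> * of_real pi) - (-1) ^ n) * Om i j) \<le> C3 / real n"
    proof -
      have "cos (\<rho> * of_real pi) - (-1) ^ n = (-1) ^ n * (cos (\<delta> * of_real pi) - cos 0)"
        using cos_sin_int_shift(1)[of n \<delta>] by (simp add: rd algebra_simps)
      then have "norm (cos (\<rho> * of_real pi) - (-1) ^ n) = norm (cos (\<delta> * of_real pi) - cos 0)"
        by (simp add: norm_mult norm_power)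
      also have "\<dots> \<le> exp pi * norm (\<delta> * of_real pi - 0)"
        by (rule cos_diff_le) (use abs_Im_le_cmod[of "\<delta> * of_real pi"] dpi in auto)
      also have "\<dots> = exp pi * (pi * norm \<delta>)" by (simp add: norm_mult)
      also have "\<dots> \<le> exp pi * (pi * (Z' / real n))" using dn by (intro mult_left_mono) auto
      finally have "norm (cos (\<rho> * of_real pi) - (-1) ^ n) * norm (Om i j) \<le> exp pi * (pi * (Z' / real n)) * Om_sum"
        using Z' by (intro mult_mono Om_le) auto
      then show ?thesis by (simp add: norm_mult C3_def)
    qed
    have b4: "norm (1 / 2 * Four \<rho> i j) \<le> ?a + C4 / real n"
    proof -
      have "norm (Four \<rho> i j) \<le> ?a + exp pi * pi * Q1 * norm (\<rho> - of_nat n)"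
        by (rule Four_near_integer) (use d1 in \<open>simp add: \<delta>_def\<close>)
      also have "\<dots> \<le> ?a + exp pi * pi * Q1 * (Z' / real n)"
        using dn Q1_nonneg by (intro add_left_mono mult_left_mono) (auto simp: \<delta>_def)
      finally have "norm (Four \<rho> i j) \<le> ?a + C4 / real n" by (simp add: C4_def)
      moreover have "norm (1 / 2 * Four \<rho> i j) \<le> norm (Four \<rho> i j)" by (simp add: norm_mult)
      ultimately show ?thesis by linarith
    qed
    have "Delta ((of_nat n)\<^sup>2 + \<zeta>) $ i $ j - (-1) ^ n * (Om i j - T') =
      A + (T + (-1) ^ n * T') + (cos (\<rho> * of_real pi) - (-1) ^ n) * Om i j + 1 / 2 * Four \<rho> i j"
      unfolding sq A_def by (simp add: algebra_simps)
    also have "norm \<dots> \<le> C1 / real n + C2 / real n + C3 / real n + (?a + C4 / real n)"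
      by (intro norm_triangle_mono b1 b2 b3 b4)
    also have "\<dots> = C / real n + ?a" by (simp add: C_def add_divide_distrib)
    finally show "norm (Delta ((of_nat n)\<^sup>2 + \<zeta>) $ i $ j - (-1) ^ n * (Om i j - (if i = j then of_real pi / 2 * \<zeta> else 0)))
      \<le> C / real n + ?a" by (simp add: T'_def)
  qed
qed

text \<open>On the circle around n^2 + 2w/\<pi> every diagonal entry of the model matrix is at least
  \<pi>/2 times the radius in modulus, so a radius proportional to the entry error satisfies
  \<open>det_near_diagonal\<close>. It is square summable because 1/n and the cosine coefficients
  are.\<close>

lemma eigenvalue_local_count:
  assumes Om: "\<And>i j. Om i j = (if i = j then of_real (d i) else 0)"
  obtains r :: "nat \<Rightarrow> real" and n0 where "\<And>n. r n > 0" "summable (\<lambda>n. (r n)\<^sup>2)" "\<And>n. n \<ge> n0 \<Longrightarrow> r n \<le> 1"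
    "\<And>n i j. n \<ge> n0 \<Longrightarrow> d i \<noteq> d j \<Longrightarrow> pi * r n \<le> \<bar>d i - d j\<bar>"
    "\<And>n w. n \<ge> n0 \<Longrightarrow> w \<in> range d \<Longrightarrow>
      (\<Sum>p | p \<in> ball ((of_nat n)\<^sup>2 + of_real (2 * w / pi)) (r n) \<and> det (Delta p) = 0. zorder (\<lambda>\<mu>. det (Delta \<mu>)) p)
        = int (card {q. d q = w})"
proof -
  \<comment> \<open>Bounds |\<zeta>| on all the circles at once, as their radii are at most
    1.\<close>
  define Z where "Z = (\<Sum>i\<in>UNIV. \<bar>2 * d i / pi\<bar>) + 1"
  obtain C n1 where Cn: "C \<ge> 0" "n1 \<ge> 1"
    "\<And>n \<zeta> i j. n \<ge> n1 \<Longrightarrow> norm \<zeta> \<le> Z \<Longrightarrow>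
      norm (Delta ((of_nat n)\<^sup>2 + \<zeta>) $ i $ j - (-1) ^ n * (Om i j - (if i = j then of_real pi / 2 * \<zeta> else 0)))
      \<le> C / real n + norm (cos_coeff n i j)"
    by (rule Delta_near_square[of Z]) (rule that, assumption, assumption, blast)
  obtain \<eta> where eta: "\<eta> > 0" and det: "\<And>(d :: 'm \<Rightarrow> complex) (A :: complex^'m^'m).
       (\<And>i. d i \<noteq> 0) \<Longrightarrow> (\<And>i j. norm (A $ i $ j - (if i = j then d i else 0)) \<le> \<eta> * norm (d i)) \<Longrightarrow>
       norm (det A - (\<Prod>i\<in>UNIV. d i)) < norm (\<Prod>i\<in>UNIV. d i)"
    by (rule det_near_diagonal[where 'n='m]) (rule that, assumption, blast)
  define a where "a n = (\<Sum>i\<in>UNIV. \<Sum>j\<in>UNIV. norm (cos_coeff n i j))" for n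
  \<comment> \<open>The factor \<open>2 * C\<close> stems from 1/n <= 2/(n + 1), while the added 1
    keeps the radius positive even if all error terms vanish.\<close>
  define k where "k n = (2 * C + 1) * (1 / real (Suc n)) + a n" for n
  \<comment> \<open>Solves \<open>\<eta> * (pi / 2 * r n) = k n\<close>, with
    \<open>pi / 2 * r n\<close> the lower bound of the diagonal entries on the circle.\<close>
  define r where "r n = 2 / (pi * \<eta>) * k n" for n
  have a0: "a n \<ge> 0" for n unfolding a_def by (intro sum_nonneg) auto
  have k0: "k n > 0" for n unfolding k_def using Cn(1) a0[of n] by (intro add_pos_nonneg) auto
  have r0: "r n > 0" for n unfolding r_def using k0[of n] eta by simp
  have sa: "summable (\<lambda>n. (a n)\<^sup>2)" unfolding a_def by (intro summable_square_sum cos_coeff_l2)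
  have sr: "summable (\<lambda>n. (r n)\<^sup>2)"
    unfolding r_def k_def by (intro summable_square_cmult summable_square_add summable_square_inverse sa)
  have "(\<lambda>n. sqrt ((r n)\<^sup>2)) \<longlonglongrightarrow> sqrt 0" by (intro tendsto_real_sqrt summable_LIMSEQ_zero sr)
  then have rlim: "r \<longlonglongrightarrow> 0" using r0 by (simp add: less_imp_le)
  \<comment> \<open>Inserting \<open>pi\<close> keeps the minimum meaningful when all
    \<open>d i\<close> coincide.\<close>
  define \<gamma> where "\<gamma> = Min (insert pi ((\<lambda>(i, j). \<bar>d i - d j\<bar>) ` {(i, j). d i \<noteq> d j}))"
  have g0: "\<gamma> > 0" unfolding \<gamma>_def by (subst Min_gr_iff) auto
  have gap: "\<gamma> \<le> \<bar>d i - d j\<bar>" if "d i \<noteq> d j" for i j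
    unfolding \<gamma>_def by (rule Min_le) (use that in auto)
  have "\<forall>\<^sub>F n in sequentially. r n < min 1 (\<gamma> / pi)"
    using rlim by (rule order_tendstoD) (use g0 in auto)
  then obtain n2 where n2: "\<And>n. n \<ge> n2 \<Longrightarrow> r n < min 1 (\<gamma> / pi)" unfolding eventually_sequentially by blast
  show thesis
  proof (rule that[of r "max n1 n2"])
    show "r n > 0" for n by (rule r0)
    show "summable (\<lambda>n. (r n)\<^sup>2)" by (rule sr)
    show "r n \<le> 1" if "n \<ge> max n1 n2" for n using n2[of n] that by simp
    show sep: "pi * r n \<le> \<bar>d i - d j\<bar>" if "n \<ge> max n1 n2" "d i \<noteq> d j" for n i j
    proof -
      have "r n \<le> \<gamma> / pi" using n2[of n] that by simp
      then have "pi * r n \<le> \<gamma>" by (simp add: field_simps)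
      then show ?thesis using gap[OF that(2)] by linarith
    qed
    fix n w assume n: "n \<ge> max n1 n2" and w: "w \<in> range d"
    have nn: "n \<ge> n1" "n \<ge> n2" "n \<ge> 1" using n Cn(2) by auto
    have r1: "r n \<le> 1" using n2[OF nn(2)] by simp
    define s :: complex where "s = (-1) ^ n"
    have s: "s \<noteq> 0" "norm s = 1" by (auto simp: s_def norm_power)
    define f where "f z = (\<Prod>i\<in>(UNIV :: 'm set). s * (of_real (d i) - of_real pi / 2 * (z - (of_nat n)\<^sup>2)))" for z
    have "(\<Sum>p | p \<in> ball ((of_nat n)\<^sup>2 + of_real (2 * w / pi)) (r n) \<and> det (Delta p) = 0. zorder (\<lambda>\<mu>. det (Delta \<mu>)) p)
      = (\<Sum>p | p \<in> ball ((of_nat n)\<^sup>2 + of_real (2 * w / pi)) (r n) \<and> f p = 0. zorder f p)"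
    proof (rule rouche_ball)
      show "f holomorphic_on UNIV" unfolding f_def by (intro holomorphic_intros)
      show "(\<lambda>\<mu>. det (Delta \<mu>)) holomorphic_on UNIV" by (rule det_Delta_holomorphic)
      show "r n > 0" by (rule r0)
      fix z :: complex assume z: "norm (z - ((of_nat n)\<^sup>2 + of_real (2 * w / pi))) = r n"
      define \<zeta> where "\<zeta> = z - (of_nat n)\<^sup>2"
      have zz: "z = (of_nat n)\<^sup>2 + \<zeta>" by (simp add: \<zeta>_def)
      have nz: "norm (\<zeta> - of_real (2 * w / pi)) = r n" using z by (simp add: \<zeta>_def algebra_simps)
      have "\<bar>2 * w / pi\<bar> \<le> (\<Sum>i\<in>UNIV. \<bar>2 * d i / pi\<bar>)"
      proof -
        obtain i where "w = d i" using w by blast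
        then show ?thesis by (simp only:) (rule member_le_sum[of i UNIV "\<lambda>i. \<bar>2 * d i / pi\<bar>"], auto)
      qed
      then have zZ: "norm \<zeta> \<le> Z"
        using norm_triangle_sub[of \<zeta> "of_real (2 * w / pi)"] nz r1 unfolding Z_def norm_of_real by linarith
      \<comment> \<open>For \<open>d i = w\<close> this is an equality. Otherwise the separation
        \<open>pi * r n\<close> of the values exceeds the deviation \<open>pi / 2 * r n\<close> by
        the claimed amount.\<close>
      have low: "pi / 2 * r n \<le> norm (of_real (d i) - of_real pi / 2 * \<zeta>)" for i
      proof -
        have e: "of_real (d i) - of_real pi / 2 * \<zeta> = of_real (d i - w) - of_real pi / 2 * (\<zeta> - of_real (2 * w / pi))"
          by (simp add: field_simps)
        have n1: "norm (of_real pi / 2 * (\<zeta> - of_real (2 * w / pi))) = pi / 2 * r n"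
          unfolding norm_mult nz by simp
        show ?thesis
        proof (cases "d i = w")
          case True
          then show ?thesis unfolding e using n1 by simp
        next
          case False
          obtain j where "w = d j" using w by blast
          then have "pi * r n \<le> \<bar>d i - w\<bar>" using sep[OF n, of i j] False by simp
          also have "\<bar>d i - w\<bar> = norm (of_real (d i - w) :: complex)" by (simp only: norm_of_real)
          finally have "pi * r n \<le> norm (of_real (d i - w) :: complex)" .
          then show ?thesis unfolding e
            using norm_triangle_ineq2[of "of_real (d i - w)" "of_real pi / 2 * (\<zeta> - of_real (2 * w / pi))"] n1 by linarith
        qed
      qed
      have "norm (det (Delta z) - (\<Prod>i\<in>(UNIV :: 'm set). s * (of_real (d i) - of_real pi / 2 * \<zeta>))) <
         norm (\<Prod>i\<in>(UNIV :: 'm set). s * (of_real (d i) - of_real pi / 2 * \<zeta>))"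
      proof (rule det)
        have pos: "pi / 2 * r n > 0" using r0 by simp
        show "s * (of_real (d i) - of_real pi / 2 * \<zeta>) \<noteq> 0" for i
        proof -
          have "norm (of_real (d i) - of_real pi / 2 * \<zeta>) > 0" using low[of i] pos by linarith
          then have "of_real (d i) - of_real pi / 2 * \<zeta> \<noteq> 0" unfolding zero_less_norm_iff .
          then show ?thesis using s(1) mult_eq_0_iff by blast
        qed
        fix i j :: 'm
        have "norm (Delta z $ i $ j - (if i = j then s * (of_real (d i) - of_real pi / 2 * \<zeta>) else 0)) =
           norm (Delta ((of_nat n)\<^sup>2 + \<zeta>) $ i $ j - (-1) ^ n * (Om i j - (if i = j then of_real pi / 2 * \<zeta> else 0)))"
          by (simp add: zz s_def Om)
        also have "\<dots> \<le> C / real n + norm (cos_coeff n i j)"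
          by (rule Cn(3)[OF nn(1) zZ])
        also have "\<dots> \<le> (2 * C + 1) * (1 / real (Suc n)) + a n"
        proof (rule add_mono)
          have "1 / real n \<le> 2 / real (Suc n)" using nn(3) by (simp add: field_simps)
          then have "C * (1 / real n) \<le> C * (2 / real (Suc n))" by (rule mult_left_mono[OF _ Cn(1)])
          then have "C / real n \<le> C * (2 / real (Suc n))" by simp
          also have "\<dots> \<le> (2 * C + 1) * (1 / real (Suc n))" by (simp add: field_simps)
          finally show "C / real n \<le> (2 * C + 1) * (1 / real (Suc n))" .
          show "norm (cos_coeff n i j) \<le> a n"
          proof -
            have "norm (cos_coeff n i j) \<le> (\<Sum>j\<in>UNIV. norm (cos_coeff n i j))" by (rule member_le_sum) auto
            also have "\<dots> \<le> a n" unfolding a_def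
              by (rule member_le_sum[of i UNIV "\<lambda>i. \<Sum>j\<in>UNIV. norm (cos_coeff n i j)"]) (auto intro: sum_nonneg)
            finally show ?thesis .
          qed
        qed
        also have "\<dots> = k n" by (simp add: k_def)
        also have "\<dots> = \<eta> * (pi / 2 * r n)" using eta by (simp add: r_def)
        also have "\<dots> \<le> \<eta> * norm (of_real (d i) - of_real pi / 2 * \<zeta>)"
          using eta low[of i] by (intro mult_left_mono) auto
        also have "\<dots> = \<eta> * norm (s * (of_real (d i) - of_real pi / 2 * \<zeta>))" using s by (simp add: norm_mult)
        finally show "norm (Delta z $ i $ j - (if i = j then s * (of_real (d i) - of_real pi / 2 * \<zeta>) else 0)) \<le>
          \<eta> * norm (s * (of_real (d i) - of_real pi / 2 * \<zeta>))" .
      qed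
      then show "norm (det (Delta z) - f z) < norm (f z)" by (simp add: f_def \<zeta>_def)
    qed
    also have "\<dots> = int (card {q. d q = w})"
      unfolding f_def
    proof (rule linear_product_count[OF s(1) r0 w])
      fix i assume i: "d i \<noteq> w"
      obtain j where "w = d j" using w by blast
      then have "pi * r n \<le> \<bar>d i - w\<bar>" using sep[OF n, of i j] i by simp
      moreover have "pi / 2 * r n \<le> pi * r n" using r0[of n] by simp
      ultimately show "pi / 2 * r n \<le> \<bar>d i - w\<bar>" by linarith
    qed
    finally show "(\<Sum>p | p \<in> ball ((of_nat n)\<^sup>2 + of_real (2 * w / pi)) (r n) \<and> det (Delta p) = 0. zorder (\<lambda>\<mu>. det (Delta \<mu>)) p)
        = int (card {q. d q = w})" .
  qed
qed

end

section \<open>Numbering the eigenvalues\<close>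

text \<open>Each point p is replaced by \<open>mult p\<close> labelled copies; a bijection from
  \<open>A\<close> onto the copies, followed by forgetting the labels, has fibres of the prescribed
  size.\<close>

lemma fibre_assignment:
  fixes mult :: "'b \<Rightarrow> nat"
  assumes "finite A" "finite F" "(\<Sum>p\<in>F. mult p) = card A"
  obtains g where "\<And>a. a \<in> A \<Longrightarrow> g a \<in> F" "\<And>p. p \<in> F \<Longrightarrow> card {a \<in> A. g a = p} = mult p"
proof -
  let ?S = "SIGMA p:F. {..<mult p}"
  have "finite ?S" "card A = card ?S" using assms by simp_all
  then obtain e where e: "bij_betw e A ?S" using finite_same_card_bij[OF assms(1)] by blast
  show thesis
  proof (rule that[of "fst \<circ> e"])
    show "(fst \<circ> e) a \<in> F" if "a \<in> A" for a using bij_betw_apply[OF e that] by auto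
    fix p assume p: "p \<in> F"
    have inj: "inj_on e A" and img: "e ` A = ?S" using e by (auto simp: bij_betw_def)
    have "e ` {a \<in> A. (fst \<circ> e) a = p} = {p} \<times> {..<mult p}"
    proof (intro equalityI subsetI)
      fix x assume "x \<in> e ` {a \<in> A. (fst \<circ> e) a = p}"
      then obtain a where "a \<in> A" "fst (e a) = p" "x = e a" by auto
      moreover from this have "e a \<in> ?S" using img by blast
      ultimately show "x \<in> {p} \<times> {..<mult p}" by auto
    next
      fix x assume x: "x \<in> {p} \<times> {..<mult p}"
      then have "x \<in> e ` A" using p img by auto
      then obtain a where a: "a \<in> A" "x = e a" by blast
      then have "fst (e a) = p" using x by auto
      then show "x \<in> e ` {a \<in> A. (fst \<circ> e) a = p}" using a by simp
    qed
    then have "card (e ` {a \<in> A. (fst \<circ> e) a = p}) = mult p" by (simp add: card_cartesian_product_singleton)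
    moreover have "card (e ` {a \<in> A. (fst \<circ> e) a = p}) = card {a \<in> A. (fst \<circ> e) a = p}"
      by (rule card_image[OF inj_on_subset[OF inj]]) auto
    ultimately show "card {a \<in> A. (fst \<circ> e) a = p} = mult p" by simp
  qed
qed

text \<open>Applied in both directions it shows that the half-open annuli are disjoint, so that a
  modulus determines its n.\<close>

lemma annulus_unique:
  fixes x :: real and n n' :: nat
  assumes "(real n - 1 / 2)\<^sup>2 \<le> x" "x < (real n' + 1 / 2)\<^sup>2" "n \<ge> 1"
  shows "n \<le> n'"
proof -
  have "(real n - 1 / 2)\<^sup>2 < (real n' + 1 / 2)\<^sup>2" using assms by linarith
  then have "real n - 1 / 2 < real n' + 1 / 2" by (rule power2_less_imp_less) simp
  then show ?thesis by linarith
qed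

lemma annulus_exists:
  fixes x :: real
  assumes "(real n0 - 1 / 2)\<^sup>2 \<le> x" "n0 \<ge> 1"
  obtains n where "n \<ge> n0" "(real n - 1 / 2)\<^sup>2 \<le> x" "x < (real n + 1 / 2)\<^sup>2"
proof -
  define s where "s = sqrt x"
  have x0: "x \<ge> 0" using assms(1) order_trans zero_le_power2 by blast
  have s: "s \<ge> 0" "s\<^sup>2 = x" using x0 by (auto simp: s_def)
  define n where "n = nat \<lfloor>s + 1 / 2\<rfloor>"
  have "real n0 - 1 / 2 \<le> s" by (rule power2_le_imp_le) (use assms s in auto)
  then have n0: "int n0 \<le> \<lfloor>s + 1 / 2\<rfloor>" by linarith
  then have rn: "real n = of_int \<lfloor>s + 1 / 2\<rfloor>" by (simp add: n_def)
  have "n \<ge> n0" using n0 by (simp add: n_def)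
  moreover have "real n - 1 / 2 \<le> s" "s < real n + 1 / 2" unfolding rn by linarith+
  then have "(real n - 1 / 2)\<^sup>2 \<le> x" "x < (real n + 1 / 2)\<^sup>2"
    using s \<open>n \<ge> n0\<close> assms(2) unfolding s(2)[symmetric] by (auto intro!: power_mono power_strict_mono)
  ultimately show thesis by (rule that)
qed

context sturm_liouville
begin

definition mult :: "complex \<Rightarrow> nat" where
  "mult \<mu> = vec.dim {c. Delta \<mu> *v c = 0}"

lemma zorder_mult: "det (Delta p) = 0 \<Longrightarrow> zorder (\<lambda>\<mu>. det (Delta \<mu>)) p = int (mult p)"
  unfolding mult_def by (rule zorder_det_Delta)

lemma mult_pos:
  assumes "det (Delta p) = 0"
  shows "mult p > 0"
proof (rule ccontr)
  assume "\<not> mult p > 0"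
  then have "{c. Delta p *v c = 0} \<subseteq> {0}" unfolding mult_def by (simp add: vec.dim_eq_0)
  then show False using assms det_nonzero_iff_kernel[of "Delta p"] by blast
qed

lemma sum_zorder_mult:
  "(\<Sum>p | p \<in> S \<and> det (Delta p) = 0. zorder (\<lambda>\<mu>. det (Delta \<mu>)) p) = int (\<Sum>p | p \<in> S \<and> det (Delta p) = 0. mult p)"
  unfolding of_nat_sum by (rule sum.cong) (auto simp: zorder_mult)

text \<open>A counting argument: consecutive large discs differ by m eigenvalues, and the small
  discs inside the annulus already hold m. All eigenvalues in the annulus thus lie in the small
  discs, and those around 2w/\<pi> are numbered by the q with \<open>d q = w\<close>.\<close>

theorem eigenvalue_enumeration:
  assumes Om: "\<And>i j. Om i j = (if i = j then of_real (d i) else 0)"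
  obtains lam :: "nat \<Rightarrow> 'm \<Rightarrow> complex" and n0 and r :: "nat \<Rightarrow> real" where
    "enumerates_eigenvalues Q h H lam" "n0 \<ge> 1" "summable (\<lambda>n. (r n)\<^sup>2)" "\<And>n. n \<ge> n0 \<Longrightarrow> r n \<le> 1"
    "\<And>n q. n \<ge> n0 \<Longrightarrow> norm (lam n q - (of_nat n)\<^sup>2 - of_real (2 * d q / pi)) \<le> r n"
proof -
  obtain r :: "nat \<Rightarrow> real" and n1 where rn: "\<And>n. r n > 0" "summable (\<lambda>n. (r n)\<^sup>2)" "\<And>n. n \<ge> n1 \<Longrightarrow> r n \<le> 1"
    "\<And>n i j. n \<ge> n1 \<Longrightarrow> d i \<noteq> d j \<Longrightarrow> pi * r n \<le> \<bar>d i - d j\<bar>"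
    "\<And>n w. n \<ge> n1 \<Longrightarrow> w \<in> range d \<Longrightarrow>
      (\<Sum>p | p \<in> ball ((of_nat n)\<^sup>2 + of_real (2 * w / pi)) (r n) \<and> det (Delta p) = 0. zorder (\<lambda>\<mu>. det (Delta \<mu>)) p)
        = int (card {q. d q = w})"
    by (rule eigenvalue_local_count[OF Om]) (rule that, assumption+)
  obtain N0 where N0: "\<And>N. N \<ge> N0 \<Longrightarrow>
    (\<Sum>p | p \<in> ball 0 ((real N + 1 / 2)\<^sup>2) \<and> det (Delta p) = 0. zorder (\<lambda>\<mu>. det (Delta \<mu>)) p) = int ((N + 1) * CARD('m))"
    by (rule eigenvalue_count) (rule that, assumption)
  define Z where "Z = (\<Sum>i\<in>UNIV. \<bar>2 * d i / pi\<bar>) + 1"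
  have Z: "\<bar>2 * d i / pi\<bar> + 1 \<le> Z" for i
    unfolding Z_def using member_le_sum[of i UNIV "\<lambda>i. \<bar>2 * d i / pi\<bar>"] by simp
  obtain n2 :: nat where n2: "real n2 \<ge> Z + 1" using real_arch_simple by blast
  \<comment> \<open>\<open>N0 + 1\<close> allows the count to be used for n - 1 as well. From n >= Z
    + 1 it follows that the disc of radius \<open>Z\<close> around n^2 stays within the annulus from
    (n - 1/2)^2 to (n + 1/2)^2.\<close>
  define n0 where "n0 = max n1 (max (N0 + 1) n2)"
  have n0: "n0 \<ge> 1" "n0 \<ge> n1" "n0 \<ge> N0 + 1" "real n0 \<ge> Z + 1" using n2 by (auto simp: n0_def)
  define D where "D p = det (Delta p)" for p
  \<comment> \<open>A non-real number is no eigenvalue, so the determinant is not identically zero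
    and has finitely many zeros in every disc.\<close>
  obtain p1 where p1: "D p1 \<noteq> 0"
  proof (rule ccontr)
    assume "\<not> thesis"
    then have "D p = 0" for p using that by blast
    then have "cnj p = p" for p
      using det_nonzero_iff_kernel[of "Delta p"] Delta_kernel_real[of p] unfolding D_def by blast
    from this[of \<i>] show False by simp
  qed
  have fin: "finite {p. p \<in> ball a s \<and> D p = 0}" for a s
    by (rule finite_subset[OF _ entire_finite_zeros[OF det_Delta_holomorphic p1[unfolded D_def], of a s]]) (auto simp: D_def)
  define F where "F N = {p. p \<in> ball 0 ((real N + 1 / 2)\<^sup>2) \<and> D p = 0}" for N
  have F_count: "(\<Sum>p\<in>F N. mult p) = (N + 1) * CARD('m)" if "N \<ge> N0" for N
    using N0[OF that] unfolding sum_zorder_mult of_nat_eq_iff by (simp add: F_def D_def)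
  define ZB where "ZB n w = {p. p \<in> ball ((of_nat n)\<^sup>2 + of_real (2 * w / pi)) (r n) \<and> D p = 0}" for n w
  have ZB_count: "(\<Sum>p\<in>ZB n w. mult p) = card {q. d q = w}" if "n \<ge> n0" "w \<in> range d" for n w
    using rn(5)[of n w] that n0 unfolding sum_zorder_mult of_nat_eq_iff by (simp add: ZB_def D_def)
  have F_fin: "finite (F N)" and ZB_fin: "finite (ZB n w)" for N n w unfolding F_def ZB_def by (rule fin)+
  define ZT where "ZT n = F n - F (n - 1)" for n
  have ZT: "p \<in> ZT n \<longleftrightarrow> D p = 0 \<and> (real n - 1 / 2)\<^sup>2 \<le> norm p \<and> norm p < (real n + 1 / 2)\<^sup>2" if "n \<ge> n0" for n p
  proof -
    have "real (n - 1) + 1 / 2 = real n - 1 / 2" using that n0(1) by (simp add: of_nat_diff)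
    then show ?thesis unfolding ZT_def F_def by auto
  qed
  have ZT_count: "(\<Sum>p\<in>ZT n. mult p) = CARD('m)" if "n \<ge> n0" for n
  proof -
    have sub: "F (n - 1) \<subseteq> F n"
    proof
      fix p assume "p \<in> F (n - 1)"
      then have p: "norm p < (real (n - 1) + 1 / 2)\<^sup>2" "D p = 0" unfolding F_def by auto
      have "(real (n - 1) + 1 / 2)\<^sup>2 \<le> (real n + 1 / 2)\<^sup>2" by (intro power_mono) auto
      then have "norm p < (real n + 1 / 2)\<^sup>2" using p(1) by linarith
      then show "p \<in> F n" using p(2) unfolding F_def by simp
    qed
    have "(\<Sum>p\<in>ZT n. mult p) = (\<Sum>p\<in>F n. mult p) - (\<Sum>p\<in>F (n - 1). mult p)"
      unfolding ZT_def by (rule sum_diff_nat[OF F_fin sub])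
    also have "\<dots> = (n + 1) * CARD('m) - (n - 1 + 1) * CARD('m)"
      using that n0 by (subst (1 2) F_count) auto
    also have "\<dots> = CARD('m)" using that n0 by simp
    finally show ?thesis .
  qed
  have ZB_sub: "ZB n w \<subseteq> ZT n" if n: "n \<ge> n0" and w: "w \<in> range d" for n w
  proof
    fix p assume p: "p \<in> ZB n w"
    define \<zeta> where "\<zeta> = p - (of_nat n)\<^sup>2"
    have "norm (\<zeta> - of_real (2 * w / pi)) < r n"
      using p unfolding ZB_def \<zeta>_def by (simp add: dist_norm norm_minus_commute algebra_simps)
    moreover have "r n \<le> 1" using rn(3) n n0 by simp
    moreover obtain i where "w = d i" using w by blast
    then have "\<bar>2 * w / pi\<bar> + 1 \<le> Z" using Z by simp
    ultimately have zZ: "norm \<zeta> \<le> Z"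
      using norm_triangle_sub[of \<zeta> "of_real (2 * w / pi)"] unfolding norm_of_real by linarith
    have "norm p \<le> norm ((of_nat n)\<^sup>2 :: complex) + norm \<zeta>" "norm ((of_nat n)\<^sup>2 :: complex) - norm \<zeta> \<le> norm p"
      using norm_triangle_ineq[of "(of_nat n)\<^sup>2" \<zeta>] norm_diff_ineq[of "(of_nat n)\<^sup>2" \<zeta>] by (auto simp: \<zeta>_def)
    then have np: "norm p \<le> (real n)\<^sup>2 + Z" "(real n)\<^sup>2 - Z \<le> norm p" using zZ by (auto simp: norm_power)
    have "real n \<ge> Z + 1" using n n0(4) by linarith
    then have "(real n)\<^sup>2 + Z < (real n + 1 / 2)\<^sup>2" "(real n - 1 / 2)\<^sup>2 \<le> (real n)\<^sup>2 - Z"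
      by (auto simp: power2_eq_square algebra_simps)
    then show "p \<in> ZT n" unfolding ZT[OF n] using np p by (auto simp: ZB_def)
  qed
  have ZB_disj: "w = w'" if n: "n \<ge> n0" and w: "w \<in> range d" "w' \<in> range d" and p: "p \<in> ZB n w" "p \<in> ZB n w'" for n w w' p
  proof (rule ccontr)
    assume "w \<noteq> w'"
    obtain i j where ij: "w = d i" "w' = d j" using w by blast
    have "pi * r n \<le> \<bar>w - w'\<bar>" using rn(4)[of n i j] ij \<open>w \<noteq> w'\<close> n n0 by auto
    then have "2 * r n \<le> 2 * (\<bar>w - w'\<bar> / pi)" by (simp add: field_simps)
    also have "2 * (\<bar>w - w'\<bar> / pi) = \<bar>2 * w / pi - 2 * w' / pi\<bar>"
    proof -
      have e: "2 * w / pi - 2 * w' / pi = 2 * ((w - w') / pi)" by (simp add: field_simps)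
      show ?thesis unfolding e abs_mult abs_divide by simp
    qed
    also have "\<dots> = dist ((of_nat n)\<^sup>2 + of_real (2 * w / pi) :: complex) ((of_nat n)\<^sup>2 + of_real (2 * w' / pi))"
      unfolding dist_norm by (metis add_diff_cancel_left norm_of_real of_real_diff)
    also have "\<dots> < r n + r n"
      using p dist_triangle_less_add[of "(of_nat n)\<^sup>2 + of_real (2 * w / pi)" p "r n" "(of_nat n)\<^sup>2 + of_real (2 * w' / pi)" "r n"]
      unfolding ZB_def by (simp add: dist_commute)
    finally show False by simp
  qed
  \<comment> \<open>Multiplicities of zeros are positive, so a zero of the annulus outside the small
    discs would make its total exceed m.\<close>
  have ZT_eq: "ZT n = (\<Union>w\<in>range d. ZB n w)" if n: "n \<ge> n0" for n
  proof -
    have sub: "(\<Union>w\<in>range d. ZB n w) \<subseteq> ZT n" using ZB_sub[OF n] by blast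
    have finT: "finite (ZT n)" unfolding ZT_def using F_fin by blast
    have "(\<Sum>p\<in>(\<Union>w\<in>range d. ZB n w). mult p) = (\<Sum>w\<in>range d. \<Sum>p\<in>ZB n w. mult p)"
    proof (rule sum.UNION_disjoint)
      show "\<forall>w\<in>range d. \<forall>w'\<in>range d. w \<noteq> w' \<longrightarrow> ZB n w \<inter> ZB n w' = {}"
      proof (intro ballI impI)
        fix w w' assume w: "w \<in> range d" "w' \<in> range d" "w \<noteq> w'"
        show "ZB n w \<inter> ZB n w' = {}" using ZB_disj[OF n w(1,2)] w(3) by blast
      qed
    qed (use ZB_fin in auto)
    also have "\<dots> = (\<Sum>w\<in>range d. card {q. d q = w})" by (rule sum.cong) (auto simp: ZB_count[OF n])
    also have "\<dots> = card (\<Union>w\<in>range d. {q. d q = w})"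
      by (rule card_UN_disjoint[symmetric]) auto
    also have "(\<Union>w\<in>range d. {q. d q = w}) = UNIV" by auto
    finally have "(\<Sum>p\<in>ZT n - (\<Union>w\<in>range d. ZB n w). mult p) = 0"
      using sum_diff_nat[OF finite_subset[OF sub finT] sub, of mult] ZT_count[OF n] by simp
    then have "\<forall>p\<in>ZT n - (\<Union>w\<in>range d. ZB n w). mult p = 0" using finT by simp
    moreover have "mult p > 0" if "p \<in> ZT n" for p using that mult_pos[of p] ZT[OF n, of p] by (simp add: D_def)
    ultimately have "ZT n - (\<Union>w\<in>range d. ZB n w) = {}" by fastforce
    then show ?thesis using sub by blast
  qed
  \<comment> \<open>Within a cluster the order is arbitrary: any distribution over the indices q
    with \<open>d q = w\<close> that respects multiplicities will do, since all of them share the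
    same asymptotic centre.\<close>
  define P where "P n w g \<longleftrightarrow> (\<forall>q. d q = w \<longrightarrow> g q \<in> ZB n w) \<and> (\<forall>p\<in>ZB n w. card {q. d q = w \<and> g q = p} = mult p)"
    for n w and g :: "'m \<Rightarrow> complex"
  have ex: "\<exists>g. P n w g" if nw: "n \<ge> n0" "w \<in> range d" for n w
  proof -
    obtain g where "\<And>a. a \<in> {q. d q = w} \<Longrightarrow> g a \<in> ZB n w"
      "\<And>p. p \<in> ZB n w \<Longrightarrow> card {a \<in> {q. d q = w}. g a = p} = mult p"
      by (rule fibre_assignment[OF _ ZB_fin ZB_count[OF nw]]) (simp, rule that, blast, blast)
    then have "P n w g" unfolding P_def by simp
    then show ?thesis by blast
  qed
  define g where "g n w = (SOME g. P n w g)" for n w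
  have gP: "P n w (g n w)" if "n \<ge> n0" "w \<in> range d" for n w
    unfolding g_def by (rule someI_ex[OF ex[OF that]])
  have g: "g n w q \<in> ZB n w" if "n \<ge> n0" "w \<in> range d" "d q = w" for n w q
    using gP[OF that(1,2)] that(3) unfolding P_def by blast
  have g': "card {q. d q = w \<and> g n w q = p} = mult p" if "n \<ge> n0" "w \<in> range d" "p \<in> ZB n w" for n w p
    using gP[OF that(1,2)] that(3) unfolding P_def by blast
  define G where "G n q = g n (d q) q" for n q
  have G_in: "G n q \<in> ZB n (d q)" if "n \<ge> n0" for n q unfolding G_def using g[OF that] by blast
  have G_fibre: "card {q. G n q = p} = mult p" if n: "n \<ge> n0" and p: "p \<in> ZT n" for n p
  proof -
    obtain w where w: "w \<in> range d" "p \<in> ZB n w" using p ZT_eq[OF n] by blast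
    have "{q. G n q = p} = {q. d q = w \<and> g n w q = p}"
      using ZB_disj[OF n _ w(1) _ w(2)] G_in[OF n] by (auto simp: G_def)
    then show ?thesis using g'[OF n w] by simp
  qed
  have F0: "(\<Sum>p\<in>F (n0 - 1). mult p) = card ({..<n0} \<times> (UNIV :: 'm set))"
    using F_count[of "n0 - 1"] n0 by simp
  \<comment> \<open>The first n0 * m eigenvalues are distributed arbitrarily over the indices n <
    n0; finitely many terms affect no summability.\<close>
  obtain f where f: "\<And>a. a \<in> {..<n0} \<times> (UNIV :: 'm set) \<Longrightarrow> f a \<in> F (n0 - 1)"
    "\<And>p. p \<in> F (n0 - 1) \<Longrightarrow> card {a \<in> {..<n0} \<times> (UNIV :: 'm set). f a = p} = mult p"
    by (rule fibre_assignment[OF _ F_fin F0]) (simp, rule that, assumption+)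
  have F0_iff: "p \<in> F (n0 - 1) \<longleftrightarrow> D p = 0 \<and> norm p < (real n0 - 1 / 2)\<^sup>2" for p
  proof -
    have "real (n0 - 1) + 1 / 2 = real n0 - 1 / 2" using n0(1) by (simp add: of_nat_diff)
    then show ?thesis unfolding F_def by auto
  qed
  define lam where "lam n q = (if n < n0 then f (n, q) else G n q)" for n q
  have lam_low: "lam n q \<in> F (n0 - 1)" if "n < n0" for n q using f(1)[of "(n, q)"] that by (simp add: lam_def)
  have lam_high: "lam n q \<in> ZT n" if "n \<ge> n0" for n q
    using G_in[OF that] ZB_sub[OF that, of "d q"] that by (auto simp: lam_def)
  have high_ge: "(real n0 - 1 / 2)\<^sup>2 \<le> norm p" if n: "n \<ge> n0" and p: "p \<in> ZT n" for n p
  proof -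
    have "(real n0 - 1 / 2)\<^sup>2 \<le> (real n - 1 / 2)\<^sup>2" using n n0(1) by (intro power_mono) auto
    then show ?thesis using p unfolding ZT[OF n] by linarith
  qed
  \<comment> \<open>A zero lies either in the low disc or in exactly one annulus, so all its
    occurrences in the list come from a single block, whose fibres are already counted.\<close>
  have fib: "finite {(n, q). lam n q = z} \<and> card {(n, q). lam n q = z} = mult z" if z: "D z = 0" for z
  proof (cases "norm z < (real n0 - 1 / 2)\<^sup>2")
    case True
    then have zF: "z \<in> F (n0 - 1)" using z F0_iff by blast
    have "{(n, q). lam n q = z} = {a \<in> {..<n0} \<times> (UNIV :: 'm set). f a = z}"
    proof (intro equalityI subsetI)
      fix a assume "a \<in> {(n, q). lam n q = z}"
      then obtain n q where a: "a = (n, q)" "lam n q = z" by auto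
      have "n < n0"
      proof (rule ccontr)
        assume "\<not> n < n0"
        then show False using high_ge[of n z] lam_high[of n q] a True by simp
      qed
      then show "a \<in> {a \<in> {..<n0} \<times> (UNIV :: 'm set). f a = z}" using a by (simp add: lam_def)
    qed (auto simp: lam_def)
    then show ?thesis using f(2)[OF zF] by (simp add: finite_subset[of _ "{..<n0} \<times> (UNIV :: 'm set)"])
  next
    case False
    then obtain n where n: "n \<ge> n0" "(real n - 1 / 2)\<^sup>2 \<le> norm z" "norm z < (real n + 1 / 2)\<^sup>2"
      using annulus_exists[of n0 "norm z"] n0(1) by (metis not_less)
    have zT: "z \<in> ZT n" using ZT[OF n(1)] n z by blast
    have "{(n, q). lam n q = z} = {n} \<times> {q. G n q = z}"
    proof (intro equalityI subsetI)
      fix a assume "a \<in> {(n, q). lam n q = z}"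
      then obtain n' q where a: "a = (n', q)" "lam n' q = z" by auto
      have n': "n' \<ge> n0"
      proof (rule ccontr)
        assume "\<not> n' \<ge> n0"
        then show False using lam_low[of n' q] F0_iff[of z] a False by simp
      qed
      then have "z \<in> ZT n'" using lam_high a by blast
      then have "(real n' - 1 / 2)\<^sup>2 \<le> norm z" "norm z < (real n' + 1 / 2)\<^sup>2" using ZT[OF n'] by auto
      then have "n' = n" using annulus_unique[of n' "norm z" n] annulus_unique[of n "norm z" n'] n n' n0(1) by simp
      then show "a \<in> {n} \<times> {q. G n q = z}" using a n' by (simp add: lam_def)
    next
      fix a assume "a \<in> {n} \<times> {q. G n q = z}"
      then show "a \<in> {(n, q). lam n q = z}" using n(1) by (auto simp: lam_def)
    qed
    then show ?thesis using G_fibre[OF n(1) zT] by (simp add: card_cartesian_product_singleton)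
  qed
  have lam_D: "D (lam n q) = 0" for n q
  proof (cases "n < n0")
    case True
    then show ?thesis using lam_low[of n q] F0_iff by blast
  next
    case False
    then show ?thesis using lam_high[of n q] ZT[of n] by simp
  qed
  have "enumerates_eigenvalues Q h H lam"
    unfolding enumerates_eigenvalues_def is_eigenvalue_det multiplicity_eq mult_def[symmetric] D_def[symmetric]
  proof (intro conjI allI impI)
    show "{z. D z = 0} = {lam n q |n q. True}"
    proof (intro equalityI subsetI)
      fix z assume "z \<in> {z. D z = 0}"
      then have z: "D z = 0" by simp
      then have "card {(n, q). lam n q = z} > 0" using fib[OF z] mult_pos[of z] by (simp add: D_def)
      then have "{(n, q). lam n q = z} \<noteq> {}" by (metis card.empty less_irrefl)
      then show "z \<in> {lam n q |n q. True}" by blast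
    qed (use lam_D in auto)
  qed (use fib in blast)+
  moreover have "norm (lam n q - (of_nat n)\<^sup>2 - of_real (2 * d q / pi)) \<le> r n" if "n \<ge> n0" for n q
  proof -
    have "lam n q \<in> ZB n (d q)" using G_in[OF that] that by (simp add: lam_def)
    then have "dist ((of_nat n)\<^sup>2 + of_real (2 * d q / pi)) (lam n q) < r n" by (simp add: ZB_def)
    then show ?thesis by (simp add: dist_norm norm_minus_commute algebra_simps)
  qed
  ultimately show thesis
    using that[of lam n0 r] n0 rn(2,3) by auto
qed

end

text \<open>From \<zeta> = \<delta>(\<delta> + 2n) follows n\<delta> = \<zeta>/2 - \<delta>^2/2.
  Half the deviation of \<zeta> from 2x/\<pi> is controlled by r, and \<delta>^2 = O(1/n^2) is
  weakened to a multiple of 1/(n + 1).\<close>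

lemma csqrt_remainder:
  fixes n :: nat and \<zeta> :: complex
  assumes n: "n \<ge> 1" and z: "norm \<zeta> \<le> Z" and x: "norm (\<zeta> - of_real (2 * x / pi)) \<le> r"
  shows "norm (of_nat n * (csqrt ((of_nat n)\<^sup>2 + \<zeta>) - of_nat n) - of_real x / of_real pi) \<le> r + 2 * Z\<^sup>2 * (1 / real (Suc n))"
proof -
  define \<rho> where "\<rho> = csqrt ((of_nat n)\<^sup>2 + \<zeta>)"
  define \<delta> where "\<delta> = \<rho> - of_nat n"
  note near = csqrt_near_square[OF n, of \<zeta>, folded \<rho>_def]
  have zf: "\<zeta> = \<delta> * (\<delta> + 2 * of_nat n)" using near(2) by (simp add: \<delta>_def algebra_simps)
  have "norm \<delta> \<le> norm \<zeta> / real n" using near(1) by (simp add: \<delta>_def)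
  also have "\<dots> \<le> Z / real n" using z by (intro divide_right_mono) auto
  finally have dn: "norm \<delta> \<le> Z / real n" .
  have "(norm \<delta>)\<^sup>2 \<le> (Z / real n)\<^sup>2" using dn by (intro power_mono) auto
  also have "\<dots> = Z\<^sup>2 * (1 / (real n)\<^sup>2)" by (simp add: power_divide)
  also have "\<dots> \<le> Z\<^sup>2 * (2 / real (Suc n))"
  proof (rule mult_left_mono)
    have "real n \<ge> 1" using n by simp
    moreover from this have "real n * 1 \<le> real n * real n" by (intro mult_left_mono) auto
    ultimately have "real (Suc n) \<le> 2 * (real n)\<^sup>2" unfolding power2_eq_square of_nat_Suc by linarith
    then show "1 / (real n)\<^sup>2 \<le> 2 / real (Suc n)" using n by (simp add: field_simps)
  qed simp
  finally have d2: "(norm \<delta>)\<^sup>2 \<le> 2 * Z\<^sup>2 * (1 / real (Suc n))" by (simp add: mult.commute)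
  have "of_nat n * \<delta> - of_real x / of_real pi = (\<zeta> - of_real (2 * x / pi)) / 2 - \<delta>\<^sup>2 / 2"
    by (subst zf) (simp add: field_simps power2_eq_square)
  then have "norm (of_nat n * \<delta> - of_real x / of_real pi) \<le> norm (\<zeta> - of_real (2 * x / pi)) / 2 + (norm \<delta>)\<^sup>2 / 2"
    using norm_triangle_ineq4[of "(\<zeta> - of_real (2 * x / pi)) / 2" "\<delta>\<^sup>2 / 2"] by (simp add: norm_divide norm_power)
  also have "\<dots> \<le> r + 2 * Z\<^sup>2 * (1 / real (Suc n))"
  proof (rule add_mono)
    show "norm (\<zeta> - of_real (2 * x / pi)) / 2 \<le> r"
      by (rule order_trans[OF _ x]) simp
    show "(norm \<delta>)\<^sup>2 / 2 \<le> 2 * Z\<^sup>2 * (1 / real (Suc n))"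
      by (rule order_trans[OF _ d2]) simp
  qed
  finally show ?thesis by (simp add: \<delta>_def \<rho>_def)
qed

theorem lemma1:
  fixes Q :: "real \<Rightarrow> complex^('m::{finite,linorder})^('m::{finite,linorder})"
    and h H \<omega> :: "complex^('m::{finite,linorder})^('m::{finite,linorder})"
  assumes "selfadjoint_problem Q h H"
    and "class_A \<omega> Q h H"
    and "\<omega> \<in> diag_D"
  shows "\<exists>lam :: nat \<Rightarrow> 'm \<Rightarrow> complex.
    enumerates_eigenvalues Q h H lam \<and>
    (\<exists>\<kappa> :: nat \<Rightarrow> 'm \<Rightarrow> complex.
      (\<forall>q. summable (\<lambda>n. (norm (\<kappa> n q))\<^sup>2)) \<and>
      (\<forall>n\<ge>1. \<forall>q. csqrt (lam n q) =
         of_nat n + \<omega> $ q $ q / (of_real pi * of_nat n) + \<kappa> n q / of_nat n))"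
proof -
  interpret L: sturm_liouville Q h H by (rule sturm_liouville.intro) (rule assms(1))
  obtain d :: "'m \<Rightarrow> real" where omega: "\<omega> = (\<chi> i j. if i = j then complex_of_real (d i) else 0)"
    using assms(3) unfolding diag_D_def by blast
  have Om: "L.Om i j = (if i = j then of_real (d i) else 0)" for i j
    using L.class_A_Om[OF assms(2)] by (simp add: omega)
  have diag: "\<omega> $ q $ q = of_real (d q)" for q by (simp add: omega)
  obtain lam :: "nat \<Rightarrow> 'm \<Rightarrow> complex" and n0 and r :: "nat \<Rightarrow> real" where
    lam: "enumerates_eigenvalues Q h H lam" "n0 \<ge> 1" "summable (\<lambda>n. (r n)\<^sup>2)" "\<And>n. n \<ge> n0 \<Longrightarrow> r n \<le> 1"
    "\<And>n q. n \<ge> n0 \<Longrightarrow> norm (lam n q - (of_nat n)\<^sup>2 - of_real (2 * d q / pi)) \<le> r n"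
    by (rule L.eigenvalue_enumeration[OF Om]) (rule that, assumption+)
  \<comment> \<open>Solving the claimed expansion for \<kappa> makes it hold for every n >= 1 at
    once; only square summability of the tail n >= n0 carries content. The value at n = 0 is a
    default.\<close>
  define \<kappa> where "\<kappa> n q = (if n = 0 then 0 else of_nat n * (csqrt (lam n q) - of_nat n) - \<omega> $ q $ q / of_real pi)" for n q
  have "summable (\<lambda>n. (norm (\<kappa> n q))\<^sup>2)" for q
  proof -
    define Z where "Z = \<bar>2 * d q / pi\<bar> + 1"
    show ?thesis
    proof (rule summable_comparison_test'[of "\<lambda>n. (r n + 2 * Z\<^sup>2 * (1 / real (Suc n)))\<^sup>2" n0])
      show "summable (\<lambda>n. (r n + 2 * Z\<^sup>2 * (1 / real (Suc n)))\<^sup>2)"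
        by (intro summable_square_add summable_square_cmult summable_square_inverse lam(3))
      fix n assume n: "n \<ge> n0"
      define \<zeta> where "\<zeta> = lam n q - (of_nat n)\<^sup>2"
      have z: "norm (\<zeta> - of_real (2 * d q / pi)) \<le> r n" using lam(5)[OF n] by (simp add: \<zeta>_def)
      have "norm \<zeta> \<le> Z"
        using norm_triangle_sub[of \<zeta> "of_real (2 * d q / pi)"] z lam(4)[OF n] unfolding Z_def norm_of_real by linarith
      from csqrt_remainder[OF _ this z, of n]
      have "norm (\<kappa> n q) \<le> r n + 2 * Z\<^sup>2 * (1 / real (Suc n))"
        using n lam(2) by (simp add: \<kappa>_def diag \<zeta>_def)
      then show "norm ((norm (\<kappa> n q))\<^sup>2) \<le> (r n + 2 * Z\<^sup>2 * (1 / real (Suc n)))\<^sup>2"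
        by (simp add: power_mono)
    qed
  qed
  moreover have "csqrt (lam n q) = of_nat n + \<omega> $ q $ q / (of_real pi * of_nat n) + \<kappa> n q / of_nat n" if "n \<ge> 1" for n q
    using that by (simp add: \<kappa>_def field_simps)
  ultimately show ?thesis using lam(1) by blast
qed

end
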